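(* Let $E \subset \mathbb{R}^d$, $d \ge 2$, be of Hausdorff dimension $s$ greater than $d-1$. Let $\nu$ denote the probability measure on $\mathcal{D}(E)$ given by the relation $$\int h(\omega)\, d\nu(\omega) = \int\int h\left(\frac{x-y}{|x-y|}\right) d\mu(x)\, d\mu(y),$$ where $\mu$ is a Frostman measure on $E$, and let $\nu^{\Theta}$ denote the same measure corresponding to the set $E^{\Theta} = \{\Theta x : x \in E\}$, where $\Theta \in O(d)$, the orthogonal group. Let $\nu^{\Theta}_{\epsilon}(\omega) = \epsilon^{-(d-1)}\, \nu^{\Theta}(B(\omega,\epsilon))$, where $B(\omega,\epsilon)$ is the ball of radius $\epsilon$ centered at $\omega \in S^{d-1}$. Then $$\nu^{\Theta}_{\epsilon}(\omega) = M^{\Theta}(\omega) + R^{\Theta}_{\epsilon}(\omega),$$ where $$\int \sup_{0<\epsilon<c} |R^{\Theta}_{\epsilon}(\omega)|\, d\omega \lesssim c^{\,s-(d-1)},$$ $$\int M^{\Theta}(\omega)\, d\omega \lesssim 1,$$ and there exists $\Theta_0 \in O(d)$ such that $$\int M^{\Theta_0}(\omega)\, d\omega \gtrsim 1.$$ In particular, $\sigma(\mathcal{D}(E)) > 0$, where $\sigma$ denotes the Lebesgue measure on $S^{d-1}$.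
   Context: For $E \subset \mathbb{R}^d$, $d \ge 2$, the set of directions determined by $E$ is $\mathcal{D}(E) = \left\{ \frac{x-y}{|x-y|} : x,y \in E,\ x \neq y \right\} \subset S^{d-1}$, where $S^{d-1}$ is the unit sphere. The number $s$ is the Hausdorff dimension of $E$. A Frostman measure on $E$ is a probability measure $\mu$ on $E$ satisfying the Frostman condition $\mu(B_r) \le C_0 r^{s}$ for balls $B_r$ of radius $r$, with a constant $C_0$. The measure $\nu^{\Theta}$ is defined by the same formula as $\nu$, with $\mu$ replaced by its image on $E^{\Theta}$ under $x \mapsto \Theta x$. The letter $c$ denotes the positive upper endpoint of the range of $\epsilon$ in the supremum. $X \lesssim Y$ (equivalently $Y \gtrsim X$) means $X \le CY$ for a constant $C>0$ independent of $\epsilon$ and $c$.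
   Formalization: The Frostman measure μ is additionally assumed to be carried by a bounded part of E, since for unbounded support the estimate on the supremum of |R| can fail; for non-measurable D(E), σ(D(E)) > 0 is meant as outer measure. *)

theory Defs
  imports "HOL-Probability.Probability"
begin

section \<open>Hausdorff dimension\<close>

text \<open>
  The gauge is \<open>(diam U)\<^sup>t\<close>, with the usual conventions that the empty set contributes \<open>0\<close>
  and that \<open>(diam U)\<^sup>0 = 1\<close> for nonempty \<open>U\<close>; the latter needs a case of its own because
  \<open>0 powr 0 = 0\<close>.
\<close>

definition hausdorff_gauge :: "real \<Rightarrow> 'a::metric_space set \<Rightarrow> ennreal" where
  "hausdorff_gauge t U =
     (if U = {} then 0 else if t = 0 then 1 else ennreal (diameter U powr t))"

text \<open>
  Covering sets are required to be bounded because \<^const>\<open>diameter\<close> is real-valued and carries no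
  information on unbounded sets.
\<close>

definition hausdorff_premeasure :: "real \<Rightarrow> real \<Rightarrow> 'a::metric_space set \<Rightarrow> ennreal" where
  "hausdorff_premeasure \<delta> t E =
     (INF U \<in> {U :: nat \<Rightarrow> 'a set. E \<subseteq> (\<Union>i. U i) \<and> (\<forall>i. bounded (U i) \<and> diameter (U i) \<le> \<delta>)}.
        \<Sum>i. hausdorff_gauge t (U i))"

definition hausdorff_measure :: "real \<Rightarrow> 'a::metric_space set \<Rightarrow> ennreal" where
  "hausdorff_measure t E = (SUP \<delta> \<in> {0<..}. hausdorff_premeasure \<delta> t E)"

definition hausdorff_dim :: "'a::metric_space set \<Rightarrow> ereal" where
  "hausdorff_dim E = (INF t \<in> {t. 0 \<le> t \<and> hausdorff_measure t E = 0}. ereal t)"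

section \<open>Lebesgue measure on the unit sphere\<close>

text \<open>
  The surface measure of polar coordinates: \<open>\<sigma> A\<close> is \<open>d\<close> times the volume of the cone
  \<open>{r \<omega> | 0 < r < 1, \<omega> \<in> A}\<close>.
\<close>

definition sphere_measure :: "'a::euclidean_space measure" where
  "sphere_measure = scale_measure (of_nat DIM('a))
     (distr (restrict_space lborel (ball 0 1 - {0})) (restrict_space borel (sphere 0 1))
        (\<lambda>x. x /\<^sub>R norm x))"

lemma space_sphere_measure: "space (sphere_measure :: 'a::euclidean_space measure) = sphere 0 1"
  by (simp add: sphere_measure_def space_scale_measure space_restrict_space)

lemma emeasure_sphere_measure:
  fixes A :: "'a::euclidean_space set"
  assumes "A \<in> sets borel" "A \<subseteq> sphere 0 1"
  shows "emeasure sphere_measure A =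
    of_nat DIM('a) * emeasure lborel {x \<in> ball 0 1 - {0}. x /\<^sub>R norm x \<in> A}"
proof -
  have m: "(\<lambda>x. x /\<^sub>R norm x) \<in>
      restrict_space lborel (ball 0 1 - {0}) \<rightarrow>\<^sub>M restrict_space borel (sphere (0::'a) 1)"
    by (rule measurable_restrict_space2)
      (auto simp: space_restrict_space intro!: measurable_restrict_space1)
  have eq: "(\<lambda>x. x /\<^sub>R norm x) -` A \<inter> (ball 0 1 - {0}) = {x \<in> ball 0 1 - {0}. x /\<^sub>R norm x \<in> A}"
    by auto
  have A: "A \<in> sets (restrict_space borel (sphere 0 1))"
    using assms by (auto simp: sets_restrict_space_iff)
  have "emeasure (restrict_space lborel (ball 0 1 - {0})) {x \<in> ball 0 1 - {0}. x /\<^sub>R norm x \<in> A} =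
      emeasure lborel {x \<in> ball 0 1 - {0}. x /\<^sub>R norm x \<in> A}"
    by (rule emeasure_restrict_space) auto
  then show ?thesis
    unfolding sphere_measure_def emeasure_scale_measure emeasure_distr[OF m A]
    by (simp only: space_restrict_space eq space_lborel space_borel Int_UNIV_right)
qed

section \<open>Directions, Frostman measures and direction measures\<close>

definition directions :: "'a::real_normed_vector set \<Rightarrow> 'a set" where
  "directions E = {(x - y) /\<^sub>R norm (x - y) | x y. x \<in> E \<and> y \<in> E \<and> x \<noteq> y}"

text \<open>
  No measurability of \<open>E\<close> is required: a measure on \<open>E\<close> lives on the trace of the Borel sigma-algebra
  on \<open>E\<close>.  As is usual for Frostman measures, the mass is carried by a bounded part of \<open>E\<close>.  For
  unbounded support the maximal estimate for \<open>R\<close> fails: if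
  \<open>\<mu>\<close> has pieces of mass \<open>\<approx> k\<^sup>-\<^sup>2\<close> at distance \<open>\<approx> exp (2\<^sup>k)\<close> from the origin, in well separated
  directions, then the left-hand side is infinite for every \<open>c\<close>.
\<close>

definition frostman_measure :: "real \<Rightarrow> 'a::euclidean_space set \<Rightarrow> 'a measure \<Rightarrow> bool" where
  "frostman_measure s E \<mu> \<longleftrightarrow>
     sets \<mu> = sets (restrict_space borel E) \<and> prob_space \<mu> \<and>
     (\<exists>\<rho>. measure \<mu> (ball 0 \<rho> \<inter> E) = 1) \<and>
     (\<exists>C\<^sub>0>0. \<forall>x. \<forall>r>0. measure \<mu> (ball x r \<inter> E) \<le> C\<^sub>0 * r powr s)"

text \<open>
  The diagonal \<open>x = y\<close> is sent to \<open>0\<close>, which is harmless since it is null for the product of a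
  Frostman measure of positive exponent with itself.
\<close>

definition direction_measure :: "'a::euclidean_space measure \<Rightarrow> 'a measure" where
  "direction_measure \<mu> =
     distr (\<mu> \<Otimes>\<^sub>M \<mu>) borel (\<lambda>(x, y). (x - y) /\<^sub>R norm (x - y))"

lemma measurable_direction:
  assumes "sets \<mu> = sets (restrict_space borel (E :: 'a::euclidean_space set))"
  shows "(\<lambda>(x, y). (x - y) /\<^sub>R norm (x - y)) \<in> (\<mu> \<Otimes>\<^sub>M \<mu>) \<rightarrow>\<^sub>M borel"
proof -
  have "(\<lambda>x. x) \<in> restrict_space borel E \<rightarrow>\<^sub>M borel"
    by (rule measurable_restrict_space1) simp
  then have id: "(\<lambda>x. x) \<in> \<mu> \<rightarrow>\<^sub>M borel"
    by (simp only: measurable_cong_sets[OF assms refl])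
  have [measurable]: "fst \<in> (\<mu> \<Otimes>\<^sub>M \<mu>) \<rightarrow>\<^sub>M borel" "snd \<in> (\<mu> \<Otimes>\<^sub>M \<mu>) \<rightarrow>\<^sub>M borel"
    by (rule measurable_compose[OF measurable_fst id], rule measurable_compose[OF measurable_snd id])
  show ?thesis
    unfolding case_prod_beta by measurable
qed

lemma nn_integral_direction_measure:
  fixes h :: "'a::euclidean_space \<Rightarrow> ennreal"
  assumes "frostman_measure s E \<mu>" and h: "h \<in> borel_measurable borel"
  shows "(\<integral>\<^sup>+\<omega>. h \<omega> \<partial>direction_measure \<mu>) =
    (\<integral>\<^sup>+y. (\<integral>\<^sup>+x. h ((x - y) /\<^sub>R norm (x - y)) \<partial>\<mu>) \<partial>\<mu>)"
proof -
  have sets: "sets \<mu> = sets (restrict_space borel E)" and "prob_space \<mu>"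
    using assms by (auto simp: frostman_measure_def)
  then interpret prob_space \<mu> by simp
  interpret pair_sigma_finite \<mu> \<mu> ..
  note d = measurable_direction[OF sets]
  have f: "(\<lambda>(x, y). h ((x - y) /\<^sub>R norm (x - y))) \<in> borel_measurable (\<mu> \<Otimes>\<^sub>M \<mu>)"
    using measurable_compose[OF d h] by (simp add: case_prod_beta)
  show ?thesis
    unfolding direction_measure_def
    using nn_integral_snd[OF f]
    by (simp add: nn_integral_distr[OF d] h) (simp add: case_prod_beta')
qed

text \<open>The direction measure \<open>\<nu>\<^sup>\<Theta>\<close> of the image of \<open>\<mu>\<close> on \<open>E\<^sup>\<Theta> = \<Theta> ` E\<close>.\<close>

definition rotated_direction_measure ::
    "('a::euclidean_space \<Rightarrow> 'a) \<Rightarrow> 'a set \<Rightarrow> 'a measure \<Rightarrow> 'a measure" where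
  "rotated_direction_measure \<Theta> E \<mu> =
     direction_measure (distr \<mu> (restrict_space borel (\<Theta> ` E)) \<Theta>)"

definition direction_average :: "'a::euclidean_space measure \<Rightarrow> real \<Rightarrow> 'a \<Rightarrow> real" where
  "direction_average \<nu> \<epsilon> \<omega> = measure \<nu> (ball \<omega> \<epsilon>) / \<epsilon> ^ (DIM('a) - 1)"

end

theory Submission
  imports Defs
begin

text \<open>
  Let \<open>A\<close> be the distribution of \<open>x - y\<close> under \<open>\<mu> \<times> \<mu>\<close>.  In polar coordinates, the direction of
  \<open>x - y\<close> has, at least formally, the density \<open>f(\<omega>) = \<integral> A(r\<omega>) r\<^sup>d\<^sup>-\<^sup>1 dr\<close> with respect to surface measure.  If \<open>f\<close> exists
  as an integrable function, then \<open>\<nu>\<^sub>\<epsilon>\<close> is essentially the average of \<open>f\<close> over caps of radius \<open>\<epsilon>\<close>, so the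
  main term is \<open>M = v f\<close> with \<open>v\<close> the limit of the normalised area of caps.  The maximal estimate for
  the remainder then expresses that \<open>f\<close> has \<open>a = s - (d - 1)\<close> derivatives in \<open>L\<^sup>1\<close>, uniformly over
  scales.

  The regularity of \<open>f\<close> comes from the fact that the Fourier transform of \<open>A\<close>, the square
  \<open>P(\<xi>) = |\<mu>^(\<xi>)|\<^sup>2\<close>, is nonnegative.  Convolving \<open>A\<close> with a Gaussian at scale \<open>\<rho>\<close> gives
  \<open>m\<^sub>\<rho>(\<omega>) = (2\<pi>)\<^sup>-\<^sup>d \<integral> P(\<xi>) exp(-\<rho>\<^sup>2|\<xi>|\<^sup>2/2) W(\<xi> \<bullet> \<omega>) d\<xi>\<close>, where \<open>W\<close> is the cosine transform of the weight
  \<open>r\<^sup>d\<^sup>-\<^sup>1\<close>, cut off beyond the diameter of the support.  Integration by parts shows that \<open>W\<close> and its derivative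
  are bounded by a multiple of \<open>(1 + \<tau>\<^sup>2)\<^sup>-\<^sup>1\<close> (\<open>radial_cos_decay\<close>).  Two consequences hold pointwise: the
  oscillation of \<open>m\<^sub>\<rho>\<close> on caps of radius \<open>\<rho>\<close> (\<open>mollified_density_oscillation\<close>) and the change of
  \<open>m\<^sub>\<rho>\<close> when \<open>\<rho>\<close> is halved (\<open>mollified_density_dyadic_increment\<close>) are both dominated by
  \<open>N\<^sub>\<rho>(\<omega>) = \<integral> P(\<xi>) \<rho>|\<xi>| exp(-\<rho>\<^sup>2|\<xi>|\<^sup>2/32) (1 + (\<xi> \<bullet> \<omega>)\<^sup>2)\<^sup>-\<^sup>1 d\<xi>\<close>.  Integrated over the sphere, the last
  factor contributes at most a multiple of \<open>1/|\<xi>|\<close> (\<open>sphere_slab_integral\<close>), so the integral of \<open>N\<^sub>\<rho>\<close> is at most a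
  multiple of \<open>\<rho> \<integral> P(\<xi>) exp(-\<rho>\<^sup>2|\<xi>|\<^sup>2/32) d\<xi>\<close>.  By the Fourier transform of the Gaussian this is a
  multiple of \<open>\<rho>\<^sup>1\<^sup>-\<^sup>d \<integral>\<integral> exp(-8|x - y|\<^sup>2/\<rho>\<^sup>2) d\<mu> d\<mu>\<close>, and the Frostman condition bounds that by
  a multiple of \<open>\<rho>\<^sup>1\<^sup>-\<^sup>d \<rho>\<^sup>s = \<rho>\<^sup>a\<close> (\<open>oscillation_majorant_integral\<close>).

  Since \<open>a > 0\<close>, these bounds are summable over \<open>\<rho> = 1/2\<^sup>n\<close>.  Hence \<open>m\<^sub>\<rho>\<close> converges in \<open>L\<^sup>1\<close>; the limit is the
  density of \<open>\<nu>\<close> because \<open>m\<^sub>\<rho>\<close> converges weakly to \<open>\<nu>\<close> (\<open>mollified_density_weak_limit\<close>,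
  \<open>direction_measure_density\<close>).  For \<open>\<epsilon>\<close> comparable to \<open>\<rho>\<close>, replacing \<open>f\<close> by \<open>m\<^sub>\<rho>\<close> in the remainder leaves errors
  controlled by averages of \<open>|f - m\<^sub>\<rho>|\<close> and by \<open>N\<^sub>\<rho>\<close>, independently of \<open>\<epsilon>\<close>
  (\<open>direction_average_remainder_bound\<close>), and the sum over the dyadic scales below \<open>c\<close> is of order \<open>c\<^sup>a\<close>
  (\<open>maximal_remainder_estimate\<close>).  All constants depend only on \<open>d\<close>, \<open>s\<close>, the Frostman constant and the
  size of the support, so they are the same for all rotations.  Finally, a set of directions of
  surface measure zero would be a null set of \<open>\<nu>\<close>, which is a probability measure carried by the directions of \<open>E\<close>.
\<close>

section \<open>Oscillatory integrals of the radial weight\<close>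

text \<open>
  Only the values on \<open>[0, L]\<close> matter, where the function is \<open>1\<close>; beyond that, any continuous decay to
  zero serves.  Continuity is what makes the boundary terms at \<open>L\<close> cancel when integrating by parts,
  and two polynomial pieces keep the derivatives explicit.
\<close>

definition cutoff :: "real \<Rightarrow> real \<Rightarrow> real" where
  "cutoff L r = max 0 (min 1 (2 - r / L))"

text \<open>
  The cosine transform, on the half-line, of the radial weight \<open>r\<^sup>n\<close> cut off beyond \<open>L\<close>.  In polar
  coordinates the weight \<open>r\<^sup>d\<^sup>-\<^sup>1\<close> turns an integral over a ray into a density for directions.  The
  phase \<open>\<theta>\<close> makes the family closed under differentiation in \<open>\<tau>\<close>.
\<close>

definition radial_cos :: "real \<Rightarrow> nat \<Rightarrow> real \<Rightarrow> real \<Rightarrow> real" where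
  "radial_cos L n \<theta> \<tau> = integral {0..2*L} (\<lambda>r. r ^ n * cutoff L r * cos (r * \<tau> + \<theta>))"

lemma cutoff_bounds: "0 \<le> cutoff L r" "cutoff L r \<le> 1"
  by (auto simp: cutoff_def)

lemma continuous_on_cutoff [continuous_intros]: "continuous_on A (cutoff L)"
  unfolding cutoff_def divide_inverse by (intro continuous_intros)

lemma cutoff_eq_1: "L > 0 \<Longrightarrow> r \<le> L \<Longrightarrow> cutoff L r = 1"
  by (auto simp: cutoff_def min_def max_def field_simps)

lemma cutoff_eq_0: "L > 0 \<Longrightarrow> r \<ge> 2 * L \<Longrightarrow> cutoff L r = 0"
  by (auto simp: cutoff_def min_def max_def field_simps)

lemma cutoff_eq_linear: "L > 0 \<Longrightarrow> L \<le> r \<Longrightarrow> r \<le> 2 * L \<Longrightarrow> cutoff L r = 2 - r / L"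
  by (auto simp: cutoff_def min_def max_def field_simps)

text \<open>
  The function \<open>f(r) sin(r\<tau> + \<theta>)/\<tau> + f'(r) cos(r\<tau> + \<theta>)/\<tau>\<^sup>2\<close> has derivative
  \<open>(f(r) + f''(r)/\<tau>\<^sup>2) cos(r\<tau> + \<theta>)\<close>.  The boundary terms of order \<open>1/\<tau>\<close> are kept explicit because they
  cancel between adjacent intervals.
\<close>

lemma oscillatory_integral_by_parts:
  fixes f f' f'' :: "real \<Rightarrow> real"
  assumes "a \<le> b"
    and f: "\<And>r. (f has_real_derivative f' r) (at r)"
    and f': "\<And>r. (f' has_real_derivative f'' r) (at r)"
    and f'': "continuous_on UNIV f''"
  shows "\<exists>K\<ge>0. \<forall>\<theta> \<tau>. \<tau> \<noteq> 0 \<longrightarrow>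
    \<bar>integral {a..b} (\<lambda>r. f r * cos (r * \<tau> + \<theta>)) -
      (f b * sin (b * \<tau> + \<theta>) - f a * sin (a * \<tau> + \<theta>)) / \<tau>\<bar> \<le> K / \<tau>\<^sup>2"
proof -
  have cf'': "continuous_on A f''" for A
    using f'' continuous_on_subset by blast
  have cf: "continuous_on A f" for A
    using f by (meson DERIV_continuous_on has_field_derivative_at_within)
  define K where "K = \<bar>f' b\<bar> + \<bar>f' a\<bar> + integral {a..b} (\<lambda>r. \<bar>f'' r\<bar>)"
  have "\<bar>integral {a..b} (\<lambda>r. f r * cos (r * \<tau> + \<theta>)) -
      (f b * sin (b * \<tau> + \<theta>) - f a * sin (a * \<tau> + \<theta>)) / \<tau>\<bar> \<le> K / \<tau>\<^sup>2" if \<tau>: "\<tau> \<noteq> 0" for \<theta> \<tau>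
  proof -
    let ?F = "\<lambda>r. f r * sin (r * \<tau> + \<theta>) / \<tau> + f' r * cos (r * \<tau> + \<theta>) / \<tau>\<^sup>2"
    let ?g = "\<lambda>r. f r * cos (r * \<tau> + \<theta>)"
    let ?h = "\<lambda>r. f'' r * cos (r * \<tau> + \<theta>)"
    have "(?F has_real_derivative ?g r + ?h r / \<tau>\<^sup>2) (at r within {a..b})" for r
      using \<tau> by (auto intro!: derivative_eq_intros DERIV_subset[OF f] DERIV_subset[OF f']
          simp: field_simps power2_eq_square)
    then have "((\<lambda>r. ?g r + ?h r / \<tau>\<^sup>2) has_integral (?F b - ?F a)) {a..b}"
      by (intro fundamental_theorem_of_calculus[OF \<open>a \<le> b\<close>])
        (simp add: has_real_derivative_iff_has_vector_derivative)
    moreover have ig: "?g integrable_on {a..b}"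
      by (intro integrable_continuous_real continuous_intros cf)
    moreover have ih: "?h integrable_on {a..b}"
      by (intro integrable_continuous_real continuous_intros cf'')
    moreover have "(\<lambda>r. ?h r / \<tau>\<^sup>2) integrable_on {a..b}"
      using \<tau> by (intro integrable_continuous_real continuous_intros cf'') auto
    ultimately have "integral {a..b} ?g + integral {a..b} (\<lambda>r. ?h r / \<tau>\<^sup>2) = ?F b - ?F a"
      using integral_add[of ?g "{a..b}" "\<lambda>r. ?h r / \<tau>\<^sup>2"] by (simp add: integral_unique)
    then have eq: "integral {a..b} ?g + integral {a..b} ?h / \<tau>\<^sup>2 = ?F b - ?F a"
      by simp
    have bh: "\<bar>integral {a..b} ?h\<bar> \<le> integral {a..b} (\<lambda>r. \<bar>f'' r\<bar>)"
      unfolding real_norm_def[symmetric]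
      by (intro integral_norm_bound_integral ih integrable_continuous_real continuous_intros cf'')
        (auto simp: abs_mult intro!: mult_left_le)
    have bb: "\<bar>f' r * cos (r * \<tau> + \<theta>)\<bar> \<le> \<bar>f' r\<bar>" for r
      by (simp add: abs_mult mult_left_le)
    have "integral {a..b} ?g - (f b * sin (b * \<tau> + \<theta>) - f a * sin (a * \<tau> + \<theta>)) / \<tau> =
       (f' b * cos (b * \<tau> + \<theta>) - f' a * cos (a * \<tau> + \<theta>) - integral {a..b} ?h) / \<tau>\<^sup>2"
      using eq by (simp add: diff_divide_distrib)
    also have "\<bar>\<dots>\<bar> = \<bar>f' b * cos (b * \<tau> + \<theta>) - f' a * cos (a * \<tau> + \<theta>) - integral {a..b} ?h\<bar> / \<tau>\<^sup>2"
      by simp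
    also have "\<dots> \<le> K / \<tau>\<^sup>2"
      unfolding K_def using bh bb[of a] bb[of b] by (intro divide_right_mono) auto
    finally show ?thesis .
  qed
  moreover have "K \<ge> 0"
    unfolding K_def by (auto intro!: add_nonneg_nonneg integral_nonneg integrable_continuous_real continuous_intros cf'')
  ultimately show ?thesis by blast
qed

text \<open>
  Quadratic decay, hence integrability in \<open>\<tau>\<close>: the weight is continuous and vanishes at both ends
  (at \<open>0\<close> because \<open>n \<ge> 1\<close>, which is where \<open>d \<ge> 2\<close> enters), so no boundary term of order \<open>1/\<tau>\<close> survives.
\<close>

lemma radial_cos_decay:
  assumes "n \<ge> 1" "L > 0"
  shows "\<exists>K\<ge>0. \<forall>\<theta> \<tau>. \<bar>radial_cos L n \<theta> \<tau>\<bar> \<le> K / (1 + \<tau>\<^sup>2)"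
proof -
  let ?g = "\<lambda>\<tau> \<theta> r. r ^ n * cutoff L r * cos (r * \<tau> + \<theta>)"
  let ?p = "\<lambda>r::real. r ^ n" and ?q = "\<lambda>r. r ^ n * (2 - r / L)"
  obtain K1 where K1: "K1 \<ge> 0" and b1: "\<And>\<theta> \<tau>. \<tau> \<noteq> 0 \<Longrightarrow>
    \<bar>integral {0..L} (\<lambda>r. ?p r * cos (r * \<tau> + \<theta>)) -
      (?p L * sin (L * \<tau> + \<theta>) - ?p 0 * sin (0 * \<tau> + \<theta>)) / \<tau>\<bar> \<le> K1 / \<tau>\<^sup>2"
  proof -
    have "\<exists>K\<ge>0. \<forall>\<theta> \<tau>. \<tau> \<noteq> 0 \<longrightarrow> \<bar>integral {0..L} (\<lambda>r. ?p r * cos (r * \<tau> + \<theta>)) -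
      (?p L * sin (L * \<tau> + \<theta>) - ?p 0 * sin (0 * \<tau> + \<theta>)) / \<tau>\<bar> \<le> K / \<tau>\<^sup>2"
      by (rule oscillatory_integral_by_parts[where f'="\<lambda>r. n * r ^ (n - 1)"
            and f''="\<lambda>r. n * ((n - 1) * r ^ (n - 1 - 1))"])
        (use assms in \<open>auto intro!: derivative_eq_intros continuous_intros\<close>)
    then show ?thesis using that by blast
  qed
  obtain K2 where K2: "K2 \<ge> 0" and b2: "\<And>\<theta> \<tau>. \<tau> \<noteq> 0 \<Longrightarrow>
    \<bar>integral {L..2*L} (\<lambda>r. ?q r * cos (r * \<tau> + \<theta>)) -
      (?q (2*L) * sin (2*L * \<tau> + \<theta>) - ?q L * sin (L * \<tau> + \<theta>)) / \<tau>\<bar> \<le> K2 / \<tau>\<^sup>2"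
  proof -
    have "\<exists>K\<ge>0. \<forall>\<theta> \<tau>. \<tau> \<noteq> 0 \<longrightarrow> \<bar>integral {L..2*L} (\<lambda>r. ?q r * cos (r * \<tau> + \<theta>)) -
      (?q (2*L) * sin (2*L * \<tau> + \<theta>) - ?q L * sin (L * \<tau> + \<theta>)) / \<tau>\<bar> \<le> K / \<tau>\<^sup>2"
      by (rule oscillatory_integral_by_parts[where
            f'="\<lambda>r. n * r ^ (n - 1) * (2 - r / L) + r ^ n * (- 1 / L)"
            and f''="\<lambda>r. n * ((n - 1) * r ^ (n - 1 - 1)) * (2 - r / L) + n * r ^ (n - 1) * (- 1 / L)
                + n * r ^ (n - 1) * (- 1 / L)"])
        (use assms in \<open>auto intro!: derivative_eq_intros continuous_intros simp: field_simps\<close>)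
    then show ?thesis using that by blast
  qed
  have cg: "continuous_on A (?g \<tau> \<theta>)" for A \<tau> \<theta>
    by (intro continuous_intros)
  define K0 where "K0 = integral {0..2*L} (\<lambda>r::real. r ^ n * 1)"
  have K0: "K0 \<ge> 0" unfolding K0_def
    by (auto intro!: integral_nonneg integrable_continuous_real continuous_intros)
  have trivial: "\<bar>radial_cos L n \<theta> \<tau>\<bar> \<le> K0" for \<theta> \<tau>
    unfolding radial_cos_def K0_def real_norm_def[symmetric]
    by (intro integral_norm_bound_integral integrable_continuous_real cg continuous_intros)
      (auto simp: abs_mult cutoff_bounds mult.assoc intro!: mult_left_le mult_le_one)
  have decay: "\<bar>radial_cos L n \<theta> \<tau>\<bar> \<le> (K1 + K2) / \<tau>\<^sup>2" if "\<tau> \<noteq> 0" for \<theta> \<tau>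
  proof -
    have "radial_cos L n \<theta> \<tau> = integral {0..L} (?g \<tau> \<theta>) + integral {L..2*L} (?g \<tau> \<theta>)"
      unfolding radial_cos_def using assms
      by (intro Henstock_Kurzweil_Integration.integral_combine[symmetric] integrable_continuous_real cg) auto
    also have "integral {0..L} (?g \<tau> \<theta>) = integral {0..L} (\<lambda>r. ?p r * cos (r * \<tau> + \<theta>))"
      using assms by (intro integral_cong) (auto simp: cutoff_eq_1)
    also have "integral {L..2*L} (?g \<tau> \<theta>) = integral {L..2*L} (\<lambda>r. ?q r * cos (r * \<tau> + \<theta>))"
      using assms by (intro integral_cong) (auto simp: cutoff_eq_linear)
    finally have eq: "radial_cos L n \<theta> \<tau> = integral {0..L} (\<lambda>r. ?p r * cos (r * \<tau> + \<theta>))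
      + integral {L..2*L} (\<lambda>r. ?q r * cos (r * \<tau> + \<theta>))" .
    have z: "?p 0 = 0" "?q (2*L) = 0" "?q L = ?p L"
      using assms by (auto simp: field_simps)
    have "\<bar>radial_cos L n \<theta> \<tau>\<bar> \<le> K1 / \<tau>\<^sup>2 + K2 / \<tau>\<^sup>2"
      using b1[OF that, of \<theta>] b2[OF that, of \<theta>] unfolding z eq
      by (simp only: mult_zero_left diff_0_right diff_0 minus_divide_left[symmetric])
    then show ?thesis by (simp add: add_divide_distrib)
  qed
  have "\<bar>radial_cos L n \<theta> \<tau>\<bar> \<le> (K0 + (K1 + K2)) / (1 + \<tau>\<^sup>2)" for \<theta> \<tau>
  proof -
    have "\<bar>radial_cos L n \<theta> \<tau>\<bar> * \<tau>\<^sup>2 \<le> K1 + K2"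
      using decay[of \<tau> \<theta>] K1 K2 by (cases "\<tau> = 0") (auto simp: field_simps)
    then have "\<bar>radial_cos L n \<theta> \<tau>\<bar> * (1 + \<tau>\<^sup>2) \<le> K0 + (K1 + K2)"
      using trivial[of \<theta> \<tau>] by (simp add: algebra_simps)
    moreover have "1 + \<tau>\<^sup>2 > 0" by (simp add: add_pos_nonneg)
    ultimately show ?thesis by (simp add: pos_le_divide_eq)
  qed
  moreover have "K0 + (K1 + K2) \<ge> 0" using K0 K1 K2 by simp
  ultimately show ?thesis by blast
qed

lemma radial_cos_derivative:
  "(radial_cos L n \<theta> has_real_derivative radial_cos L (Suc n) (\<theta> + pi / 2) \<tau>) (at \<tau>)"
proof -
  have eq: "r ^ n * cutoff L r * (- sin (r * \<tau> + \<theta>) * r) =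
      r ^ Suc n * cutoff L r * cos (r * \<tau> + (\<theta> + pi / 2))" for r \<tau>
    using minus_sin_cos_eq[of "r * \<tau> + \<theta>"] by (simp add: algebra_simps)
  have "((\<lambda>\<tau>. integral (cbox 0 (2*L)) (\<lambda>r. r ^ n * cutoff L r * cos (r * \<tau> + \<theta>))) has_real_derivative
      integral (cbox 0 (2*L)) (\<lambda>r. r ^ n * cutoff L r * (- sin (r * \<tau> + \<theta>) * r))) (at \<tau> within UNIV)"
    by (rule leibniz_rule_field_derivative[where fx="\<lambda>\<tau> r. r ^ n * cutoff L r * (- sin (r * \<tau> + \<theta>) * r)"])
      (auto intro!: derivative_eq_intros integrable_continuous_real continuous_intros
         continuous_on_compose2[OF continuous_on_cutoff] simp: split_beta)
  then show ?thesis
    unfolding eq by (simp add: radial_cos_def[abs_def])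
qed

text \<open>
  By the mean value theorem an increment is \<open>h\<close> times a value of the derivative, which is again a
  \<open>radial_cos\<close> and decays quadratically.  Moving the frequency at which that decay is evaluated back
  to \<open>\<tau>\<close> costs the factor \<open>1 + h\<^sup>2\<close>.
\<close>

lemma radial_cos_increment:
  assumes "n \<ge> 1" "L > 0"
  shows "\<exists>K\<ge>0. \<forall>\<tau> h. \<bar>radial_cos L n 0 (\<tau> + h) - radial_cos L n 0 \<tau>\<bar> \<le> K * (\<bar>h\<bar> * (1 + h\<^sup>2)) / (1 + \<tau>\<^sup>2)"
proof -
  obtain K where K: "K \<ge> 0" "\<And>\<theta> \<tau>. \<bar>radial_cos L (Suc n) \<theta> \<tau>\<bar> \<le> K / (1 + \<tau>\<^sup>2)"
    using radial_cos_decay[of "Suc n" L] assms by auto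
  have deriv: "(radial_cos L n 0 has_real_derivative radial_cos L (Suc n) (pi / 2) x) (at x)" for x
    using radial_cos_derivative[of L n 0 x] by simp
  have "\<bar>radial_cos L n 0 (\<tau> + h) - radial_cos L n 0 \<tau>\<bar> \<le> 2 * K * (\<bar>h\<bar> * (1 + h\<^sup>2)) / (1 + \<tau>\<^sup>2)" for \<tau> h
  proof -
    obtain t where t: "\<bar>t\<bar> \<le> \<bar>h\<bar>" "\<bar>radial_cos L n 0 (\<tau> + h) - radial_cos L n 0 \<tau>\<bar> =
        \<bar>h\<bar> * \<bar>radial_cos L (Suc n) (pi / 2) (\<tau> + t)\<bar>"
    proof (cases h "0::real" rule: linorder_cases)
      case less
      have "\<exists>z. \<tau> + h < z \<and> z < \<tau> \<and> radial_cos L n 0 \<tau> - radial_cos L n 0 (\<tau> + h) =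
          (\<tau> - (\<tau> + h)) * radial_cos L (Suc n) (pi / 2) z"
        using less by (intro MVT2 deriv) auto
      then obtain z where "\<tau> + h < z" "z < \<tau>" "radial_cos L n 0 \<tau> - radial_cos L n 0 (\<tau> + h) =
          (\<tau> - (\<tau> + h)) * radial_cos L (Suc n) (pi / 2) z"
        by auto
      then show ?thesis using less that[of "z - \<tau>"] by (auto simp: abs_mult abs_minus_commute)
    next
      case greater
      have "\<exists>z. \<tau> < z \<and> z < \<tau> + h \<and> radial_cos L n 0 (\<tau> + h) - radial_cos L n 0 \<tau> =
          (\<tau> + h - \<tau>) * radial_cos L (Suc n) (pi / 2) z"
        using greater by (intro MVT2 deriv) auto
      then obtain z where "\<tau> < z" "z < \<tau> + h" "radial_cos L n 0 (\<tau> + h) - radial_cos L n 0 \<tau> =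
          (\<tau> + h - \<tau>) * radial_cos L (Suc n) (pi / 2) z"
        by auto
      then show ?thesis using greater that[of "z - \<tau>"] by (auto simp: abs_mult)
    qed (use that[of 0] in auto)
    have t2: "t\<^sup>2 \<le> h\<^sup>2" using t(1) by (simp add: abs_le_square_iff)
    have p: "1 + (\<tau> + t)\<^sup>2 > 0" "1 + \<tau>\<^sup>2 > 0" by (simp_all add: add_pos_nonneg)
    have "1 + \<tau>\<^sup>2 \<le> 2 * (1 + t\<^sup>2) * (1 + (\<tau> + t)\<^sup>2)"
    proof -
      have "\<tau>\<^sup>2 \<le> 2 * (\<tau> + t)\<^sup>2 + 2 * t\<^sup>2"
        using zero_le_power2[of "\<tau> + 2 * t"] by (simp add: power2_eq_square algebra_simps)
      moreover have "0 \<le> t\<^sup>2 * (\<tau> + t)\<^sup>2" by simp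
      moreover have "2 * (1 + t\<^sup>2) * (1 + (\<tau> + t)\<^sup>2) = 2 + 2 * t\<^sup>2 + 2 * (\<tau> + t)\<^sup>2 + 2 * (t\<^sup>2 * (\<tau> + t)\<^sup>2)"
        by (simp add: algebra_simps)
      ultimately show ?thesis by linarith
    qed
    also have "\<dots> \<le> 2 * (1 + h\<^sup>2) * (1 + (\<tau> + t)\<^sup>2)"
      using t2 by (intro mult_right_mono) auto
    finally have "K * (1 + \<tau>\<^sup>2) \<le> K * (2 * (1 + h\<^sup>2) * (1 + (\<tau> + t)\<^sup>2))"
      using K(1) by (intro mult_left_mono)
    then have "K / (1 + (\<tau> + t)\<^sup>2) \<le> 2 * K * (1 + h\<^sup>2) / (1 + \<tau>\<^sup>2)"
      using p by (simp add: divide_le_eq pos_le_divide_eq mult_ac)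
    then have "\<bar>radial_cos L (Suc n) (pi / 2) (\<tau> + t)\<bar> \<le> 2 * K * (1 + h\<^sup>2) / (1 + \<tau>\<^sup>2)"
      using K(2)[of "pi/2" "\<tau> + t"] by simp
    then have "\<bar>h\<bar> * \<bar>radial_cos L (Suc n) (pi / 2) (\<tau> + t)\<bar> \<le> \<bar>h\<bar> * (2 * K * (1 + h\<^sup>2) / (1 + \<tau>\<^sup>2))"
      by (intro mult_left_mono) auto
    then show ?thesis using t(2) by (simp add: mult_ac)
  qed
  then show ?thesis using K(1) by (intro exI[of _ "2 * K"]) auto
qed

section \<open>Rotation invariance and Fourier transforms of Gaussians\<close>

text \<open>
  The Householder reflection in the hyperplane orthogonal to \<open>a - b\<close>.
\<close>

lemma orthogonal_transformation_exists_norm_eq: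
  fixes a b :: "'a::euclidean_space"
  assumes "norm a = norm b"
  obtains f where "orthogonal_transformation f" "f a = b"
proof -
  define u where "u = a - b"
  define f where "f x = x - (2 * (x \<bullet> u) / (u \<bullet> u)) *\<^sub>R u" for x
  have "linear f"
    unfolding f_def by (rule linearI) (simp_all add: inner_add_left algebra_simps add_divide_distrib)
  moreover have "f v \<bullet> f w = v \<bullet> w" for v w
    by (cases "u = 0") (simp_all add: f_def inner_diff_left inner_diff_right inner_commute field_simps)
  ultimately have "orthogonal_transformation f"
    by (simp add: orthogonal_transformation_def)
  moreover have "f a = b"
  proof (cases "u = 0")
    case False
    have "a \<bullet> a = b \<bullet> b" using assms by (simp add: norm_eq)
    then have "2 * (a \<bullet> u) = u \<bullet> u"
      by (simp add: u_def inner_diff_left inner_diff_right inner_commute)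
    then show ?thesis using False by (simp add: f_def u_def)
  qed (simp add: f_def u_def)
  ultimately show ?thesis using that by blast
qed

lemma orthogonal_transformation_borel:
  fixes f :: "'a::euclidean_space \<Rightarrow> 'a"
  assumes "orthogonal_transformation f"
  shows "f \<in> borel_measurable borel"
  using assms
  by (intro borel_measurable_continuous_onI linear_continuous_on)
    (simp add: orthogonal_transformation_linear linear_conv_bounded_linear[symmetric])

lemma nn_integral_lborel_translate:
  fixes g :: "'a::euclidean_space \<Rightarrow> ennreal"
  assumes [measurable]: "g \<in> borel_measurable borel"
  shows "(\<integral>\<^sup>+x. g (c + x) \<partial>lborel) = (\<integral>\<^sup>+x. g x \<partial>lborel)"
proof -
  have "(\<integral>\<^sup>+x. g x \<partial>lborel) = (\<integral>\<^sup>+x. g x \<partial>distr lborel borel ((+) c))"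
    by (simp add: lborel_distr_plus)
  also have "\<dots> = (\<integral>\<^sup>+x. g (c + x) \<partial>lborel)"
    by (rule nn_integral_distr) auto
  finally show ?thesis by simp
qed

lemma nn_integral_lborel_scale:
  fixes g :: "'a::euclidean_space \<Rightarrow> ennreal"
  assumes [measurable]: "g \<in> borel_measurable borel" and "c \<noteq> 0"
  shows "(\<integral>\<^sup>+x. g x \<partial>lborel) = \<bar>c\<bar> ^ DIM('a) * (\<integral>\<^sup>+x. g (c *\<^sub>R x) \<partial>lborel)"
  by (subst lborel_affine[OF \<open>c \<noteq> 0\<close>, of 0])
    (simp add: nn_integral_density nn_integral_distr nn_integral_cmult ennreal_power)

lemma nn_integral_lborel_reflect:
  fixes g :: "'a::euclidean_space \<Rightarrow> ennreal"
  assumes [measurable]: "g \<in> borel_measurable borel"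
  shows "(\<integral>\<^sup>+x. g (c - x) \<partial>lborel) = (\<integral>\<^sup>+x. g x \<partial>lborel)"
proof -
  have "(\<integral>\<^sup>+x. g (c - x) \<partial>lborel) = (\<integral>\<^sup>+x. g (c + x) \<partial>lborel)"
    by (subst nn_integral_lborel_scale[of _ "-1"]) auto
  then show ?thesis by (simp add: nn_integral_lborel_translate)
qed

text \<open>
  The image measure is translation invariant, and translation invariance determines a
  \<open>\<sigma>\<close>-finite Borel measure up to a constant; the constant is \<open>1\<close> because balls around the origin are
  preserved.
\<close>

lemma distr_lborel_orthogonal_transformation:
  fixes f :: "'a::euclidean_space \<Rightarrow> 'a"
  assumes f: "orthogonal_transformation f"
  shows "distr lborel borel f = lborel"
proof -
  define N where "N = distr lborel borel f"
  note [measurable] = orthogonal_transformation_borel[OF f]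
  have [measurable_cong, simp]: "sets N = sets borel" by (simp add: N_def)
  have [simp]: "space N = UNIV" by (simp add: N_def)
  have norm_f: "norm (f x) = norm x" for x
    using f by (simp add: orthogonal_transformation_norm)
  have ball: "emeasure N (ball 0 r) = emeasure lborel (ball (0::'a) r)" for r
  proof -
    have "f -` ball 0 r = ball 0 r" by (auto simp: norm_f)
    then show ?thesis unfolding N_def by (subst emeasure_distr) simp_all
  qed
  interpret N: sigma_finite_measure N
  proof
    have "x \<in> (\<Union>n::nat. ball 0 (real n))" for x :: 'a
      using reals_Archimedean2[of "norm x"] by auto
    moreover have "emeasure N (ball 0 r) \<noteq> \<infinity>" for r
      using emeasure_lborel_ball_finite[of "0::'a" r] by (simp add: ball)
    ultimately show "\<exists>A::'a set set. countable A \<and> A \<subseteq> sets N \<and> \<Union>A = space N \<and> (\<forall>a\<in>A. emeasure N a \<noteq> \<infinity>)"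
      by (intro exI[of _ "range (\<lambda>n::nat. ball (0::'a) (real n))"]) auto
  qed
  interpret pair_sigma_finite N "lborel :: 'a measure" ..
  have trans: "(\<integral>\<^sup>+x. g x \<partial>N) = (\<integral>\<^sup>+x. g (x - y) \<partial>N)" if [measurable]: "g \<in> borel_measurable borel"
    for g :: "'a \<Rightarrow> ennreal" and y
  proof -
    obtain z where z: "f z = y" using orthogonal_transformation_surj[OF f] by (metis surjD)
    have "f u - y = f (- z + u)" for u
      using orthogonal_transformation_linear[OF f] by (simp add: linear_diff z)
    then have "(\<integral>\<^sup>+x. g (x - y) \<partial>N) = (\<integral>\<^sup>+u. g (f (- z + u)) \<partial>lborel)"
      by (simp add: N_def nn_integral_distr)
    also have "\<dots> = (\<integral>\<^sup>+x. g x \<partial>N)"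
      by (subst nn_integral_lborel_translate) (simp_all add: N_def nn_integral_distr)
    finally show ?thesis by simp
  qed
  \<comment> \<open>Both measures are translation invariant, so integrating \<open>1\<^sub>A(x) 1\<^sub>B(x + y)\<close> in the two possible
    orders gives \<open>N(A) |B| = |A| N(B)\<close>; the unit ball \<open>B\<close> has the same positive finite mass for both.\<close>
  have eq: "emeasure N A = emeasure lborel A" if [measurable]: "A \<in> sets borel" for A
  proof -
    let ?B = "ball 0 1 :: 'a set"
    have B [measurable]: "?B \<in> sets borel" by simp
    have "emeasure N A * emeasure lborel ?B = (\<integral>\<^sup>+x. indicator A x * (\<integral>\<^sup>+y. indicator ?B (x + y) \<partial>lborel) \<partial>N)"
      by (subst nn_integral_lborel_translate) (simp_all add: nn_integral_multc borel_measurable_indicator[OF B] borel_measurable_indicator)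
    also have "\<dots> = (\<integral>\<^sup>+x. (\<integral>\<^sup>+y. indicator A x * indicator ?B (x + y) \<partial>lborel) \<partial>N)"
      by (intro nn_integral_cong) (simp add: nn_integral_cmult)
    also have "\<dots> = (\<integral>\<^sup>+y. (\<integral>\<^sup>+x. indicator A x * indicator ?B (x + y) \<partial>N) \<partial>lborel)"
      by (rule Fubini'[symmetric]) simp
    also have "\<dots> = (\<integral>\<^sup>+y. (\<integral>\<^sup>+x. indicator A (x - y) * indicator ?B x \<partial>N) \<partial>lborel)"
    proof (rule nn_integral_cong)
      fix y show "(\<integral>\<^sup>+x. indicator A x * indicator ?B (x + y) \<partial>N) = (\<integral>\<^sup>+x. indicator A (x - y) * indicator ?B x \<partial>N)"
        by (subst trans[of _ y]) (simp_all add: indicator_def)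
    qed
    also have "\<dots> = (\<integral>\<^sup>+x. (\<integral>\<^sup>+y. indicator A (x - y) * indicator ?B x \<partial>lborel) \<partial>N)"
      by (rule Fubini') simp
    also have "\<dots> = (\<integral>\<^sup>+x. (\<integral>\<^sup>+y. indicator A (x - y) \<partial>lborel) * indicator ?B x \<partial>N)"
      by (intro nn_integral_cong) (simp add: nn_integral_multc)
    also have "\<dots> = emeasure lborel A * emeasure N ?B"
      by (subst nn_integral_lborel_reflect) (simp_all add: nn_integral_cmult)
    finally have "emeasure N A * emeasure lborel ?B = emeasure lborel A * emeasure lborel ?B"
      by (simp add: ball)
    moreover have "emeasure lborel ?B \<noteq> 0" "emeasure lborel ?B \<noteq> \<infinity>"
      using emeasure_lborel_ball_finite[of "0::'a" 1] open_not_negligible[of ?B]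
      by (simp_all add: negligible_iff_null_sets null_sets_def)
    ultimately show ?thesis
      by (simp add: ennreal_mult_cancel_left mult.commute[of _ "emeasure lborel (ball 0 1)"])
  qed
  show ?thesis
    using eq by (intro measure_eqI) (auto simp: N_def[symmetric])
qed

lemma nn_integral_lborel_orthogonal:
  fixes g :: "'a::euclidean_space \<Rightarrow> ennreal" and f :: "'a \<Rightarrow> 'a"
  assumes f: "orthogonal_transformation f" and [measurable]: "g \<in> borel_measurable borel"
  shows "(\<integral>\<^sup>+x. g (f x) \<partial>lborel) = (\<integral>\<^sup>+x. g x \<partial>lborel)"
proof -
  note [measurable] = orthogonal_transformation_borel[OF f]
  have "(\<integral>\<^sup>+x. g x \<partial>lborel) = (\<integral>\<^sup>+x. g x \<partial>distr lborel borel f)"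
    by (simp add: distr_lborel_orthogonal_transformation[OF f])
  also have "\<dots> = (\<integral>\<^sup>+x. g (f x) \<partial>lborel)"
    by (rule nn_integral_distr) auto
  finally show ?thesis by simp
qed

text \<open>
  The normalisation is the one in which Gaussians appear as Fourier multipliers: \<open>\<rho>\<close> is the spatial
  scale of the mollifier whose transform is \<open>gauss \<rho>\<close>.
\<close>

definition gauss :: "real \<Rightarrow> 'a::euclidean_space \<Rightarrow> real" where
  "gauss \<rho> x = exp (- ((\<rho> * norm x)\<^sup>2 / 2))"

lemma gauss_pos: "0 < gauss \<rho> x" and gauss_nonneg: "0 \<le> gauss \<rho> x" and gauss_le_1: "gauss \<rho> x \<le> 1"
  by (simp_all add: gauss_def)

lemma gauss_measurable [measurable]: "gauss \<rho> \<in> borel_measurable borel"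
  unfolding gauss_def by measurable

lemma fourier_gauss_real:
  fixes z :: real
  assumes "\<rho> > 0"
  shows "integrable lborel (\<lambda>t. iexp (t * z) * complex_of_real (exp (- ((\<rho> * t)\<^sup>2 / 2))))"
    and "(\<integral>t. iexp (t * z) * complex_of_real (exp (- ((\<rho> * t)\<^sup>2 / 2))) \<partial>lborel) =
      complex_of_real (sqrt (2 * pi) / \<rho> * exp (- ((z / \<rho>)\<^sup>2 / 2)))"
proof -
  let ?f = "\<lambda>t. iexp (t * z) * complex_of_real (exp (- ((\<rho> * t)\<^sup>2 / 2)))"
  let ?g = "\<lambda>u. iexp (z / \<rho> * u) * complex_of_real (exp (- (u\<^sup>2 / 2)))"
  have fg: "?f (0 + (1 / \<rho>) * u) = ?g u" for u
    using assms by (simp add: mult_ac)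
  have "integrable lborel (\<lambda>x. std_normal_density x)" by simp
  then have "integrable lborel (\<lambda>x. sqrt (2 * pi) * std_normal_density x)" by simp
  also have "(\<lambda>x. sqrt (2 * pi) * std_normal_density x) = (\<lambda>x. exp (- (x\<^sup>2 / 2)))"
    by (auto simp: std_normal_density_def)
  finally have ie: "integrable lborel (\<lambda>x::real. exp (- (x\<^sup>2 / 2)))" .
  have ig: "integrable lborel ?g"
    by (rule Bochner_Integration.integrable_bound[OF ie]) (auto simp: norm_mult)
  then have "integrable lborel (\<lambda>u. ?f (0 + (1 / \<rho>) * u))" by (simp only: fg)
  then show "integrable lborel ?f"
    using assms by (subst (asm) lborel_integrable_real_affine_iff) auto
  have "complex_of_real (exp (- ((z / \<rho>)\<^sup>2) / 2)) = char std_normal_distribution (z / \<rho>)"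
    by (simp add: char_std_normal_distribution)
  also have "\<dots> = (\<integral>u. std_normal_density u *\<^sub>R iexp (z / \<rho> * u) \<partial>lborel)"
    unfolding char_def by (subst integral_density) (auto simp: normal_density_nonneg)
  also have "\<dots> = (\<integral>u. complex_of_real (1 / sqrt (2 * pi)) * ?g u \<partial>lborel)"
    by (intro Bochner_Integration.integral_cong) (auto simp: std_normal_density_def scaleR_conv_of_real)
  also have "\<dots> = complex_of_real (1 / sqrt (2 * pi)) * (\<integral>u. ?g u \<partial>lborel)"
    by simp
  finally have g: "(\<integral>u. ?g u \<partial>lborel) = complex_of_real (sqrt (2 * pi) * exp (- ((z / \<rho>)\<^sup>2 / 2)))"
    by (simp add: field_simps)
  have "(\<integral>t. ?f t \<partial>lborel) = \<bar>1 / \<rho>\<bar> *\<^sub>R (\<integral>u. ?f (0 + (1 / \<rho>) * u) \<partial>lborel)"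
    using assms by (intro lborel_integral_real_affine) auto
  also have "\<dots> = complex_of_real (sqrt (2 * pi) / \<rho> * exp (- ((z / \<rho>)\<^sup>2 / 2)))"
    unfolding fg g using assms by (simp add: scaleR_conv_of_real)
  finally show "(\<integral>t. ?f t \<partial>lborel) = complex_of_real (sqrt (2 * pi) / \<rho> * exp (- ((z / \<rho>)\<^sup>2 / 2)))" .
qed

lemma integral_lborel_prod:
  fixes f :: "'a::euclidean_space \<Rightarrow> real \<Rightarrow> complex"
  assumes "\<And>b. b \<in> Basis \<Longrightarrow> integrable lborel (f b)"
  shows "integrable lborel (\<lambda>x::'a. \<Prod>b\<in>Basis. f b (x \<bullet> b))"
    and "(\<integral>x. (\<Prod>b\<in>Basis. f b (x \<bullet> b)) \<partial>lborel) = (\<Prod>b\<in>Basis. \<integral>t. f b t \<partial>lborel)"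
proof -
  interpret product_sigma_finite "\<lambda>_::'a. lborel :: real measure" ..
  have [measurable]: "\<And>b. b \<in> Basis \<Longrightarrow> f b \<in> borel_measurable borel"
    using assms by (auto dest: borel_measurable_integrable)
  have eq: "(\<Prod>b\<in>Basis. f b ((\<Sum>c\<in>Basis. x c *\<^sub>R c) \<bullet> b)) = (\<Prod>b\<in>Basis. f b (x b))" for x :: "'a \<Rightarrow> real"
    by (intro prod.cong refl) (simp add: inner_sum_left_Basis)
  have m: "(\<lambda>x. \<Sum>b\<in>Basis. x b *\<^sub>R b) \<in> (\<Pi>\<^sub>M b\<in>(Basis::'a set). lborel) \<rightarrow>\<^sub>M borel"
    by measurable
  have g: "(\<lambda>x::'a. \<Prod>b\<in>Basis. f b (x \<bullet> b)) \<in> borel_measurable borel"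
    by measurable
  show "integrable lborel (\<lambda>x::'a. \<Prod>b\<in>Basis. f b (x \<bullet> b))"
    unfolding lborel_eq[where 'a='a] integrable_distr_eq[OF m g] eq
    by (rule product_integrable_prod[OF finite_Basis]) (rule assms)
  show "(\<integral>x. (\<Prod>b\<in>Basis. f b (x \<bullet> b)) \<partial>lborel) = (\<Prod>b\<in>Basis. \<integral>t. f b t \<partial>lborel)"
    unfolding lborel_eq[where 'a='a] integral_distr[OF m g] eq
    by (rule product_integral_prod[OF finite_Basis]) (rule assms)
qed

lemma
  fixes z :: "'a::euclidean_space"
  assumes "\<rho> > 0"
  shows integrable_gauss: "integrable lborel (gauss \<rho> :: 'a \<Rightarrow> real)"
    and fourier_gauss: "(\<integral>\<xi>. gauss \<rho> \<xi> * cos (\<xi> \<bullet> z) \<partial>lborel) =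
      (sqrt (2 * pi) / \<rho>) ^ DIM('a) * gauss (1 / \<rho>) z"
proof -
  have prod_gauss: "(\<Prod>b\<in>Basis. complex_of_real (exp (- ((r * (\<xi> \<bullet> b))\<^sup>2 / 2)))) = complex_of_real (gauss r \<xi>)"
    for r and \<xi> :: 'a
  proof -
    have "(\<Prod>b\<in>Basis. exp (- ((r * (\<xi> \<bullet> b))\<^sup>2 / 2))) = exp (\<Sum>b\<in>Basis. - ((r * (\<xi> \<bullet> b))\<^sup>2 / 2))"
      by (simp add: exp_sum)
    also have "(\<Sum>b\<in>Basis. - ((r * (\<xi> \<bullet> b))\<^sup>2 / 2)) = - (r\<^sup>2 * (\<Sum>b\<in>Basis. (\<xi> \<bullet> b)\<^sup>2) / 2)"
      by (simp add: sum_negf sum_divide_distrib sum_distrib_left power_mult_distrib)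
    also have "(\<Sum>b\<in>Basis. (\<xi> \<bullet> b)\<^sup>2) = (norm \<xi>)\<^sup>2"
      unfolding power2_norm_eq_inner by (subst euclidean_inner) (simp add: power2_eq_square)
    also have "- (r\<^sup>2 * (norm \<xi>)\<^sup>2 / 2) = - ((r * norm \<xi>)\<^sup>2 / 2)"
      by (simp add: norm_eq_sqrt_inner power_mult_distrib euclidean_inner[of \<xi> \<xi>] power2_eq_square)
    finally show ?thesis by (simp add: gauss_def flip: of_real_prod)
  qed
  have prod_exp: "(\<Prod>b\<in>Basis. iexp ((\<xi> \<bullet> b) * (y \<bullet> b))) = iexp (\<xi> \<bullet> y)" for \<xi> y :: 'a
    by (simp add: exp_sum[symmetric] sum_distrib_left[symmetric] euclidean_inner[of \<xi> y] flip: of_real_sum of_real_mult)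
  have *: "(\<Prod>b\<in>Basis. iexp ((\<xi> \<bullet> b) * (y \<bullet> b)) * complex_of_real (exp (- ((\<rho> * (\<xi> \<bullet> b))\<^sup>2 / 2)))) =
      iexp (\<xi> \<bullet> y) * complex_of_real (gauss \<rho> \<xi>)" for \<xi> y :: 'a
    unfolding prod.distrib prod_exp prod_gauss ..
  have int: "integrable lborel (\<lambda>\<xi>. iexp (\<xi> \<bullet> y) * complex_of_real (gauss \<rho> \<xi>))" for y :: 'a
    using integral_lborel_prod(1)[OF fourier_gauss_real(1)[OF assms], of "\<lambda>b. y \<bullet> b"] unfolding * .
  from integrable_norm[OF int[of 0]] show "integrable lborel (gauss \<rho> :: 'a \<Rightarrow> real)"
    by (simp add: gauss_nonneg)
  have "(\<integral>\<xi>. iexp (\<xi> \<bullet> z) * complex_of_real (gauss \<rho> \<xi>) \<partial>lborel) =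
    (\<Prod>b\<in>(Basis::'a set). complex_of_real (sqrt (2 * pi) / \<rho> * exp (- (((z \<bullet> b) / \<rho>)\<^sup>2 / 2))))"
    using integral_lborel_prod(2)[OF fourier_gauss_real(1)[OF assms], of "\<lambda>b. z \<bullet> b"]
    unfolding * fourier_gauss_real(2)[OF assms] .
  also have "\<dots> = complex_of_real ((sqrt (2 * pi) / \<rho>) ^ DIM('a) * gauss (1 / \<rho>) z)"
    using prod_gauss[of "1 / \<rho>" z] unfolding of_real_mult prod.distrib by simp
  finally have "Re (\<integral>\<xi>. iexp (\<xi> \<bullet> z) * complex_of_real (gauss \<rho> \<xi>) \<partial>lborel) =
    (sqrt (2 * pi) / \<rho>) ^ DIM('a) * gauss (1 / \<rho>) z"
    by simp
  also have "Re (\<integral>\<xi>. iexp (\<xi> \<bullet> z) * complex_of_real (gauss \<rho> \<xi>) \<partial>lborel) =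
     (\<integral>\<xi>. Re (iexp (\<xi> \<bullet> z) * complex_of_real (gauss \<rho> \<xi>)) \<partial>lborel)"
    by (rule integral_Re[symmetric, OF int])
  finally show "(\<integral>\<xi>. gauss \<rho> \<xi> * cos (\<xi> \<bullet> z) \<partial>lborel) =
      (sqrt (2 * pi) / \<rho>) ^ DIM('a) * gauss (1 / \<rho>) z"
    by (simp add: Re_exp mult.commute)
qed

text \<open>
  The form of Fubini's theorem needed for Fourier integrals: the frequency variable carries an
  integrable Gaussian, all other variables range over a finite measure space.
\<close>

lemma Fubini_integral_dominated:
  fixes g :: "'a \<Rightarrow> 'b \<Rightarrow> real"
  assumes "sigma_finite_measure M" "finite_measure Q"
    and meas: "(\<lambda>(x, y). g x y) \<in> borel_measurable (M \<Otimes>\<^sub>M Q)"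
    and f: "integrable M f" and bound: "\<And>x y. \<bar>g x y\<bar> \<le> f x"
  shows "(\<integral>x. (\<integral>y. g x y \<partial>Q) \<partial>M) = (\<integral>y. (\<integral>x. g x y \<partial>M) \<partial>Q)"
proof -
  interpret M: sigma_finite_measure M by fact
  interpret Q: finite_measure Q by fact
  interpret pair_sigma_finite M Q ..
  have [measurable]: "f \<in> borel_measurable M" using f by auto
  have "integrable (M \<Otimes>\<^sub>M Q) (\<lambda>p. f (fst p))"
    unfolding integrable_iff_bounded
  proof
    have "(\<integral>\<^sup>+p. ennreal (norm (f (fst p))) \<partial>(M \<Otimes>\<^sub>M Q)) = (\<integral>\<^sup>+x. \<integral>\<^sup>+y. ennreal (norm (f x)) \<partial>Q \<partial>M)"
      by (subst Q.nn_integral_fst[symmetric]) auto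
    also have "\<dots> = (\<integral>\<^sup>+x. ennreal (norm (f x)) \<partial>M) * emeasure Q (space Q)"
      by (simp add: nn_integral_multc)
    also have "\<dots> < \<infinity>"
      using f by (simp add: integrable_iff_bounded ennreal_mult_less_top Q.emeasure_eq_measure)
    finally show "(\<integral>\<^sup>+p. ennreal (norm (f (fst p))) \<partial>(M \<Otimes>\<^sub>M Q)) < \<infinity>" .
  qed simp
  then have "integrable (M \<Otimes>\<^sub>M Q) (\<lambda>(x, y). g x y)"
    by (rule Bochner_Integration.integrable_bound[OF _ meas])
      (simp add: bound order_trans[OF bound abs_ge_self] split_beta)
  then show ?thesis
    by (rule Fubini_integral[symmetric])
qed

section \<open>Polar coordinates and slabs on the sphere\<close>

text \<open>
  Membership in a ball or half-line whose centre, radius or endpoint depends on the point.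
\<close>

lemma pred_in_ball [measurable (raw)]:
  fixes f g :: "'b \<Rightarrow> 'a::euclidean_space"
  assumes [measurable]: "f \<in> borel_measurable M" "g \<in> borel_measurable M" "h \<in> borel_measurable M"
  shows "Measurable.pred M (\<lambda>x. f x \<in> ball (g x) (h x))"
  unfolding mem_ball by measurable

lemma pred_in_greaterThan [measurable (raw)]:
  fixes f g :: "'b \<Rightarrow> real"
  assumes [measurable]: "f \<in> borel_measurable M" "g \<in> borel_measurable M"
  shows "Measurable.pred M (\<lambda>x. f x \<in> {g x<..})"
  unfolding greaterThan_iff by measurable

lemma sets_sphere_measure:
  "sets (sphere_measure :: 'a::euclidean_space measure) = sets (restrict_space borel (sphere 0 1))"
  by (simp add: sphere_measure_def)

lemma borel_measurable_sphere_measure [measurable (raw)]: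
  assumes "g \<in> borel_measurable borel"
  shows "g \<in> borel_measurable (sphere_measure :: 'a::euclidean_space measure)"
  using assms by (simp add: measurable_restrict_space1 measurable_cong_sets[OF sets_sphere_measure refl])

text \<open>
  The surface measure lives on the trace of the Borel sets, so functions that are jointly Borel on
  the whole space have to be restricted before Fubini's theorem applies.
\<close>

lemma borel_measurable_pair_sphere_measure:
  fixes f :: "'b \<Rightarrow> 'a::euclidean_space \<Rightarrow> 'c::topological_space"
  assumes "(\<lambda>(x, \<omega>). f x \<omega>) \<in> borel_measurable (M \<Otimes>\<^sub>M borel)"
  shows "(\<lambda>(x, \<omega>). f x \<omega>) \<in> borel_measurable (M \<Otimes>\<^sub>M sphere_measure)"
proof -
  have s: "(\<lambda>\<omega>. \<omega>) \<in> (sphere_measure :: 'a measure) \<rightarrow>\<^sub>M borel"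
    by (rule borel_measurable_sphere_measure) simp
  have "(\<lambda>p. (fst p, snd p)) \<in> M \<Otimes>\<^sub>M (sphere_measure :: 'a measure) \<rightarrow>\<^sub>M M \<Otimes>\<^sub>M borel"
    by (intro measurable_Pair measurable_compose[OF measurable_snd s] measurable_fst)
  from measurable_compose[OF this assms] show ?thesis by (simp add: split_beta)
qed

lemma nn_integral_sphere_measure:
  fixes g :: "'a::euclidean_space \<Rightarrow> ennreal"
  assumes g [measurable]: "g \<in> borel_measurable borel"
  shows "(\<integral>\<^sup>+\<omega>. g \<omega> \<partial>sphere_measure) =
    of_nat DIM('a) * (\<integral>\<^sup>+x. indicator (ball 0 1) x * g (x /\<^sub>R norm x) \<partial>lborel)"
proof -
  have m: "(\<lambda>x. x /\<^sub>R norm x) \<in>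
      restrict_space lborel (ball 0 1 - {0}) \<rightarrow>\<^sub>M restrict_space borel (sphere (0::'a) 1)"
    by (rule measurable_restrict_space2)
      (auto simp: space_restrict_space intro!: measurable_restrict_space1)
  have g': "g \<in> borel_measurable (restrict_space borel (sphere 0 1))"
    by (simp add: measurable_restrict_space1 g)
  have "(\<integral>\<^sup>+\<omega>. g \<omega> \<partial>sphere_measure) = of_nat DIM('a) *
      (\<integral>\<^sup>+x. g (x /\<^sub>R norm x) * indicator (ball 0 1 - {0}) x \<partial>lborel)"
    unfolding sphere_measure_def using g' m
    by (simp add: nn_integral_scale_measure nn_integral_distr nn_integral_restrict_space)
  also have "(\<integral>\<^sup>+x. g (x /\<^sub>R norm x) * indicator (ball 0 1 - {0}) x \<partial>lborel) =
      (\<integral>\<^sup>+x. indicator (ball 0 1) x * g (x /\<^sub>R norm x) \<partial>lborel)"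
    by (rule nn_integral_cong_AE, rule AE_mp[OF AE_lborel_singleton[of 0]])
      (auto simp: indicator_def)
  finally show ?thesis .
qed

lemma finite_measure_sphere_measure: "finite_measure (sphere_measure :: 'a::euclidean_space measure)"
proof
  have "emeasure sphere_measure (space (sphere_measure :: 'a measure)) = (\<integral>\<^sup>+\<omega>. 1 \<partial>(sphere_measure :: 'a measure))"
    by simp
  also have "\<dots> = of_nat DIM('a) * emeasure lborel (ball (0::'a) 1)"
    by (subst nn_integral_sphere_measure) simp_all
  also have "\<dots> \<noteq> \<infinity>"
    using emeasure_lborel_ball_finite[of "0::'a" 1] by (simp add: ennreal_mult_eq_top_iff)
  finally show "emeasure (sphere_measure :: 'a measure) (space sphere_measure) \<noteq> \<infinity>" .
qed

text \<open>
  By definition the left-hand side is an integral over \<open>x\<close> in the unit ball and \<open>r > 0\<close> of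
  \<open>F(r x/|x|)\<close>.  Substituting \<open>r = t|x|\<close> and then \<open>y = tx\<close> leaves, for fixed \<open>y\<close>, the integral
  \<open>d |y|\<^sup>d \<integral> t\<^sup>-\<^sup>d\<^sup>-\<^sup>1 dt = 1\<close> over \<open>t > |y|\<close>.
\<close>

lemma nn_integral_polar:
  fixes F :: "'a::euclidean_space \<Rightarrow> ennreal"
  assumes [measurable]: "F \<in> borel_measurable borel"
  shows "(\<integral>\<^sup>+\<omega>. (\<integral>\<^sup>+r. indicator {0<..} r * ennreal (r ^ (DIM('a) - 1)) * F (r *\<^sub>R \<omega>) \<partial>lborel) \<partial>sphere_measure)
    = (\<integral>\<^sup>+x. F x \<partial>lborel)"
proof -
  let ?d = "DIM('a)"
  have d: "?d > 0" by simp
  have Suc_d: "Suc (?d - 1) = ?d" using d by simp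
  have pow_d: "a ^ ?d = a * a ^ (?d - 1)" for a :: real
    by (metis Suc_d power_Suc)
  have inner: "(\<integral>\<^sup>+r. indicator {0<..} r * ennreal (r ^ (?d - 1)) * F (r *\<^sub>R (x /\<^sub>R norm x)) \<partial>lborel) =
      (\<integral>\<^sup>+t. indicator {0<..} t * ennreal (t ^ (?d - 1)) * (ennreal (norm x ^ ?d) * F (t *\<^sub>R x)) \<partial>lborel)"
    if "x \<noteq> 0" for x :: 'a
  proof -
    have "indicator {0<..} (norm x * t) * ennreal ((norm x * t) ^ (?d - 1)) * F ((norm x * t) *\<^sub>R (x /\<^sub>R norm x)) * ennreal (norm x)
       = indicator {0<..} t * ennreal (t ^ (?d - 1)) * (ennreal (norm x ^ ?d) * F (t *\<^sub>R x))" for t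
    proof (cases "t > 0")
      case True
      have "ennreal ((norm x * t) ^ (?d - 1)) * ennreal (norm x) = ennreal (t ^ (?d - 1)) * ennreal (norm x ^ ?d)"
        using True by (simp add: pow_d power_mult_distrib ennreal_mult'[symmetric] mult_ac del: One_nat_def)
      then have "ennreal ((norm x * t) ^ (?d - 1)) * ennreal (norm x) * F (t *\<^sub>R x) =
          ennreal (t ^ (?d - 1)) * ennreal (norm x ^ ?d) * F (t *\<^sub>R x)"
        by simp
      then show ?thesis
        using True that by (simp add: indicator_def mult_ac zero_less_mult_iff)
    qed (use that in \<open>simp add: indicator_def zero_less_mult_iff\<close>)
    then show ?thesis
      using that by (subst nn_integral_real_affine[where c="norm x" and t=0])
        (simp_all add: nn_integral_cmult[symmetric] mult_ac)
  qed
  have "(\<integral>\<^sup>+\<omega>. (\<integral>\<^sup>+r. indicator {0<..} r * ennreal (r ^ (?d - 1)) * F (r *\<^sub>R \<omega>) \<partial>lborel) \<partial>sphere_measure)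
     = of_nat ?d * (\<integral>\<^sup>+x. indicator (ball 0 1) x *
       (\<integral>\<^sup>+r. indicator {0<..} r * ennreal (r ^ (?d - 1)) * F (r *\<^sub>R (x /\<^sub>R norm x)) \<partial>lborel) \<partial>lborel)"
    by (rule nn_integral_sphere_measure) measurable
  also have "\<dots> = of_nat ?d * (\<integral>\<^sup>+x. indicator (ball 0 1) x *
       (\<integral>\<^sup>+t. indicator {0<..} t * ennreal (t ^ (?d - 1)) * (ennreal (norm x ^ ?d) * F (t *\<^sub>R x)) \<partial>lborel) \<partial>lborel)"
    by (rule arg_cong[where f="\<lambda>u. of_nat ?d * u"], rule nn_integral_cong_AE,
        rule AE_mp[OF AE_lborel_singleton[of 0]], rule AE_I2, rule impI) (simp only: inner not_False_eq_True)
  also have "\<dots> = of_nat ?d * (\<integral>\<^sup>+x. (\<integral>\<^sup>+t. indicator (ball 0 1) x *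
       (indicator {0<..} t * ennreal (t ^ (?d - 1)) * (ennreal (norm x ^ ?d) * F (t *\<^sub>R x))) \<partial>lborel) \<partial>lborel)"
    by (simp add: nn_integral_cmult)
  also have "\<dots> = of_nat ?d * (\<integral>\<^sup>+t. (\<integral>\<^sup>+x. indicator (ball 0 1) x *
       (indicator {0<..} t * ennreal (t ^ (?d - 1)) * (ennreal (norm x ^ ?d) * F (t *\<^sub>R x))) \<partial>lborel) \<partial>lborel)"
    by (subst lborel_pair.Fubini') simp_all
  also have "\<dots> = of_nat ?d * (\<integral>\<^sup>+t. (\<integral>\<^sup>+y. indicator {norm y<..} t * ennreal (1 / t ^ Suc ?d) * (ennreal (norm y ^ ?d) * F y) \<partial>lborel) \<partial>lborel)"
  proof (rule arg_cong[where f="\<lambda>u. of_nat ?d * u"], rule nn_integral_cong)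
    fix t :: real
    show "(\<integral>\<^sup>+x. indicator (ball 0 1) x *
       (indicator {0<..} t * ennreal (t ^ (?d - 1)) * (ennreal (norm x ^ ?d) * F (t *\<^sub>R x))) \<partial>lborel) =
       (\<integral>\<^sup>+y. indicator {norm y<..} t * ennreal (1 / t ^ Suc ?d) * (ennreal (norm y ^ ?d) * F y) \<partial>lborel)"
    proof (cases "t > 0")
      case True
      have e: "ennreal (t ^ ?d) * (ennreal (1 / t ^ Suc ?d) * ennreal ((t * a) ^ ?d)) =
          ennreal (t ^ (?d - 1)) * ennreal (a ^ ?d)" if "a \<ge> 0" for a
      proof -
        have "t ^ ?d * (1 / t ^ Suc ?d * (t * a) ^ ?d) = t ^ (?d - 1) * a ^ ?d"
          using True by (simp add: pow_d power_mult_distrib field_simps del: One_nat_def)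
        then show ?thesis
          using True that by (simp only: ennreal_mult'[symmetric] mult_nonneg_nonneg zero_le_power less_imp_le divide_nonneg_nonneg zero_le_one)
      qed
      have "(\<integral>\<^sup>+y. indicator {norm y<..} t * ennreal (1 / t ^ Suc ?d) * (ennreal (norm y ^ ?d) * F y) \<partial>lborel)
        = ennreal (t ^ ?d) * (\<integral>\<^sup>+x. indicator {norm (t *\<^sub>R x)<..} t * ennreal (1 / t ^ Suc ?d) * (ennreal (norm (t *\<^sub>R x) ^ ?d) * F (t *\<^sub>R x)) \<partial>lborel)"
        using True by (subst nn_integral_lborel_scale[of _ t]) (simp_all add: ennreal_power)
      also have "\<dots> = (\<integral>\<^sup>+x. ennreal (t ^ ?d) * (indicator {norm (t *\<^sub>R x)<..} t * ennreal (1 / t ^ Suc ?d) * (ennreal (norm (t *\<^sub>R x) ^ ?d) * F (t *\<^sub>R x))) \<partial>lborel)"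
        by (rule nn_integral_cmult[symmetric]) measurable
      also have "\<dots> = (\<integral>\<^sup>+x. indicator (ball 0 1) x *
       (indicator {0<..} t * ennreal (t ^ (?d - 1)) * (ennreal (norm x ^ ?d) * F (t *\<^sub>R x))) \<partial>lborel)"
      proof (rule nn_integral_cong)
        fix x :: 'a
        have "indicator {norm (t *\<^sub>R x)<..} t = (indicator (ball 0 1) x :: ennreal)"
          using True by (auto simp: indicator_def)
        then show "ennreal (t ^ ?d) * (indicator {norm (t *\<^sub>R x)<..} t * ennreal (1 / t ^ Suc ?d) * (ennreal (norm (t *\<^sub>R x) ^ ?d) * F (t *\<^sub>R x)))
          = indicator (ball 0 1) x * (indicator {0<..} t * ennreal (t ^ (?d - 1)) * (ennreal (norm x ^ ?d) * F (t *\<^sub>R x)))"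
          using e[of "norm x"] True by (simp add: indicator_def mult_ac)
      qed
      finally show ?thesis by simp
    next
      case False
      then have "indicator {norm y<..} t = (0::ennreal)" for y :: 'a
        by (auto simp: indicator_def) (meson le_less_trans norm_ge_zero)
      then show ?thesis using False by simp
    qed
  qed
  also have "\<dots> = of_nat ?d * (\<integral>\<^sup>+y. (\<integral>\<^sup>+t. indicator {norm y<..} t * ennreal (1 / t ^ Suc ?d) * (ennreal (norm y ^ ?d) * F y) \<partial>lborel) \<partial>lborel)"
    by (subst lborel_pair.Fubini') simp_all
  also have "\<dots> = (\<integral>\<^sup>+y. (\<integral>\<^sup>+t. ennreal (?d / t ^ Suc ?d) * indicator {norm y<..} t \<partial>lborel) * (ennreal (norm y ^ ?d) * F y) \<partial>lborel)"
  proof -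
    have "of_nat ?d * (\<integral>\<^sup>+t. indicator {norm y<..} t * ennreal (1 / t ^ Suc ?d) * (ennreal (norm y ^ ?d) * F y) \<partial>lborel)
      = (\<integral>\<^sup>+t. ennreal (?d / t ^ Suc ?d) * indicator {norm y<..} t \<partial>lborel) * (ennreal (norm y ^ ?d) * F y)" for y :: 'a
    proof -
      have "of_nat ?d * (\<integral>\<^sup>+t. indicator {norm y<..} t * ennreal (1 / t ^ Suc ?d) * (ennreal (norm y ^ ?d) * F y) \<partial>lborel)
        = (\<integral>\<^sup>+t. of_nat ?d * (indicator {norm y<..} t * ennreal (1 / t ^ Suc ?d) * (ennreal (norm y ^ ?d) * F y)) \<partial>lborel)"
        by (rule nn_integral_cmult[symmetric]) measurable
      also have "\<dots> = (\<integral>\<^sup>+t. (ennreal (?d / t ^ Suc ?d) * indicator {norm y<..} t) * (ennreal (norm y ^ ?d) * F y) \<partial>lborel)"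
      proof (rule nn_integral_cong)
        fix t :: real
        have "of_nat ?d * ennreal (1 / t ^ Suc ?d) = ennreal (?d / t ^ Suc ?d)"
          by (simp add: ennreal_of_nat_eq_real_of_nat ennreal_mult'[symmetric])
        from this [symmetric]
        show "of_nat ?d * (indicator {norm y<..} t * ennreal (1 / t ^ Suc ?d) * (ennreal (norm y ^ ?d) * F y)) =
          (ennreal (?d / t ^ Suc ?d) * indicator {norm y<..} t) * (ennreal (norm y ^ ?d) * F y)"
          by (simp only: mult_ac)
      qed
      also have "\<dots> = (\<integral>\<^sup>+t. ennreal (?d / t ^ Suc ?d) * indicator {norm y<..} t \<partial>lborel) * (ennreal (norm y ^ ?d) * F y)"
        by (rule nn_integral_multc) measurable
      finally show ?thesis .
    qed
    then show ?thesis by (subst nn_integral_cmult[symmetric]) simp_all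
  qed
  also have "\<dots> = (\<integral>\<^sup>+y. F y \<partial>lborel)"
  proof (rule nn_integral_cong_AE, rule AE_mp[OF AE_lborel_singleton[of 0]], rule AE_I2, rule impI)
    fix y :: 'a assume y: "y \<noteq> 0"
    then have ny: "norm y > 0" by simp
    let ?G = "\<lambda>t::real. - (1 / t ^ ?d)" and ?g = "\<lambda>t::real. if t > 0 then ?d / t ^ Suc ?d else 0"
    have "(\<integral>\<^sup>+t. ennreal (?d / t ^ Suc ?d) * indicator {norm y<..} t \<partial>lborel) =
      (\<integral>\<^sup>+t. ennreal (?g t) * indicator {norm y..} t \<partial>lborel)"
      by (rule nn_integral_cong_AE, rule AE_mp[OF AE_lborel_singleton[of "norm y"]], rule AE_I2)
        (auto simp: indicator_def dest: less_le_trans[OF ny])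
    also have "\<dots> = ennreal (0 - ?G (norm y))"
    proof (rule nn_integral_FTC_atLeast)
      show "DERIV ?G t :> ?g t" if "norm y \<le> t" for t
      proof -
        have t: "t > 0" using y that by (meson less_le_trans zero_less_norm_iff)
        have "DERIV ?G t :> - (- (real ?d * t ^ (?d - 1)) / (t ^ ?d * t ^ ?d))"
          using t by (auto intro!: derivative_eq_intros)
        moreover have "- (- (real ?d * t ^ (?d - 1)) / (t ^ ?d * t ^ ?d)) = ?g t"
          using t d by (cases ?d) (auto simp: field_simps)
        ultimately show ?thesis by simp
      qed
      have "((\<lambda>t::real. inverse t ^ ?d) \<longlongrightarrow> 0 ^ ?d) at_top"
        by (intro tendsto_intros tendsto_inverse_0_at_top filterlim_ident)
      from tendsto_minus[OF this] show "(?G \<longlongrightarrow> 0) at_top"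
        using d by (simp add: power_inverse inverse_eq_divide[symmetric] zero_power)
    qed auto
    finally have "(\<integral>\<^sup>+t. ennreal (?d / t ^ Suc ?d) * indicator {norm y<..} t \<partial>lborel) = ennreal (1 / norm y ^ ?d)"
      by simp
    then show "(\<integral>\<^sup>+t. ennreal (?d / t ^ Suc ?d) * indicator {norm y<..} t \<partial>lborel) * (ennreal (norm y ^ ?d) * F y) = F y"
      using y by (simp add: mult.assoc[symmetric] ennreal_mult'[symmetric])
  qed
  finally show ?thesis .
qed

lemma nn_integral_cauchy_le: "(\<integral>\<^sup>+t. ennreal (1 / (1 + t\<^sup>2)) \<partial>lborel) \<le> ennreal pi"
proof -
  have half: "(\<integral>\<^sup>+t. ennreal (1 / (1 + t\<^sup>2)) * indicator {0..} t \<partial>lborel) = ennreal (pi / 2)"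
    by (subst nn_integral_FTC_atLeast[where F=arctan and T="pi / 2"])
      (auto intro!: derivative_eq_intros tendsto_arctan_at_top simp: field_simps add_nonneg_nonneg)
  have "(\<integral>\<^sup>+t. ennreal (1 / (1 + t\<^sup>2)) * indicator {0..} t \<partial>lborel)
      = (\<integral>\<^sup>+t. ennreal (1 / (1 + t\<^sup>2)) * indicator {..0} t \<partial>lborel)"
    by (subst nn_integral_real_affine[where c="-1" and t=0]) (auto intro!: nn_integral_cong simp: indicator_def)
  with half have half': "(\<integral>\<^sup>+t. ennreal (1 / (1 + t\<^sup>2)) * indicator {..0::real} t \<partial>lborel) = ennreal (pi / 2)"
    by simp
  have "(\<integral>\<^sup>+t. ennreal (1 / (1 + t\<^sup>2)) \<partial>lborel) \<le>
     (\<integral>\<^sup>+t. ennreal (1 / (1 + t\<^sup>2)) * indicator {0..} t + ennreal (1 / (1 + t\<^sup>2)) * indicator {..0} t \<partial>lborel)"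
    by (intro nn_integral_mono) (auto simp: indicator_def)
  also have "\<dots> = ennreal (pi / 2) + ennreal (pi / 2)"
    by (subst nn_integral_add) (simp_all add: half half')
  finally show ?thesis by (simp flip: ennreal_plus)
qed

text \<open>
  A frequency \<open>\<xi>\<close> is felt only by the directions in a slab of width about \<open>1/|\<xi>|\<close> around its
  orthogonal complement.  In the cone description of the surface measure, \<open>|\<xi> \<bullet> x| \<le> |\<xi> \<bullet> x/|x||\<close> for
  \<open>x\<close> in the unit ball, so the direction may be replaced by \<open>x\<close> itself; after a rotation of \<open>\<xi>\<close> to a
  coordinate axis the integral over the surrounding cube factorises.
\<close>

lemma sphere_slab_integral:
  "\<exists>K\<ge>0. \<forall>\<xi>::'a::euclidean_space. \<xi> \<noteq> 0 \<longrightarrow>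
    (\<integral>\<^sup>+\<omega>. ennreal (1 / (1 + (\<xi> \<bullet> \<omega>)\<^sup>2)) \<partial>sphere_measure) \<le> ennreal (K / norm \<xi>)"
proof -
  define K where "K = real DIM('a) * (pi * 2 ^ (DIM('a) - 1))"
  have "(\<integral>\<^sup>+\<omega>. ennreal (1 / (1 + (\<xi> \<bullet> \<omega>)\<^sup>2)) \<partial>sphere_measure) \<le> ennreal (K / norm \<xi>)"
    if "\<xi> \<noteq> 0" for \<xi> :: 'a
  proof -
    define e where "e = (SOME b. b \<in> (Basis::'a set))"
    have e: "e \<in> Basis" unfolding e_def by (rule SOME_Basis)
    obtain f where f: "orthogonal_transformation f" "f (norm \<xi> *\<^sub>R e) = \<xi>"
      using orthogonal_transformation_exists_norm_eq[of "norm \<xi> *\<^sub>R e" \<xi>] e by auto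
    note [measurable] = orthogonal_transformation_borel[OF f(1)]
    \<comment> \<open>The coordinate along \<open>e\<close> carries the slab, the others range over the sides of a cube.\<close>
    define h where "h b t = (if b = e then ennreal (1 / (1 + (norm \<xi> * t)\<^sup>2)) else indicator {-1..1} t)" for b and t :: real
    have [measurable]: "h b \<in> borel_measurable borel" for b
      unfolding h_def by measurable
    have "(\<integral>\<^sup>+\<omega>. ennreal (1 / (1 + (\<xi> \<bullet> \<omega>)\<^sup>2)) \<partial>sphere_measure) =
      of_nat DIM('a) * (\<integral>\<^sup>+x. indicator (ball 0 1) x * ennreal (1 / (1 + (\<xi> \<bullet> (x /\<^sub>R norm x))\<^sup>2)) \<partial>lborel)"
      by (rule nn_integral_sphere_measure) measurable
    also have "\<dots> \<le> of_nat DIM('a) * (\<integral>\<^sup>+x. indicator (ball 0 1) x * ennreal (1 / (1 + (\<xi> \<bullet> x)\<^sup>2)) \<partial>lborel)"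
    proof (rule mult_left_mono[OF nn_integral_mono])
      fix x :: 'a
      have "1 / (1 + (\<xi> \<bullet> (x /\<^sub>R norm x))\<^sup>2) \<le> 1 / (1 + (\<xi> \<bullet> x)\<^sup>2)" if "norm x < 1"
      proof (cases "x = 0")
        case False
        then have "\<bar>\<xi> \<bullet> x\<bar> \<le> \<bar>\<xi> \<bullet> (x /\<^sub>R norm x)\<bar>"
          using that by (simp add: abs_mult divide_simps mult_left_le)
        then have "(\<xi> \<bullet> x)\<^sup>2 \<le> (\<xi> \<bullet> (x /\<^sub>R norm x))\<^sup>2"
          by (simp only: abs_le_square_iff)
        then show ?thesis by (intro divide_left_mono) (auto simp: add_pos_nonneg)
      qed simp
      then show "indicator (ball 0 1) x * ennreal (1 / (1 + (\<xi> \<bullet> (x /\<^sub>R norm x))\<^sup>2)) \<le>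
          indicator (ball 0 1) x * ennreal (1 / (1 + (\<xi> \<bullet> x)\<^sup>2))"
        by (auto simp: indicator_def intro!: ennreal_leI)
    qed simp
    also have "(\<integral>\<^sup>+x. indicator (ball 0 1) x * ennreal (1 / (1 + (\<xi> \<bullet> x)\<^sup>2)) \<partial>lborel) =
        (\<integral>\<^sup>+x. indicator (ball 0 1) (f x) * ennreal (1 / (1 + (\<xi> \<bullet> f x)\<^sup>2)) \<partial>lborel)"
      by (rule nn_integral_lborel_orthogonal[OF f(1), symmetric]) simp
    also have "\<dots> \<le> (\<integral>\<^sup>+x. (\<Prod>b\<in>Basis. h b (x \<bullet> b)) \<partial>lborel)"
    proof (intro nn_integral_mono)
      fix x :: 'a
      have "\<xi> \<bullet> f x = f (norm \<xi> *\<^sub>R e) \<bullet> f x" by (simp add: f(2))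
      also have "\<dots> = norm \<xi> * (x \<bullet> e)"
        using f(1) by (simp add: orthogonal_transformation_def inner_commute)
      finally have \<xi>f: "\<xi> \<bullet> f x = norm \<xi> * (x \<bullet> e)" .
      have "norm (f x) = norm x" using f(1) by (simp add: orthogonal_transformation_norm)
      moreover have "(\<Prod>b\<in>Basis. h b (x \<bullet> b)) = ennreal (1 / (1 + (norm \<xi> * (x \<bullet> e))\<^sup>2))" if "norm x < 1"
      proof -
        have "\<bar>x \<bullet> b\<bar> \<le> 1" if "b \<in> Basis" for b
          using Basis_le_norm[OF that, of x] \<open>norm x < 1\<close> by simp
        then have "(\<Prod>b\<in>Basis - {e}. h b (x \<bullet> b)) = 1"
          by (intro prod.neutral) (auto simp: h_def indicator_def abs_le_iff)
        then show ?thesis using e by (subst prod.remove[of _ e]) (auto simp: h_def)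
      qed
      ultimately show "indicator (ball 0 1) (f x) * ennreal (1 / (1 + (\<xi> \<bullet> f x)\<^sup>2)) \<le> (\<Prod>b\<in>Basis. h b (x \<bullet> b))"
        by (auto simp: indicator_def \<xi>f)
    qed
    also have "\<dots> = (\<Prod>b\<in>Basis. \<integral>\<^sup>+t. h b t \<partial>lborel)"
      by (rule nn_integral_lborel_prod) auto
    also have "\<dots> = (\<integral>\<^sup>+t. h e t \<partial>lborel) * (\<Prod>b\<in>Basis - {e}. \<integral>\<^sup>+t. h b t \<partial>lborel)"
      using e by (intro prod.remove) auto
    also have "(\<Prod>b\<in>Basis - {e}. \<integral>\<^sup>+t. h b t \<partial>lborel) = (\<Prod>b\<in>Basis - {e}. ennreal 2)"
      by (intro prod.cong refl) (simp add: h_def)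
    also have "\<dots> = ennreal (2 ^ (DIM('a) - 1))"
      using e by (simp add: ennreal_numeral[symmetric] ennreal_power del: ennreal_numeral)
    also have "(\<integral>\<^sup>+t. h e t \<partial>lborel) \<le> ennreal (pi / norm \<xi>)"
    proof -
      have "ennreal (norm \<xi>) * (\<integral>\<^sup>+t. h e t \<partial>lborel) \<le> ennreal pi"
        using nn_integral_cauchy_le that
        by (subst (asm) nn_integral_real_affine[where c="norm \<xi>" and t=0]) (auto simp: h_def)
      then have "ennreal (1 / norm \<xi>) * (ennreal (norm \<xi>) * (\<integral>\<^sup>+t. h e t \<partial>lborel)) \<le> ennreal (1 / norm \<xi>) * ennreal pi"
        by (intro mult_left_mono) auto
      then show ?thesis
        using that by (simp add: mult.assoc[symmetric] ennreal_mult'[symmetric])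
    qed
    finally have "(\<integral>\<^sup>+\<omega>. ennreal (1 / (1 + (\<xi> \<bullet> \<omega>)\<^sup>2)) \<partial>sphere_measure)
        \<le> of_nat DIM('a) * (ennreal (pi / norm \<xi>) * ennreal (2 ^ (DIM('a) - 1)))"
      by (simp add: mult_left_mono mult_right_mono)
    also have "\<dots> = ennreal (K / norm \<xi>)"
      by (simp add: K_def ennreal_of_nat_eq_real_of_nat ennreal_mult'[symmetric] mult_ac)
    finally show ?thesis .
  qed
  moreover have "K \<ge> 0" by (simp add: K_def)
  ultimately show ?thesis by blast
qed

section \<open>The area of spherical caps\<close>

text \<open>
  The circular cone with axis \<open>\<omega>\<close> and slope \<open>t\<close>, cut off by a hyperplane at height \<open>h\<close>.  Unlike
  the cone over a spherical cap, it is an exact linear image of the cone with \<open>t = h = 1\<close>.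
\<close>

definition flat_cone :: "real \<Rightarrow> real \<Rightarrow> 'a::euclidean_space \<Rightarrow> 'a set" where
  "flat_cone t h \<omega> = {x. 0 < x \<bullet> \<omega> \<and> x \<bullet> \<omega> < h \<and> (norm x)\<^sup>2 - (x \<bullet> \<omega>)\<^sup>2 < t\<^sup>2 * (x \<bullet> \<omega>)\<^sup>2}"

lemma flat_cone_borel [measurable]: "flat_cone t h \<omega> \<in> sets borel"
  unfolding flat_cone_def by measurable

lemma emeasure_flat_cone_rotate:
  fixes e \<omega> :: "'a::euclidean_space"
  assumes "norm e = 1" "norm \<omega> = 1"
  shows "emeasure lborel (flat_cone t h \<omega>) = emeasure lborel (flat_cone t h e)"
proof -
  obtain f where f: "orthogonal_transformation f" "f e = \<omega>"
    using orthogonal_transformation_exists_norm_eq[of e \<omega>] assms by auto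
  have "f x \<bullet> \<omega> = x \<bullet> e" "norm (f x) = norm x" for x
    using f by (auto simp: orthogonal_transformation_def orthogonal_transformation_norm)
  then have eq: "indicator (flat_cone t h \<omega>) (f x) = (indicator (flat_cone t h e) x :: ennreal)" for x
    by (simp add: flat_cone_def indicator_def)
  have "(\<integral>\<^sup>+x. indicator (flat_cone t h \<omega>) (f x) \<partial>lborel) = (\<integral>\<^sup>+x. indicator (flat_cone t h \<omega>) x \<partial>lborel)"
    by (rule nn_integral_lborel_orthogonal[OF f(1)]) simp
  then show ?thesis by (simp add: eq)
qed

lemma emeasure_flat_cone_scale:
  fixes e :: "'a::euclidean_space"
  assumes e: "e \<in> Basis" and "t > 0" "h > 0"
  shows "emeasure lborel (flat_cone t h e) = ennreal (t ^ (DIM('a) - 1) * h ^ DIM('a)) * emeasure lborel (flat_cone 1 1 e)"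
proof -
  define c where "c j = (if j = e then h else h * t)" for j
  \<comment> \<open>Stretch the axis \<open>e\<close> by \<open>h\<close> and all orthogonal directions by \<open>h t\<close>.\<close>
  define D where "D x = 0 + (\<Sum>j\<in>Basis. (c j * (x \<bullet> j)) *\<^sub>R j)" for x :: 'a
  have [measurable]: "D \<in> borel_measurable borel" by (simp add: D_def[abs_def])
  have c: "c j \<noteq> 0" for j using assms by (simp add: c_def)
  have lb: "(lborel :: 'a measure) = density (distr lborel borel D) (\<lambda>_. (\<Prod>j\<in>Basis. \<bar>c j\<bar>))"
    unfolding D_def by (rule lborel_affine_euclidean) (rule c)
  have Dj: "D x \<bullet> j = c j * (x \<bullet> j)" if "j \<in> Basis" for x j
    using that by (simp add: D_def inner_sum_left_Basis)
  have nrm: "(norm x)\<^sup>2 - (x \<bullet> e)\<^sup>2 = (\<Sum>j\<in>Basis - {e}. (x \<bullet> j)\<^sup>2)" for x :: 'a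
  proof -
    have "(norm x)\<^sup>2 = (\<Sum>j\<in>Basis. (x \<bullet> j)\<^sup>2)"
      unfolding power2_norm_eq_inner by (subst euclidean_inner) (simp add: power2_eq_square)
    then show ?thesis using e by (simp add: sum.remove[of _ e])
  qed
  have "(norm (D x))\<^sup>2 - (D x \<bullet> e)\<^sup>2 = (h * t)\<^sup>2 * ((norm x)\<^sup>2 - (x \<bullet> e)\<^sup>2)" for x
    unfolding nrm sum_distrib_left by (intro sum.cong refl) (simp add: Dj c_def power_mult_distrib)
  moreover have "D x \<bullet> e = h * (x \<bullet> e)" for x
    using e by (simp add: Dj c_def)
  ultimately have "D x \<in> flat_cone t h e \<longleftrightarrow> x \<in> flat_cone 1 1 e" for x
    using assms
    by (auto simp: flat_cone_def zero_less_mult_iff power_mult_distrib mult.left_commute[of "t\<^sup>2"] mult.assoc)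
  then have vim: "D -` flat_cone t h e = flat_cone 1 1 e" by auto
  have "(\<Prod>j\<in>Basis. \<bar>c j\<bar>) = h * (\<Prod>j\<in>Basis - {e}. \<bar>c j\<bar>)"
    using e assms by (subst prod.remove[of _ e]) (auto simp: c_def)
  also have "(\<Prod>j\<in>Basis - {e}. \<bar>c j\<bar>) = (\<Prod>j\<in>Basis - {e}. h * t)"
    using assms by (intro prod.cong refl) (auto simp: c_def abs_mult)
  also have "\<dots> = (h * t) ^ (DIM('a) - 1)"
    using e by simp
  also have "h * (h * t) ^ (DIM('a) - 1) = t ^ (DIM('a) - 1) * h ^ DIM('a)"
    by (subst power_eq_if[of h "DIM('a)"]) (simp add: power_mult_distrib)
  finally have prod: "(\<Prod>j\<in>Basis. \<bar>c j\<bar>) = t ^ (DIM('a) - 1) * h ^ DIM('a)" .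
  have "emeasure lborel (flat_cone t h e) = (\<Prod>j\<in>Basis. \<bar>c j\<bar>) * emeasure (distr lborel borel D) (flat_cone t h e)"
    by (subst lb) (simp add: emeasure_density_const)
  also have "emeasure (distr lborel borel D) (flat_cone t h e) = emeasure lborel (flat_cone 1 1 e)"
    by (simp add: emeasure_distr vim)
  finally show ?thesis unfolding prod .
qed

text \<open>
  The volume of the unit ball of dimension \<open>d - 1\<close>, written as \<open>d\<close> times the volume of a cone over
  it.
\<close>

definition sphere_cap_constant :: "'a::euclidean_space itself \<Rightarrow> real" where
  "sphere_cap_constant _ = DIM('a) * measure lborel (flat_cone 1 1 (SOME b. b \<in> (Basis :: 'a set)))"

lemma emeasure_flat_cone_unit:
  fixes \<omega> :: "'a::euclidean_space"
  assumes "norm \<omega> = 1" "t > 0" "h > 0"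
  shows "of_nat DIM('a) * emeasure lborel (flat_cone t h \<omega>) =
    ennreal (t ^ (DIM('a) - 1) * h ^ DIM('a) * sphere_cap_constant TYPE('a))"
proof -
  define e where "e = (SOME b. b \<in> (Basis::'a set))"
  have e: "e \<in> Basis" unfolding e_def by (rule SOME_Basis)
  have "flat_cone 1 1 e \<subseteq> ball 0 2"
  proof
    fix x assume x: "x \<in> flat_cone 1 1 e"
    then have "(x \<bullet> e)\<^sup>2 < 1\<^sup>2" by (intro power_strict_mono) (auto simp: flat_cone_def)
    then have "(norm x)\<^sup>2 < 2\<^sup>2" using x by (auto simp: flat_cone_def)
    then have "norm x < 2" by (rule power2_less_imp_less) simp
    then show "x \<in> ball 0 2" by simp
  qed
  from emeasure_mono[OF this, of lborel]
  have "emeasure lborel (flat_cone 1 1 e) \<le> emeasure lborel (ball (0::'a) 2)"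
    by simp
  then have "emeasure lborel (flat_cone 1 1 e) < \<infinity>"
    using emeasure_lborel_ball_finite le_less_trans by blast
  then have fin: "emeasure lborel (flat_cone 1 1 e) = ennreal (measure lborel (flat_cone 1 1 e))"
    by (simp add: emeasure_eq_ennreal_measure)
  have "emeasure lborel (flat_cone t h \<omega>) = ennreal (t ^ (DIM('a) - 1) * h ^ DIM('a)) * emeasure lborel (flat_cone 1 1 e)"
    using emeasure_flat_cone_rotate[of e \<omega>] emeasure_flat_cone_scale[OF e assms(2,3)] e assms(1) by simp
  then show ?thesis
    using assms(2,3) unfolding fin sphere_cap_constant_def e_def[symmetric]
    by (simp add: ennreal_of_nat_eq_real_of_nat ennreal_mult'[symmetric] mult_ac del: One_nat_def)
qed

lemma sphere_cap_constant_pos: "sphere_cap_constant TYPE('a::euclidean_space) > 0"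
proof -
  define e where "e = (SOME b. b \<in> (Basis::'a set))"
  have e: "e \<in> Basis" unfolding e_def by (rule SOME_Basis)
  have "open (flat_cone 1 1 e)"
    unfolding flat_cone_def by (intro open_Collect_conj open_Collect_less continuous_intros)
  moreover have "(1/2) *\<^sub>R e \<in> flat_cone 1 1 e"
    using e by (simp add: flat_cone_def power2_eq_square)
  ultimately have "emeasure lborel (flat_cone 1 1 e) \<noteq> 0"
    using open_not_negligible[of "flat_cone 1 1 e"] by (auto simp: negligible_iff_null_sets null_sets_def)
  then have "of_nat DIM('a) * emeasure lborel (flat_cone 1 1 e) > 0"
    by (simp add: zero_less_iff_neq_zero)
  then show ?thesis
    using emeasure_flat_cone_unit[of e 1 1] e by (simp add: ennreal_zero_less_mult_iff)
qed

text \<open>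
  The directions at distance less than \<open>\<epsilon>\<close> from \<open>\<omega>\<close> are those with \<open>x \<bullet> \<omega> > c|x|\<close>, a circular cone
  of slope \<open>t\<close>.  The part of this cone in the unit ball lies between the flat cones of heights \<open>c\<close>
  and \<open>1\<close>.
\<close>

lemma sphere_cap_bounds:
  fixes \<omega> :: "'a::euclidean_space"
  assumes \<omega>: "norm \<omega> = 1" and \<epsilon>: "0 < \<epsilon>" "\<epsilon> \<le> 1"
  defines "c \<equiv> 1 - \<epsilon>\<^sup>2 / 2"
  defines "t \<equiv> sqrt (1 - c\<^sup>2) / c"
  shows "ennreal (t ^ (DIM('a) - 1) * c ^ DIM('a) * sphere_cap_constant TYPE('a)) \<le> (\<integral>\<^sup>+x. indicator (ball \<omega> \<epsilon>) x \<partial>sphere_measure)"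
    and "(\<integral>\<^sup>+x. indicator (ball \<omega> \<epsilon>) x \<partial>sphere_measure) \<le> ennreal (t ^ (DIM('a) - 1) * sphere_cap_constant TYPE('a))"
proof -
  have "\<epsilon>\<^sup>2 \<le> 1" using \<epsilon> by (simp add: power_le_one)
  moreover have "0 < \<epsilon>\<^sup>2" using \<epsilon> by simp
  ultimately have c: "0 < c" "c < 1" by (auto simp: c_def)
  have c2: "c\<^sup>2 < 1" using c by (simp add: power_less_one_iff)
  have t: "t > 0" using c c2 by (simp add: t_def)
  have t2: "t\<^sup>2 = (1 - c\<^sup>2) / c\<^sup>2" using c2 by (simp add: t_def power_divide)
  have cone: "x /\<^sub>R norm x \<in> ball \<omega> \<epsilon> \<longleftrightarrow> 0 < x \<bullet> \<omega> \<and> (norm x)\<^sup>2 - (x \<bullet> \<omega>)\<^sup>2 < t\<^sup>2 * (x \<bullet> \<omega>)\<^sup>2"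
    if x: "x \<noteq> 0" for x
  proof -
    have nx: "norm x > 0" using x by simp
    have "x /\<^sub>R norm x \<in> ball \<omega> \<epsilon> \<longleftrightarrow> (norm (\<omega> - x /\<^sub>R norm x))\<^sup>2 < \<epsilon>\<^sup>2"
    proof -
      have "norm (\<omega> - x /\<^sub>R norm x) < \<epsilon> \<longleftrightarrow> (norm (\<omega> - x /\<^sub>R norm x))\<^sup>2 < \<epsilon>\<^sup>2"
        using \<epsilon> by (meson less_imp_le norm_ge_zero pos2 power2_less_imp_less power_strict_mono)
      then show ?thesis by (simp add: dist_norm)
    qed
    also have "(norm (\<omega> - x /\<^sub>R norm x))\<^sup>2 = 2 - 2 * (x \<bullet> \<omega>) / norm x"
      using nx \<omega> by (simp add: power2_norm_eq_inner inner_diff_left inner_diff_right inner_commute norm_eq_1 divide_inverse)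
        (simp add: dot_square_norm power2_eq_square field_simps)
    also have "2 - 2 * (x \<bullet> \<omega>) / norm x < \<epsilon>\<^sup>2 \<longleftrightarrow> c * norm x < x \<bullet> \<omega>"
      using nx by (simp add: c_def field_simps)
    also have "\<dots> \<longleftrightarrow> 0 < x \<bullet> \<omega> \<and> (c * norm x)\<^sup>2 < (x \<bullet> \<omega>)\<^sup>2"
    proof -
      have "0 < c * norm x" using c nx by simp
      then show ?thesis by (meson less_imp_le less_trans pos2 power2_less_imp_less power_strict_mono)
    qed
    also have "(c * norm x)\<^sup>2 < (x \<bullet> \<omega>)\<^sup>2 \<longleftrightarrow> (norm x)\<^sup>2 - (x \<bullet> \<omega>)\<^sup>2 < t\<^sup>2 * (x \<bullet> \<omega>)\<^sup>2"
      unfolding t2 using c by (simp add: field_simps power_mult_distrib)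
    finally show ?thesis .
  qed
  have int: "(\<integral>\<^sup>+x. indicator (ball \<omega> \<epsilon>) x \<partial>sphere_measure) =
      of_nat DIM('a) * emeasure lborel {x \<in> ball 0 1 - {0}. x /\<^sub>R norm x \<in> ball \<omega> \<epsilon>}"
  proof -
    have "(\<integral>\<^sup>+x. indicator (ball \<omega> \<epsilon>) x \<partial>sphere_measure) =
       of_nat DIM('a) * (\<integral>\<^sup>+x. indicator (ball 0 1) x * indicator (ball \<omega> \<epsilon>) (x /\<^sub>R norm x) \<partial>lborel)"
      by (rule nn_integral_sphere_measure) simp
    also have "(\<integral>\<^sup>+x. indicator (ball 0 1) x * indicator (ball \<omega> \<epsilon>) (x /\<^sub>R norm x) \<partial>lborel) =
        (\<integral>\<^sup>+x. indicator {x \<in> ball 0 1 - {0}. x /\<^sub>R norm x \<in> ball \<omega> \<epsilon>} x \<partial>(lborel :: 'a measure))"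
      by (rule nn_integral_cong_AE, rule AE_mp[OF AE_lborel_singleton[of 0]], rule AE_I2) (simp add: indicator_def)
    also have "\<dots> = emeasure lborel {x \<in> ball 0 1 - {0}. x /\<^sub>R norm x \<in> ball \<omega> \<epsilon>}"
      by (rule nn_integral_indicator) measurable
    finally show ?thesis .
  qed
  have sub1: "flat_cone t c \<omega> \<subseteq> {x \<in> ball 0 1 - {0}. x /\<^sub>R norm x \<in> ball \<omega> \<epsilon>}"
  proof
    fix x assume x: "x \<in> flat_cone t c \<omega>"
    then have x0: "x \<noteq> 0" and pos: "0 < x \<bullet> \<omega>" "x \<bullet> \<omega> < c"
      and l: "(norm x)\<^sup>2 - (x \<bullet> \<omega>)\<^sup>2 < t\<^sup>2 * (x \<bullet> \<omega>)\<^sup>2"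
      by (auto simp: flat_cone_def)
    have "(norm x)\<^sup>2 < (1 + t\<^sup>2) * (x \<bullet> \<omega>)\<^sup>2" using l by (simp add: algebra_simps)
    also have "1 + t\<^sup>2 = 1 / c\<^sup>2" using c by (simp add: t2 field_simps)
    also have "1 / c\<^sup>2 * (x \<bullet> \<omega>)\<^sup>2 \<le> 1 / c\<^sup>2 * c\<^sup>2"
      using pos by (intro mult_left_mono power_mono) auto
    finally have "(norm x)\<^sup>2 < 1\<^sup>2" using c by simp
    then have "norm x < 1" by (rule power2_less_imp_less) simp
    then show "x \<in> {x \<in> ball 0 1 - {0}. x /\<^sub>R norm x \<in> ball \<omega> \<epsilon>}"
      using cone[OF x0] x0 pos l by auto
  qed
  have sub2: "{x \<in> ball 0 1 - {0}. x /\<^sub>R norm x \<in> ball \<omega> \<epsilon>} \<subseteq> flat_cone t 1 \<omega>"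
  proof
    fix x assume x: "x \<in> {x \<in> ball 0 1 - {0}. x /\<^sub>R norm x \<in> ball \<omega> \<epsilon>}"
    then have x0: "x \<noteq> 0" and nx: "norm x < 1" by auto
    have "x \<bullet> \<omega> \<le> norm x" using norm_cauchy_schwarz[of x \<omega>] \<omega> by simp
    then show "x \<in> flat_cone t 1 \<omega>"
      using cone[OF x0] x nx by (auto simp: flat_cone_def)
  qed
  have [measurable]: "{x \<in> ball 0 1 - {0}. x /\<^sub>R norm x \<in> ball \<omega> \<epsilon>} \<in> sets borel"
    by measurable
  show "ennreal (t ^ (DIM('a) - 1) * c ^ DIM('a) * sphere_cap_constant TYPE('a)) \<le> (\<integral>\<^sup>+x. indicator (ball \<omega> \<epsilon>) x \<partial>sphere_measure)"
    unfolding int emeasure_flat_cone_unit[OF \<omega> t c(1), symmetric]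
    by (intro mult_left_mono emeasure_mono sub1) auto
  show "(\<integral>\<^sup>+x. indicator (ball \<omega> \<epsilon>) x \<partial>sphere_measure) \<le> ennreal (t ^ (DIM('a) - 1) * sphere_cap_constant TYPE('a))"
    unfolding int using emeasure_flat_cone_unit[OF \<omega> t zero_less_one]
      mult_left_mono[OF emeasure_mono[OF sub2], of lborel "of_nat DIM('a)"] by simp
qed

definition cap_area :: "real \<Rightarrow> 'a::euclidean_space \<Rightarrow> real" where
  "cap_area \<epsilon> \<omega> = measure sphere_measure (ball \<omega> \<epsilon> \<inter> sphere 0 1)"

lemma nn_integral_cap:
  "(\<integral>\<^sup>+x. indicator (ball \<omega> \<epsilon>) x \<partial>sphere_measure) = ennreal (cap_area \<epsilon> (\<omega>::'a::euclidean_space))"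
proof -
  interpret finite_measure "sphere_measure :: 'a measure" by (rule finite_measure_sphere_measure)
  have "(\<integral>\<^sup>+x. indicator (ball \<omega> \<epsilon>) x \<partial>sphere_measure) =
      (\<integral>\<^sup>+x. indicator (ball \<omega> \<epsilon> \<inter> sphere 0 1) x \<partial>(sphere_measure :: 'a measure))"
    by (rule nn_integral_cong) (auto simp: space_sphere_measure indicator_def)
  also have "\<dots> = emeasure sphere_measure (ball \<omega> \<epsilon> \<inter> sphere 0 1)"
    by (rule nn_integral_indicator) (auto simp: sets_sphere_measure sets_restrict_space_iff)
  finally show ?thesis by (simp add: cap_area_def emeasure_eq_measure)
qed

text \<open>
  Both \<open>c\<close> and \<open>t/\<epsilon>\<close> equal \<open>1\<close> up to an error of order \<open>\<epsilon>\<^sup>2\<close>.  The weaker error \<open>min 1 \<epsilon>\<close> is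
  uniform over all radii and suffices, since \<open>min 1 \<epsilon> \<le> \<epsilon>\<^sup>a\<close> for every \<open>a\<close> between \<open>0\<close> and \<open>1\<close>.
\<close>

lemma cap_area_asymptotics:
  "\<exists>K\<ge>0. \<forall>\<epsilon>>0. \<forall>\<omega>::'a::euclidean_space. norm \<omega> = 1 \<longrightarrow>
    \<bar>cap_area \<epsilon> \<omega> / \<epsilon> ^ (DIM('a) - 1) - sphere_cap_constant TYPE('a)\<bar> \<le> K * min 1 \<epsilon>"
proof -
  interpret finite_measure "sphere_measure :: 'a measure" by (rule finite_measure_sphere_measure)
  let ?v = "sphere_cap_constant TYPE('a)" and ?n = "DIM('a) - 1"
  have v: "?v > 0" by (rule sphere_cap_constant_pos)
  define S where "S = measure sphere_measure (space (sphere_measure :: 'a measure))"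
  define K where "K = ?v * (DIM('a) * 2 ^ DIM('a)) + S"
  have S0: "S \<ge> 0" by (simp add: S_def)
  have K0: "K \<ge> 0" using v S0 by (simp add: K_def)
  have main: "\<bar>cap_area \<epsilon> \<omega> / \<epsilon> ^ ?n - ?v\<bar> \<le> K * min 1 \<epsilon>" if \<epsilon>: "\<epsilon> > 0" and \<omega>: "norm \<omega> = 1" for \<epsilon> and \<omega> :: 'a
  proof (cases "\<epsilon> \<le> 1")
    case True
    define c where "c = 1 - \<epsilon>\<^sup>2 / 2"
    define t where "t = sqrt (1 - c\<^sup>2) / c"
    have e1: "\<epsilon>\<^sup>2 \<le> 1" using \<epsilon> True by (simp add: power_le_one)
    have e0: "0 < \<epsilon>\<^sup>2" using \<epsilon> by simp
    have c: "1 / 2 \<le> c" "c < 1" using e1 e0 by (auto simp: c_def)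
    have c2: "c\<^sup>2 < 1" using c by (simp add: power_less_one_iff)
    have t0: "t > 0" using c c2 by (simp add: t_def)
    have t2: "t\<^sup>2 = \<epsilon>\<^sup>2 * (1 - \<epsilon>\<^sup>2 / 4) / c\<^sup>2"
      using c2 by (simp add: t_def power_divide c_def power2_eq_square field_simps)
    have "c\<^sup>2 \<le> 1 - \<epsilon>\<^sup>2 / 4"
    proof -
      have "\<epsilon>\<^sup>2 * \<epsilon>\<^sup>2 \<le> \<epsilon>\<^sup>2 * 1" using e1 by (intro mult_left_mono) auto
      moreover have "c\<^sup>2 = 1 - \<epsilon>\<^sup>2 + \<epsilon>\<^sup>2 * \<epsilon>\<^sup>2 / 4"
        by (simp add: c_def power2_eq_square algebra_simps)
      ultimately show ?thesis using e0 by linarith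
    qed
    then have "\<epsilon>\<^sup>2 * 1 \<le> \<epsilon>\<^sup>2 * ((1 - \<epsilon>\<^sup>2 / 4) / c\<^sup>2)"
      using c by (intro mult_left_mono) (auto simp: pos_le_divide_eq)
    then have "\<epsilon>\<^sup>2 \<le> t\<^sup>2" by (simp add: t2)
    then have te: "\<epsilon> \<le> t" using t0 by (intro power2_le_imp_le[of \<epsilon> t]) auto
    have "(1 - \<epsilon>\<^sup>2 / 4) / c\<^sup>2 \<le> 1 / c\<^sup>2" by (intro divide_right_mono) auto
    then have "\<epsilon>\<^sup>2 * ((1 - \<epsilon>\<^sup>2 / 4) / c\<^sup>2) \<le> \<epsilon>\<^sup>2 * (1 / c\<^sup>2)" by (intro mult_left_mono) auto
    then have "t\<^sup>2 \<le> (\<epsilon> / c)\<^sup>2" by (simp add: t2 power_divide)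
    then have te2: "t \<le> \<epsilon> / c" using \<epsilon> c by (intro power2_le_imp_le[of t "\<epsilon> / c"]) auto
    have t: "1 \<le> t / \<epsilon>" "t / \<epsilon> \<le> 1 / c" using te te2 \<epsilon> c by (auto simp: field_simps)
    have low: "t ^ ?n * c ^ DIM('a) * ?v \<le> cap_area \<epsilon> \<omega>"
      and upp: "cap_area \<epsilon> \<omega> \<le> t ^ ?n * ?v"
      using sphere_cap_bounds[OF \<omega> \<epsilon> True] v t0
      by (simp_all add: nn_integral_cap c_def[symmetric] t_def[symmetric] ennreal_le_iff cap_area_def)
    have low': "c ^ DIM('a) * ?v \<le> cap_area \<epsilon> \<omega> / \<epsilon> ^ ?n"
    proof -
      have "1 * (c ^ DIM('a) * ?v) \<le> (t / \<epsilon>) ^ ?n * (c ^ DIM('a) * ?v)"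
        using t v c by (intro mult_right_mono one_le_power) auto
      also have "\<dots> = (t ^ ?n * c ^ DIM('a) * ?v) / \<epsilon> ^ ?n" by (simp add: power_divide)
      also have "\<dots> \<le> cap_area \<epsilon> \<omega> / \<epsilon> ^ ?n" using low \<epsilon> by (intro divide_right_mono) auto
      finally show ?thesis by simp
    qed
    have upp': "cap_area \<epsilon> \<omega> / \<epsilon> ^ ?n \<le> (1 / c) ^ ?n * ?v"
    proof -
      have "cap_area \<epsilon> \<omega> / \<epsilon> ^ ?n \<le> t ^ ?n * ?v / \<epsilon> ^ ?n" using upp \<epsilon> by (intro divide_right_mono) auto
      also have "\<dots> = (t / \<epsilon>) ^ ?n * ?v" by (simp add: power_divide)
      also have "\<dots> \<le> (1 / c) ^ ?n * ?v" using t v by (intro mult_right_mono power_mono) auto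
      finally show ?thesis .
    qed
    have bern: "1 - c ^ m \<le> m * \<epsilon>" for m :: nat
    proof -
      have "1 + real m * (c - 1) \<le> (1 + (c - 1)) ^ m"
        using c by (intro Bernoulli_inequality) auto
      moreover have "1 - c \<le> \<epsilon>"
        using \<epsilon> True mult_left_le[of \<epsilon> \<epsilon>] by (simp add: c_def power2_eq_square)
      then have "real m * (1 - c) \<le> real m * \<epsilon>" by (intro mult_left_mono) auto
      ultimately show ?thesis by (simp add: algebra_simps)
    qed
    have "1 - c ^ DIM('a) \<le> DIM('a) * 2 ^ DIM('a) * \<epsilon>"
    proof -
      have "DIM('a) * \<epsilon> * 1 \<le> DIM('a) * \<epsilon> * 2 ^ DIM('a)" using \<epsilon> by (intro mult_left_mono) auto
      then show ?thesis using bern[of "DIM('a)"] by (simp add: mult_ac)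
    qed
    then have "?v * (1 - c ^ DIM('a)) \<le> ?v * (DIM('a) * 2 ^ DIM('a) * \<epsilon>)"
      using v by (intro mult_left_mono) auto
    then have A: "?v - cap_area \<epsilon> \<omega> / \<epsilon> ^ ?n \<le> ?v * (DIM('a) * 2 ^ DIM('a)) * \<epsilon>"
      using low' by (simp add: algebra_simps)
    have "(1 / c) ^ ?n - 1 \<le> DIM('a) * 2 ^ DIM('a) * \<epsilon>"
    proof -
      have "(1 / c) ^ ?n - 1 = (1 / c) ^ ?n * (1 - c ^ ?n)"
        using c by (simp add: algebra_simps flip: power_mult_distrib)
      also have "\<dots> \<le> 2 ^ ?n * (?n * \<epsilon>)"
        using c bern[of ?n] by (intro mult_mono power_mono) (auto simp: field_simps power_le_one)
      also have "\<dots> \<le> 2 ^ DIM('a) * (DIM('a) * \<epsilon>)"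
        using \<epsilon> by (intro mult_mono power_increasing) auto
      finally show ?thesis by (simp add: mult_ac)
    qed
    then have "?v * ((1 / c) ^ ?n - 1) \<le> ?v * (DIM('a) * 2 ^ DIM('a) * \<epsilon>)"
      using v by (intro mult_left_mono) auto
    then have B: "cap_area \<epsilon> \<omega> / \<epsilon> ^ ?n - ?v \<le> ?v * (DIM('a) * 2 ^ DIM('a)) * \<epsilon>"
      using upp' by (simp add: algebra_simps)
    have "\<bar>cap_area \<epsilon> \<omega> / \<epsilon> ^ ?n - ?v\<bar> \<le> ?v * (DIM('a) * 2 ^ DIM('a)) * \<epsilon>"
      using A B by (intro abs_leI) (simp_all only: minus_diff_eq)
    also have "\<dots> \<le> K * \<epsilon>" unfolding K_def using S0 \<epsilon> by (intro mult_right_mono) auto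
    finally show ?thesis using True by (simp add: min_def)
  next
    case False
    have "cap_area \<epsilon> \<omega> \<le> S" unfolding cap_area_def S_def by (rule bounded_measure)
    moreover have "1 \<le> \<epsilon> ^ ?n" using False by (intro one_le_power) auto
    ultimately have "cap_area \<epsilon> \<omega> / \<epsilon> ^ ?n \<le> S / 1"
      using S0 by (intro frac_le) auto
    then have "cap_area \<epsilon> \<omega> / \<epsilon> ^ ?n \<le> S" by simp
    moreover have "0 \<le> cap_area \<epsilon> \<omega> / \<epsilon> ^ ?n" using False by (simp add: cap_area_def)
    moreover have "?v * 1 \<le> ?v * (DIM('a) * 2 ^ DIM('a))"
    proof (rule mult_left_mono)
      have "1 * 1 \<le> real DIM('a) * 2 ^ DIM('a)" by (intro mult_mono) (auto simp: Suc_leI)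
      then show "1 \<le> real (DIM('a) * 2 ^ DIM('a))" by simp
    qed (use v in simp)
    ultimately have "\<bar>cap_area \<epsilon> \<omega> / \<epsilon> ^ ?n - ?v\<bar> \<le> K"
      using v S0 unfolding K_def by (intro abs_leI) linarith+
    then show ?thesis using False by (simp add: min_def)
  qed
  with K0 show ?thesis by blast
qed

section \<open>The energy of a Frostman measure\<close>

text \<open>
  Frostman measures moved to the Borel sets of the whole space, with explicit constants.  All
  estimates below are uniform over the measures satisfying these axioms for fixed \<open>s\<close>, \<open>C\<close> and \<open>L\<close>,
  which is what makes them uniform over rotations.  The ball has radius \<open>L/2\<close> so that differences of
  points in it have length less than \<open>L\<close>.
\<close>

locale frostman = prob_space \<mu> for \<mu> :: "'a::euclidean_space measure" +
  fixes s C L :: real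
  assumes sets_\<mu> [measurable_cong]: "sets \<mu> = sets borel"
    and C_pos: "0 < C" and L_pos: "0 < L"
    and concentrated: "measure \<mu> (ball 0 (L / 2)) = 1"
    and growth: "0 < r \<Longrightarrow> measure \<mu> (ball x r) \<le> C * r powr s"

text \<open>
  The squared modulus of the Fourier transform of \<open>\<mu>\<close>, that is, the Fourier transform of the
  distribution of \<open>x - y\<close>.  That it is nonnegative is the source of all the estimates.
\<close>

definition power_spectrum :: "'a::euclidean_space measure \<Rightarrow> 'a \<Rightarrow> real" where
  "power_spectrum \<mu> \<xi> = (\<integral>x. cos (\<xi> \<bullet> x) \<partial>\<mu>)\<^sup>2 + (\<integral>x. sin (\<xi> \<bullet> x) \<partial>\<mu>)\<^sup>2"

text \<open>
  The density with respect to surface measure of the direction of \<open>x - y\<close>, after convolving the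
  distribution of \<open>x - y\<close> with a Gaussian at scale \<open>\<rho>\<close> and applying the cutoff to the distance from
  the origin, written on the Fourier side.  The physical form is \<open>mollified_density_eq\<close>.
\<close>

definition mollified_density :: "'a::euclidean_space measure \<Rightarrow> real \<Rightarrow> real \<Rightarrow> 'a \<Rightarrow> real" where
  "mollified_density \<mu> L \<rho> \<omega> = (\<integral>\<xi>. power_spectrum \<mu> \<xi> * gauss \<rho> \<xi> *
     radial_cos L (DIM('a) - 1) 0 (\<xi> \<bullet> \<omega>) \<partial>lborel) / (2 * pi) ^ DIM('a)"

text \<open>
  A common bound for the two errors at scale \<open>\<rho>\<close>: the oscillation of the mollified density over
  caps of radius \<open>\<rho>\<close>, and its change when \<open>\<rho>\<close> is halved.  Each produces a factor \<open>\<rho>|\<xi>|\<close>; the Gaussian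
  is widened from \<open>\<rho>\<close> to \<open>\<rho>/4\<close> so that it absorbs further powers of \<open>\<rho>|\<xi>|\<close>.
\<close>

definition oscillation_majorant :: "'a::euclidean_space measure \<Rightarrow> real \<Rightarrow> 'a \<Rightarrow> ennreal" where
  "oscillation_majorant \<mu> \<rho> \<omega> =
     (\<integral>\<^sup>+\<xi>. ennreal (power_spectrum \<mu> \<xi> * (\<rho> * norm \<xi>) * gauss (\<rho> / 4) \<xi> / (1 + (\<xi> \<bullet> \<omega>)\<^sup>2)) \<partial>lborel)"

lemma power_spectrum_nonneg: "0 \<le> power_spectrum \<mu> \<xi>"
  by (simp add: power_spectrum_def)

lemma power_le_fact_mult_exp:
  fixes x :: real
  assumes "x \<ge> 0"
  shows "x ^ m \<le> fact m * exp x"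
proof -
  have "(\<Sum>n\<in>{m}. inverse (fact n) * x ^ n) \<le> (\<Sum>n. inverse (fact n) * x ^ n)"
    using assms by (intro sum_le_suminf) (auto simp: summable_exp)
  then have "inverse (fact m) * x ^ m \<le> exp x"
    by (simp add: exp_def scaleR_conv_of_real divide_inverse mult.commute)
  then show ?thesis by (simp add: field_simps)
qed

context frostman
begin

lemma space_\<mu> [simp]: "space \<mu> = UNIV"
  using sets_eq_imp_space_eq[OF sets_\<mu>] by simp

lemma prob_space_pair: "prob_space (\<mu> \<Otimes>\<^sub>M \<mu>)"
proof -
  interpret pair_prob_space \<mu> \<mu> ..
  show ?thesis by (rule P.prob_space_axioms)
qed

lemma power_spectrum_measurable [measurable]: "power_spectrum \<mu> \<in> borel_measurable borel"
  unfolding power_spectrum_def by measurable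

text \<open>
  Expanding the cosine leaves the square of the cosine transform plus that of the sine transform;
  the terms with \<open>sin \<theta>\<close> cancel because the distribution of \<open>x - y\<close> is symmetric.
\<close>

lemma power_spectrum_phase:
  "power_spectrum \<mu> \<xi> * cos \<theta> = (\<integral>p. cos (\<xi> \<bullet> (fst p - snd p) - \<theta>) \<partial>(\<mu> \<Otimes>\<^sub>M \<mu>))"
proof -
  have ic: "integrable \<mu> (\<lambda>x. cos (\<xi> \<bullet> x))" and isn: "integrable \<mu> (\<lambda>x. sin (\<xi> \<bullet> x))"
    by (auto intro!: integrable_const_bound[of _ 1])
  interpret pair_prob_space \<mu> \<mu> ..
  define a where "a = (\<integral>x. cos (\<xi> \<bullet> x) \<partial>\<mu>)"
  define b where "b = (\<integral>x. sin (\<xi> \<bullet> x) \<partial>\<mu>)"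
  have eq: "cos (\<xi> \<bullet> (x - y) - \<theta>) = cos (\<xi> \<bullet> y) * (cos (\<xi> \<bullet> x) * cos \<theta> + sin (\<xi> \<bullet> x) * sin \<theta>)
      + sin (\<xi> \<bullet> y) * (sin (\<xi> \<bullet> x) * cos \<theta> - cos (\<xi> \<bullet> x) * sin \<theta>)" for x y
    by (simp only: inner_diff_right cos_diff sin_diff) (simp add: algebra_simps)
  have inner: "(\<integral>y. cos (\<xi> \<bullet> (x - y) - \<theta>) \<partial>\<mu>) =
      a * (cos (\<xi> \<bullet> x) * cos \<theta> + sin (\<xi> \<bullet> x) * sin \<theta>) + b * (sin (\<xi> \<bullet> x) * cos \<theta> - cos (\<xi> \<bullet> x) * sin \<theta>)" for x
    unfolding eq a_def b_def using ic isn by simp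
  have "(\<integral>p. cos (\<xi> \<bullet> (fst p - snd p) - \<theta>) \<partial>(\<mu> \<Otimes>\<^sub>M \<mu>)) = (\<integral>x. (\<integral>y. cos (\<xi> \<bullet> (x - y) - \<theta>) \<partial>\<mu>) \<partial>\<mu>)"
    using integral_fst'[of "\<lambda>p. cos (\<xi> \<bullet> (fst p - snd p) - \<theta>)"]
    by (simp add: P.integrable_const_bound[of _ 1])
  also have "\<dots> = a * (a * cos \<theta> + b * sin \<theta>) + b * (b * cos \<theta> - a * sin \<theta>)"
    unfolding inner using ic isn by (simp add: a_def b_def)
  also have "\<dots> = power_spectrum \<mu> \<xi> * cos \<theta>"
    by (simp add: power_spectrum_def a_def[symmetric] b_def[symmetric] algebra_simps power2_eq_square)
  finally show ?thesis by simp
qed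

lemma power_spectrum_le_1: "power_spectrum \<mu> \<xi> \<le> 1"
proof -
  interpret P: prob_space "\<mu> \<Otimes>\<^sub>M \<mu>" by (rule prob_space_pair)
  have "power_spectrum \<mu> \<xi> * cos 0 \<le> (\<integral>p. 1 \<partial>(\<mu> \<Otimes>\<^sub>M \<mu>))"
    unfolding power_spectrum_phase by (intro integral_mono P.integrable_const_bound[of _ 1]) auto
  then show ?thesis using P.prob_space by simp
qed

lemma power_spectrum_gauss_integrable:
  assumes "\<rho> > 0"
  shows "integrable lborel (\<lambda>\<xi>. power_spectrum \<mu> \<xi> * gauss \<rho> \<xi>)"
  by (rule Bochner_Integration.integrable_bound[OF integrable_gauss[OF assms]])
    (auto simp: abs_mult power_spectrum_nonneg power_spectrum_le_1 gauss_nonneg mult_left_le_one_le)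

text \<open>
  The Fourier transform of a Gaussian turns spectral energy below frequency \<open>1/\<rho>\<close> into the mass of
  pairs at distance at most about \<open>\<rho>\<close>.  This is the only place where frequency and position are exchanged
  in the energy estimate, and it needs no inversion formula.
\<close>

lemma power_spectrum_gauss_integral:
  assumes "\<rho> > 0"
  shows "(\<integral>\<xi>. power_spectrum \<mu> \<xi> * gauss \<rho> \<xi> \<partial>lborel) =
    (sqrt (2 * pi) / \<rho>) ^ DIM('a) * (\<integral>p. gauss (1 / \<rho>) (fst p - snd p) \<partial>(\<mu> \<Otimes>\<^sub>M \<mu>))"
proof -
  interpret P: prob_space "\<mu> \<Otimes>\<^sub>M \<mu>" by (rule prob_space_pair)
  have "(\<integral>\<xi>. power_spectrum \<mu> \<xi> * gauss \<rho> \<xi> \<partial>lborel) =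
     (\<integral>\<xi>. (\<integral>p. gauss \<rho> \<xi> * cos (\<xi> \<bullet> (fst p - snd p)) \<partial>(\<mu> \<Otimes>\<^sub>M \<mu>)) \<partial>lborel)"
    using power_spectrum_phase[of _ 0] by (simp add: mult.commute)
  also have "\<dots> = (\<integral>p. (\<integral>\<xi>. gauss \<rho> \<xi> * cos (\<xi> \<bullet> (fst p - snd p)) \<partial>lborel) \<partial>(\<mu> \<Otimes>\<^sub>M \<mu>))"
    by (rule Fubini_integral_dominated[OF sigma_finite_lborel P.finite_measure_axioms _ integrable_gauss[OF assms]])
      (auto simp: abs_mult gauss_nonneg mult_left_le)
  also have "\<dots> = (sqrt (2 * pi) / \<rho>) ^ DIM('a) * (\<integral>p. gauss (1 / \<rho>) (fst p - snd p) \<partial>(\<mu> \<Otimes>\<^sub>M \<mu>))"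
    by (simp add: fourier_gauss[OF assms])
  finally show ?thesis .
qed

end

lemma summable_gaussian_powr: "summable (\<lambda>n. exp (- ((real n)\<^sup>2 / 2)) * (real n + 1) powr s)"
proof (rule summable_comparison_test')
  let ?m = "nat \<lceil>s\<rceil>"
  have "norm (exp (- 1 :: real)) < 1" by simp
  from summable_mult[OF summable_geometric[OF this], of "fact ?m * exp 3"]
  show "summable (\<lambda>n. fact ?m * exp 3 * exp (- 1 :: real) ^ n)" .
  fix n :: nat
  have "(real n + 1) powr s \<le> (real n + 1) powr ?m"
    by (intro powr_mono) linarith+
  also have "\<dots> = (real n + 1) ^ ?m" by (simp add: powr_realpow add_pos_nonneg)
  also have "\<dots> \<le> fact ?m * exp (real n + 1)" by (intro power_le_fact_mult_exp) simp
  finally have "exp (- ((real n)\<^sup>2 / 2)) * (real n + 1) powr s \<le>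
      exp (- ((real n)\<^sup>2 / 2)) * (fact ?m * exp (real n + 1))"
    by (intro mult_left_mono) auto
  also have "\<dots> = fact ?m * exp (- ((real n)\<^sup>2 / 2) + (real n + 1))"
    by (simp add: exp_add[symmetric] mult.left_commute)
  also have "\<dots> \<le> fact ?m * exp (3 - real n)"
  proof (intro mult_left_mono)
    \<comment> \<open>Completing the square leaves a convergent geometric series.\<close>
    have "0 \<le> (real n - 2)\<^sup>2" by simp
    then have "- ((real n)\<^sup>2 / 2) + (real n + 1) \<le> 3 - real n"
      by (simp add: power2_eq_square algebra_simps)
    then show "exp (- ((real n)\<^sup>2 / 2) + (real n + 1)) \<le> exp (3 - real n)" by simp
  qed simp
  also have "\<dots> = fact ?m * exp 3 * exp (- 1) ^ n"
    using exp_of_nat_mult[of n "- 1 :: real"] by (simp add: exp_diff exp_minus divide_inverse)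
  finally show "norm (exp (- ((real n)\<^sup>2 / 2)) * (real n + 1) powr s) \<le> fact ?m * exp 3 * exp (- 1) ^ n"
    by simp
qed

text \<open>
  Summing the ball condition over the annuli \<open>n\<rho> \<le> |x - y| < (n + 1)\<rho>\<close> around each point \<open>y\<close>.
\<close>

lemma gauss_energy_bound:
  "\<exists>K\<ge>0. \<forall>\<mu>::'a::euclidean_space measure. frostman \<mu> s C L \<longrightarrow> (\<forall>\<rho>>0.
    (\<integral>p. gauss (1 / \<rho>) (fst p - snd p) \<partial>(\<mu> \<Otimes>\<^sub>M \<mu>)) \<le> K * \<rho> powr s)"
proof -
  let ?g = "\<lambda>n. exp (- ((real n)\<^sup>2 / 2)) * (real n + 1) powr s"
  define K where "K = \<bar>C\<bar> * (\<Sum>n. ?g n)"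
  have K0: "K \<ge> 0"
    unfolding K_def by (intro mult_nonneg_nonneg suminf_nonneg summable_gaussian_powr) auto
  have "(\<integral>p. gauss (1 / \<rho>) (fst p - snd p) \<partial>(\<mu> \<Otimes>\<^sub>M \<mu>)) \<le> K * \<rho> powr s"
    if "frostman \<mu> s C L" and \<rho>: "\<rho> > 0" for \<mu> :: "'a measure" and \<rho>
  proof -
    interpret frostman \<mu> s C L by fact
    note em = emeasure_eq_measure and sp = emeasure_space_1[simplified]
    interpret pair_prob_space \<mu> \<mu> ..
    have one: "(\<integral>\<^sup>+x. ennreal (gauss (1 / \<rho>) (x - y)) \<partial>\<mu>) \<le> ennreal (K * \<rho> powr s)" for y
    proof -
      have "ennreal (gauss (1 / \<rho>) (x - y)) \<le>
          (\<Sum>n. ennreal (exp (- ((real n)\<^sup>2 / 2))) * indicator (ball y ((real n + 1) * \<rho>)) x)" for x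
      proof -
        define u where "u = norm (x - y) / \<rho>"
        define n where "n = nat \<lfloor>u\<rfloor>"
        have u: "u \<ge> 0" using \<rho> by (simp add: u_def)
        then have n: "real n \<le> u" "u < real n + 1" unfolding n_def by linarith+
        have "gauss (1 / \<rho>) (x - y) = exp (- (u\<^sup>2 / 2))" by (simp add: gauss_def u_def)
        also have "\<dots> \<le> exp (- ((real n)\<^sup>2 / 2))"
          using n by (simp add: power_mono)
        finally have "ennreal (gauss (1 / \<rho>) (x - y)) \<le> ennreal (exp (- ((real n)\<^sup>2 / 2)))"
          by (rule ennreal_leI)
        also have "x \<in> ball y ((real n + 1) * \<rho>)"
          using n(2) \<rho> by (simp add: u_def dist_norm norm_minus_commute pos_divide_less_eq)
        then have "ennreal (exp (- ((real n)\<^sup>2 / 2))) =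
            (\<Sum>k\<in>{n}. ennreal (exp (- ((real k)\<^sup>2 / 2))) * indicator (ball y ((real k + 1) * \<rho>)) x)"
          by simp
        also have "\<dots> \<le> (\<Sum>n. ennreal (exp (- ((real n)\<^sup>2 / 2))) * indicator (ball y ((real n + 1) * \<rho>)) x)"
          by (rule sum_le_suminf) auto
        finally show ?thesis .
      qed
      then have "(\<integral>\<^sup>+x. ennreal (gauss (1 / \<rho>) (x - y)) \<partial>\<mu>) \<le>
        (\<integral>\<^sup>+x. (\<Sum>n. ennreal (exp (- ((real n)\<^sup>2 / 2))) * indicator (ball y ((real n + 1) * \<rho>)) x) \<partial>\<mu>)"
        by (rule nn_integral_mono)
      also have "\<dots> = (\<Sum>n. \<integral>\<^sup>+x. ennreal (exp (- ((real n)\<^sup>2 / 2))) * indicator (ball y ((real n + 1) * \<rho>)) x \<partial>\<mu>)"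
        by (rule nn_integral_suminf) measurable
      also have "\<dots> = (\<Sum>n. ennreal (exp (- ((real n)\<^sup>2 / 2))) * emeasure \<mu> (ball y ((real n + 1) * \<rho>)))"
        by (simp add: nn_integral_cmult_indicator sets_\<mu>)
      also have "\<dots> \<le> (\<Sum>n. ennreal (C * \<rho> powr s * ?g n))"
      proof (rule suminf_le)
        fix n
        have "measure \<mu> (ball y ((real n + 1) * \<rho>)) \<le> C * ((real n + 1) * \<rho>) powr s"
          using \<rho> by (intro growth) (simp add: add_nonneg_pos)
        then have "exp (- ((real n)\<^sup>2 / 2)) * measure \<mu> (ball y ((real n + 1) * \<rho>)) \<le>
            exp (- ((real n)\<^sup>2 / 2)) * (C * ((real n + 1) * \<rho>) powr s)"
          by (intro mult_left_mono) auto
        also have "\<dots> = C * \<rho> powr s * ?g n" using \<rho> by (simp add: powr_mult mult_ac)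
        finally have "exp (- ((real n)\<^sup>2 / 2)) * measure \<mu> (ball y ((real n + 1) * \<rho>)) \<le> C * \<rho> powr s * ?g n" .
        then show "ennreal (exp (- ((real n)\<^sup>2 / 2))) * emeasure \<mu> (ball y ((real n + 1) * \<rho>)) \<le> ennreal (C * \<rho> powr s * ?g n)"
          by (simp add: em ennreal_mult'[symmetric] ennreal_leI)
      qed auto
      also have "\<dots> = ennreal (\<Sum>n. C * \<rho> powr s * ?g n)"
        using C_pos by (intro suminf_ennreal2 summable_mult summable_gaussian_powr) auto
      also have "(\<Sum>n. C * \<rho> powr s * ?g n) = K * \<rho> powr s"
        using C_pos by (subst suminf_mult[OF summable_gaussian_powr]) (simp add: K_def)
      finally show ?thesis .
    qed
    have "ennreal (\<integral>p. gauss (1 / \<rho>) (fst p - snd p) \<partial>(\<mu> \<Otimes>\<^sub>M \<mu>)) =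
        (\<integral>\<^sup>+p. ennreal (gauss (1 / \<rho>) (fst p - snd p)) \<partial>(\<mu> \<Otimes>\<^sub>M \<mu>))"
      by (rule nn_integral_eq_integral[symmetric])
        (auto simp: gauss_nonneg gauss_le_1 intro!: P.integrable_const_bound[of _ 1])
    also have "\<dots> = (\<integral>\<^sup>+y. (\<integral>\<^sup>+x. ennreal (gauss (1 / \<rho>) (x - y)) \<partial>\<mu>) \<partial>\<mu>)"
      by (subst nn_integral_snd[symmetric]) (simp_all add: split_beta)
    also have "\<dots> \<le> (\<integral>\<^sup>+y. ennreal (K * \<rho> powr s) \<partial>\<mu>)"
      by (intro nn_integral_mono one)
    also have "\<dots> = ennreal (K * \<rho> powr s)" by (simp add: sp)
    finally show ?thesis using K0 by (simp add: ennreal_le_iff)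
  qed
  with K0 show ?thesis by blast
qed

lemma spectral_energy_bound:
  "\<exists>K\<ge>0. \<forall>\<mu>::'a::euclidean_space measure. frostman \<mu> s C L \<longrightarrow> (\<forall>\<rho>>0.
    (\<integral>\<xi>. power_spectrum \<mu> \<xi> * gauss \<rho> \<xi> \<partial>lborel) \<le> K * \<rho> powr (s - DIM('a)))"
proof -
  obtain K where K: "K \<ge> 0" "\<And>\<mu>::'a measure. \<And>\<rho>. frostman \<mu> s C L \<Longrightarrow> \<rho> > 0 \<Longrightarrow>
      (\<integral>p. gauss (1 / \<rho>) (fst p - snd p) \<partial>(\<mu> \<Otimes>\<^sub>M \<mu>)) \<le> K * \<rho> powr s"
    using gauss_energy_bound[where 'a='a, of s C L] by blast
  have "(\<integral>\<xi>. power_spectrum \<mu> \<xi> * gauss \<rho> \<xi> \<partial>lborel) \<le> (sqrt (2 * pi) ^ DIM('a) * K) * \<rho> powr (s - DIM('a))"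
    if "frostman \<mu> s C L" and \<rho>: "\<rho> > 0" for \<mu> :: "'a measure" and \<rho>
  proof -
    interpret frostman \<mu> s C L by fact
    have "(\<integral>\<xi>. power_spectrum \<mu> \<xi> * gauss \<rho> \<xi> \<partial>lborel) \<le> (sqrt (2 * pi) / \<rho>) ^ DIM('a) * (K * \<rho> powr s)"
      unfolding power_spectrum_gauss_integral[OF \<rho>] using \<rho> K(2)[OF that] by (intro mult_left_mono) auto
    also have "\<dots> = (sqrt (2 * pi) ^ DIM('a) * K) * \<rho> powr (s - DIM('a))"
      using \<rho> by (simp add: power_divide powr_diff powr_realpow)
    finally show ?thesis .
  qed
  then show ?thesis using K(1) by (intro exI[of _ "sqrt (2 * pi) ^ DIM('a) * K"]) auto
qed

text \<open>
  The spectral energy increases as \<open>\<rho>\<close> decreases, whereas for \<open>s > d\<close> its bound \<open>\<rho>\<^sup>s\<^sup>-\<^sup>d\<close> would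
  tend to zero.
\<close>

lemma (in frostman) exponent_le_DIM: "s \<le> DIM('a)"
proof (rule ccontr)
  assume "\<not> s \<le> DIM('a)"
  then have s: "s - DIM('a) > 0" by simp
  obtain K where K: "K \<ge> 0" "\<And>\<rho>. \<rho> > 0 \<Longrightarrow>
    (\<integral>\<xi>. power_spectrum \<mu> \<xi> * gauss \<rho> \<xi> \<partial>lborel) \<le> K * \<rho> powr (s - DIM('a))"
    using spectral_energy_bound[where 'a='a, of s C L] frostman_axioms by blast
  interpret P: prob_space "\<mu> \<Otimes>\<^sub>M \<mu>" by (rule prob_space_pair)
  let ?I = "\<lambda>\<rho>. \<integral>\<xi>. power_spectrum \<mu> \<xi> * gauss \<rho> \<xi> \<partial>lborel"
  have mono: "?I 1 \<le> ?I \<rho>" if "0 < \<rho>" "\<rho> \<le> 1" for \<rho>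
  proof (rule integral_mono)
    fix \<xi> :: 'a
    have "(\<rho> * norm \<xi>)\<^sup>2 \<le> (1 * norm \<xi>)\<^sup>2" using that by (intro power_mono mult_right_mono) auto
    then show "power_spectrum \<mu> \<xi> * gauss 1 \<xi> \<le> power_spectrum \<mu> \<xi> * gauss \<rho> \<xi>"
      by (intro mult_left_mono) (auto simp: power_spectrum_nonneg gauss_def)
  qed (use that in \<open>auto intro: power_spectrum_gauss_integrable\<close>)
  have "((\<lambda>\<rho>. K * \<rho> powr (s - DIM('a))) \<longlongrightarrow> K * 0) (at_right 0)"
  proof (intro tendsto_intros)
    have "((\<lambda>\<rho>::real. \<rho> powr (s - DIM('a))) \<longlongrightarrow> 0 powr (s - DIM('a))) (at_right 0)"
      using s by (intro tendsto_powr2 tendsto_intros) (auto simp: eventually_at_filter)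
    then show "((\<lambda>\<rho>::real. \<rho> powr (s - DIM('a))) \<longlongrightarrow> 0) (at_right 0)" by simp
  qed
  moreover have "eventually (\<lambda>\<rho>. ?I 1 \<le> K * \<rho> powr (s - DIM('a))) (at_right 0)"
    using eventually_at_right_real[OF zero_less_one] by eventually_elim (auto intro: order_trans[OF mono K(2)])
  ultimately have "?I 1 \<le> K * 0"
    by (rule tendsto_lowerbound) simp
  then have "sqrt (2 * pi) ^ DIM('a) * (\<integral>p. gauss 1 (fst p - snd p) \<partial>(\<mu> \<Otimes>\<^sub>M \<mu>)) \<le> 0"
    using power_spectrum_gauss_integral[of 1] by simp
  moreover have "sqrt (2 * pi) ^ DIM('a) > 0" by simp
  ultimately have "(\<integral>p. gauss 1 (fst p - snd p) \<partial>(\<mu> \<Otimes>\<^sub>M \<mu>)) \<le> 0"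
    by (meson mult_pos_pos not_le)
  moreover have "(\<integral>p. gauss 1 (fst p - snd p) \<partial>(\<mu> \<Otimes>\<^sub>M \<mu>)) > 0"
  proof -
    have "integrable (\<mu> \<Otimes>\<^sub>M \<mu>) (\<lambda>p. gauss 1 (fst p - snd p))"
      by (rule P.integrable_const_bound[of _ 1]) (auto simp: gauss_nonneg gauss_le_1)
    then show ?thesis
      using P.integral_less_AE_space[of "\<lambda>_. 0" "\<lambda>p. gauss 1 (fst p - snd p)"]
      by (simp add: gauss_pos P.emeasure_space_1)
  qed
  ultimately show False by simp
qed

lemma oscillation_majorant_measurable [measurable]:
  assumes "frostman \<mu> s C L"
  shows "oscillation_majorant \<mu> \<rho> \<in> borel_measurable borel"
proof -
  interpret frostman \<mu> s C L by fact
  show ?thesis unfolding oscillation_majorant_def by measurable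
qed

text \<open>
  Averaging over \<open>\<omega>\<close> first gains the factor \<open>1/|\<xi>|\<close> of \<open>sphere_slab_integral\<close>.  It cancels the factor
  \<open>|\<xi>|\<close> of the majorant exactly, leaving \<open>\<rho>\<close> times a pure Gaussian energy of size \<open>\<rho>\<^sup>s\<^sup>-\<^sup>d\<close>.  Because nothing
  is summed over dyadic frequencies, there is no logarithmic loss in the borderline case \<open>s = d\<close>.
\<close>

lemma oscillation_majorant_integral:
  "\<exists>K\<ge>0. \<forall>\<mu>::'a::euclidean_space measure. frostman \<mu> s C L \<longrightarrow> (\<forall>\<rho>>0.
    (\<integral>\<^sup>+\<omega>. oscillation_majorant \<mu> \<rho> \<omega> \<partial>sphere_measure) \<le> ennreal (K * \<rho> powr (s - (DIM('a) - 1))))"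
proof -
  obtain K1 where K1: "K1 \<ge> 0" "\<And>\<mu>::'a measure. \<And>\<rho>. frostman \<mu> s C L \<Longrightarrow> \<rho> > 0 \<Longrightarrow>
      (\<integral>\<xi>. power_spectrum \<mu> \<xi> * gauss \<rho> \<xi> \<partial>lborel) \<le> K1 * \<rho> powr (s - DIM('a))"
    using spectral_energy_bound[where 'a='a, of s C L] by blast
  obtain K2 where K2: "K2 \<ge> 0" "\<And>\<xi>::'a. \<xi> \<noteq> 0 \<Longrightarrow>
      (\<integral>\<^sup>+\<omega>. ennreal (1 / (1 + (\<xi> \<bullet> \<omega>)\<^sup>2)) \<partial>sphere_measure) \<le> ennreal (K2 / norm \<xi>)"
    using sphere_slab_integral[where 'a='a] by blast
  interpret S: finite_measure "sphere_measure :: 'a measure" by (rule finite_measure_sphere_measure)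
  interpret LS: pair_sigma_finite "lborel :: 'a measure" "sphere_measure :: 'a measure" ..
  let ?K = "K2 * K1 * (1/4) powr (s - DIM('a))"
  have "(\<integral>\<^sup>+\<omega>. oscillation_majorant \<mu> \<rho> \<omega> \<partial>sphere_measure) \<le> ennreal (?K * \<rho> powr (s - (DIM('a) - 1)))"
    if fr: "frostman \<mu> s C L" and \<rho>: "\<rho> > 0" for \<mu> :: "'a measure" and \<rho>
  proof -
    interpret frostman \<mu> s C L by fact
    let ?w = "\<lambda>\<xi>. power_spectrum \<mu> \<xi> * (\<rho> * norm \<xi>) * gauss (\<rho> / 4) \<xi>"
    have w: "?w \<xi> \<ge> 0" for \<xi> using \<rho> by (simp add: power_spectrum_nonneg gauss_nonneg)
    have "(\<integral>\<^sup>+\<omega>. oscillation_majorant \<mu> \<rho> \<omega> \<partial>sphere_measure) =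
      (\<integral>\<^sup>+\<omega>. (\<integral>\<^sup>+\<xi>. ennreal (?w \<xi>) * ennreal (1 / (1 + (\<xi> \<bullet> \<omega>)\<^sup>2)) \<partial>lborel) \<partial>sphere_measure)"
      unfolding oscillation_majorant_def using w by (simp add: ennreal_mult'[symmetric])
    also have "\<dots> = (\<integral>\<^sup>+\<xi>. (\<integral>\<^sup>+\<omega>. ennreal (?w \<xi>) * ennreal (1 / (1 + (\<xi> \<bullet> \<omega>)\<^sup>2)) \<partial>sphere_measure) \<partial>lborel)"
      by (intro LS.Fubini' borel_measurable_pair_sphere_measure) measurable
    also have "\<dots> = (\<integral>\<^sup>+\<xi>. ennreal (?w \<xi>) * (\<integral>\<^sup>+\<omega>. ennreal (1 / (1 + (\<xi> \<bullet> \<omega>)\<^sup>2)) \<partial>sphere_measure) \<partial>lborel)"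
      by (intro nn_integral_cong nn_integral_cmult) measurable
    also have "\<dots> \<le> (\<integral>\<^sup>+\<xi>. ennreal (K2 * \<rho> * (power_spectrum \<mu> \<xi> * gauss (\<rho> / 4) \<xi>)) \<partial>lborel)"
    proof (rule nn_integral_mono)
      fix \<xi> :: 'a
      show "ennreal (?w \<xi>) * (\<integral>\<^sup>+\<omega>. ennreal (1 / (1 + (\<xi> \<bullet> \<omega>)\<^sup>2)) \<partial>sphere_measure) \<le>
          ennreal (K2 * \<rho> * (power_spectrum \<mu> \<xi> * gauss (\<rho> / 4) \<xi>))"
      proof (cases "\<xi> = 0")
        case False
        have "ennreal (?w \<xi>) * (\<integral>\<^sup>+\<omega>. ennreal (1 / (1 + (\<xi> \<bullet> \<omega>)\<^sup>2)) \<partial>sphere_measure) \<le> ennreal (?w \<xi>) * ennreal (K2 / norm \<xi>)"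
          using K2(2)[OF False] by (rule mult_left_mono) simp
        also have "\<dots> = ennreal (?w \<xi> * (K2 / norm \<xi>))"
          using w by (simp add: ennreal_mult'[symmetric])
        also have "?w \<xi> * (K2 / norm \<xi>) = K2 * \<rho> * (power_spectrum \<mu> \<xi> * gauss (\<rho> / 4) \<xi>)"
          using False by (simp add: field_simps)
        finally show ?thesis .
      qed simp
    qed
    also have "\<dots> = ennreal (\<integral>\<xi>. K2 * \<rho> * (power_spectrum \<mu> \<xi> * gauss (\<rho> / 4) \<xi>) \<partial>lborel)"
      using \<rho> K2(1) by (intro nn_integral_eq_integral integrable_mult_right power_spectrum_gauss_integrable)
        (auto simp: power_spectrum_nonneg gauss_nonneg)
    also have "\<dots> \<le> ennreal (K2 * \<rho> * (K1 * (\<rho> / 4) powr (s - DIM('a))))"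
      using K1(2)[OF fr, of "\<rho> / 4"] \<rho> K2(1) by (intro ennreal_leI) (simp add: mult_left_mono)
    also have "K2 * \<rho> * (K1 * (\<rho> / 4) powr (s - DIM('a))) = ?K * (\<rho> powr 1 * \<rho> powr (s - DIM('a)))"
      using \<rho> powr_mult[of \<rho> "1/4" "s - DIM('a)"] by simp
    also have "\<rho> powr 1 * \<rho> powr (s - DIM('a)) = \<rho> powr (s - (DIM('a) - 1))"
      unfolding powr_add[symmetric] by (simp add: algebra_simps of_nat_diff Suc_leI)
    finally show ?thesis .
  qed
  moreover have "?K \<ge> 0" using K1(1) K2(1) by simp
  ultimately show ?thesis by blast
qed

section \<open>Mollified direction densities\<close>

lemma radial_cos_bounded:
  assumes "n \<ge> 1" "L > 0"
  shows "\<exists>K\<ge>0. \<forall>\<theta> \<tau>. \<bar>radial_cos L n \<theta> \<tau>\<bar> \<le> K"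
proof -
  obtain K where K: "K \<ge> 0" "\<And>\<theta> \<tau>. \<bar>radial_cos L n \<theta> \<tau>\<bar> \<le> K / (1 + \<tau>\<^sup>2)"
    using radial_cos_decay[OF assms] by blast
  have "\<bar>radial_cos L n \<theta> \<tau>\<bar> \<le> K" for \<theta> \<tau>
  proof -
    have "K / (1 + \<tau>\<^sup>2) \<le> K / 1" using K(1) by (intro divide_left_mono) (auto simp: add_pos_nonneg)
    then show ?thesis using K(2)[of \<theta> \<tau>] by simp
  qed
  with K(1) show ?thesis by blast
qed

lemma radial_cos_measurable [measurable]: "radial_cos L n \<theta> \<in> borel_measurable borel"
  by (intro borel_measurable_continuous_onI DERIV_continuous_on)
    (rule has_field_derivative_at_within, rule radial_cos_derivative)

lemma (in frostman) mollified_density_integrable: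
  assumes d: "DIM('a) \<ge> 2" and \<rho>: "\<rho> > 0"
  shows "integrable lborel (\<lambda>\<xi>. power_spectrum \<mu> \<xi> * gauss \<rho> \<xi> * radial_cos L (DIM('a) - 1) 0 (\<xi> \<bullet> \<omega>))"
proof -
  have d1: "1 \<le> DIM('a) - 1" using d by linarith
  obtain K where K: "K \<ge> 0" "\<And>\<theta> \<tau>. \<bar>radial_cos L (DIM('a) - 1) \<theta> \<tau>\<bar> \<le> K"
    using radial_cos_bounded[OF d1 L_pos] by blast
  show ?thesis
  proof (rule Bochner_Integration.integrable_bound[OF integrable_mult_left[OF power_spectrum_gauss_integrable[OF \<rho>], of K]])
    show "AE \<xi> in lborel. norm (power_spectrum \<mu> \<xi> * gauss \<rho> \<xi> * radial_cos L (DIM('a) - 1) 0 (\<xi> \<bullet> \<omega>))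
        \<le> norm (power_spectrum \<mu> \<xi> * gauss \<rho> \<xi> * K)"
      using K by (intro AE_I2) (simp add: abs_mult power_spectrum_nonneg gauss_nonneg mult_left_mono)
  qed measurable
qed

lemma ennreal_integral_le_majorant:
  fixes f :: "'a::euclidean_space \<Rightarrow> real"
  assumes f: "integrable lborel f"
    and le: "\<And>\<xi>. \<bar>f \<xi>\<bar> \<le> K * (power_spectrum \<mu> \<xi> * (\<rho> * norm \<xi>) * gauss (\<rho> / 4) \<xi> / (1 + (\<xi> \<bullet> \<omega>)\<^sup>2))"
    and "K \<ge> 0" and fr: "frostman \<mu> s C L"
  shows "ennreal \<bar>(\<integral>\<xi>. f \<xi> \<partial>lborel) / (2 * pi) ^ DIM('a)\<bar> \<le> ennreal K * oscillation_majorant \<mu> \<rho> \<omega>"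
proof -
  interpret frostman \<mu> s C L by fact
  have "1 * 1 \<le> 2 * pi" using pi_ge_two by (intro mult_mono) auto
  then have "1 \<le> (2 * pi) ^ DIM('a)" by (intro one_le_power) simp
  then have "\<bar>(\<integral>\<xi>. f \<xi> \<partial>lborel) / (2 * pi) ^ DIM('a)\<bar> \<le> \<bar>\<integral>\<xi>. f \<xi> \<partial>lborel\<bar> / 1"
    unfolding abs_divide by (intro divide_left_mono) auto
  then have "ennreal \<bar>(\<integral>\<xi>. f \<xi> \<partial>lborel) / (2 * pi) ^ DIM('a)\<bar> \<le> ennreal (norm (\<integral>\<xi>. f \<xi> \<partial>lborel))"
    by (intro ennreal_leI) simp
  also have "\<dots> \<le> (\<integral>\<^sup>+\<xi>. ennreal (norm (f \<xi>)) \<partial>lborel)"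
    by (rule integral_norm_bound_ennreal[OF f])
  also have "\<dots> \<le> (\<integral>\<^sup>+\<xi>. ennreal K * ennreal (power_spectrum \<mu> \<xi> * (\<rho> * norm \<xi>) * gauss (\<rho> / 4) \<xi> / (1 + (\<xi> \<bullet> \<omega>)\<^sup>2)) \<partial>lborel)"
    using le \<open>K \<ge> 0\<close> by (intro nn_integral_mono) (simp add: ennreal_mult'[symmetric] ennreal_leI)
  also have "\<dots> = ennreal K * oscillation_majorant \<mu> \<rho> \<omega>"
    unfolding oscillation_majorant_def by (rule nn_integral_cmult) measurable
  finally show ?thesis .
qed

text \<open>
  The factor \<open>1 + h\<^sup>2\<close> of \<open>radial_cos_increment\<close> is at most \<open>1 + (\<rho>|\<xi>|)\<^sup>2\<close> on a cap of radius \<open>\<rho>\<close>.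
\<close>

lemma gauss_absorbs_square: "gauss \<rho> \<xi> * (1 + (\<rho> * norm \<xi>)\<^sup>2) \<le> 3 * gauss (\<rho> / 4) (\<xi>::'a::euclidean_space)"
proof -
  let ?u = "(\<rho> * norm \<xi>)\<^sup>2"
  have g: "gauss \<rho> \<xi> = gauss (\<rho> / 4) \<xi> * exp (- (15 / 32 * ?u))"
    by (simp add: gauss_def exp_add[symmetric] power_mult_distrib power_divide algebra_simps)
  have "1 + v \<le> 3 * (1 + 15 / 32 * v)" if "0 \<le> v" for v :: real
    using that by (simp add: field_simps)
  from this[of ?u] have "1 + ?u \<le> 3 * (1 + 15 / 32 * ?u)" by simp
  also have "\<dots> \<le> 3 * exp (15 / 32 * ?u)" by (intro mult_left_mono exp_ge_add_one_self) auto
  finally have "exp (- (15 / 32 * ?u)) * (1 + ?u) \<le> exp (- (15 / 32 * ?u)) * (3 * exp (15 / 32 * ?u))"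
    by (intro mult_left_mono) auto
  also have "\<dots> = 3" by (simp add: exp_minus)
  finally have "gauss (\<rho> / 4) \<xi> * (exp (- (15 / 32 * ?u)) * (1 + ?u)) \<le> gauss (\<rho> / 4) \<xi> * 3"
    by (intro mult_left_mono gauss_nonneg)
  then show ?thesis unfolding g by (simp add: mult_ac)
qed

lemma gauss_dyadic_increment:
  assumes "\<rho> > 0"
  shows "\<bar>gauss (\<rho> / 2) \<xi> - gauss \<rho> \<xi>\<bar> \<le> \<rho> * norm \<xi> * gauss (\<rho> / 4) (\<xi>::'a::euclidean_space)"
proof -
  define u where "u = \<rho> * norm \<xi>"
  have u: "u \<ge> 0" using assms by (simp add: u_def)
  have g1: "gauss (\<rho> / 2) \<xi> = exp (- (u\<^sup>2 / 8))" and g2: "gauss \<rho> \<xi> = exp (- (u\<^sup>2 / 8)) * exp (- (3 / 8 * u\<^sup>2))"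
    and g3: "gauss (\<rho> / 4) \<xi> = exp (- (u\<^sup>2 / 32))"
    by (simp_all add: gauss_def u_def exp_add[symmetric] power_mult_distrib power_divide algebra_simps)
  have g4: "exp (- (u\<^sup>2 / 8)) = exp (- (u\<^sup>2 / 32)) * exp (- (3 / 32 * u\<^sup>2))"
    by (simp add: exp_add[symmetric])
  \<comment> \<open>One power of \<open>u\<close> is paid for by the Gaussian: \<open>3u/8 \<le> 1 + 3u\<^sup>2/32 \<le> exp(3u\<^sup>2/32)\<close>.\<close>
  have "0 \<le> (u - 2)\<^sup>2" by simp
  then have "0 \<le> u\<^sup>2 - 4 * u + 4" by (simp add: power2_eq_square algebra_simps)
  then have "3 / 8 * u \<le> 1 + 3 / 32 * u\<^sup>2" by linarith
  also have "\<dots> \<le> exp (3 / 32 * u\<^sup>2)" by (rule exp_ge_add_one_self)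
  finally have "exp (- (3 / 32 * u\<^sup>2)) * (3 / 8 * u) \<le> exp (- (3 / 32 * u\<^sup>2)) * exp (3 / 32 * u\<^sup>2)"
    by (intro mult_left_mono) auto
  also have "\<dots> = 1" by (simp add: exp_minus)
  finally have "u * exp (- (u\<^sup>2 / 32)) * (exp (- (3 / 32 * u\<^sup>2)) * (3 / 8 * u)) \<le> u * exp (- (u\<^sup>2 / 32)) * 1"
    using u by (intro mult_left_mono) auto
  then have A: "exp (- (u\<^sup>2 / 8)) * (3 / 8 * u\<^sup>2) \<le> u * exp (- (u\<^sup>2 / 32))"
    unfolding g4 by (simp add: power2_eq_square mult_ac)
  have "1 - exp (- (3 / 8 * u\<^sup>2)) \<le> 3 / 8 * u\<^sup>2"
    using exp_ge_add_one_self[of "- (3 / 8 * u\<^sup>2)"] by linarith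
  then have "exp (- (u\<^sup>2 / 8)) * (1 - exp (- (3 / 8 * u\<^sup>2))) \<le> exp (- (u\<^sup>2 / 8)) * (3 / 8 * u\<^sup>2)"
    by (intro mult_left_mono) auto
  moreover have "0 \<le> exp (- (u\<^sup>2 / 8)) * (1 - exp (- (3 / 8 * u\<^sup>2)))"
    by (intro mult_nonneg_nonneg) auto
  moreover have "gauss (\<rho> / 2) \<xi> - gauss \<rho> \<xi> = exp (- (u\<^sup>2 / 8)) * (1 - exp (- (3 / 8 * u\<^sup>2)))"
    unfolding g1 g2 by (simp add: algebra_simps)
  ultimately have "\<bar>gauss (\<rho> / 2) \<xi> - gauss \<rho> \<xi>\<bar> \<le> exp (- (u\<^sup>2 / 8)) * (3 / 8 * u\<^sup>2)"
    by (simp only: abs_of_nonneg)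
  with A show ?thesis unfolding g3 u_def[symmetric] by (rule order_trans[rotated])
qed

text \<open>
  Between two directions at distance at most \<open>\<rho>\<close>, the frequency \<open>\<xi> \<bullet> \<omega>\<close> moves by at most \<open>\<rho>|\<xi>|\<close>.
  Since \<open>power_spectrum\<close> is nonnegative, the bound for the radial transform can be integrated against
  it without losing cancellation.
\<close>

lemma mollified_density_oscillation:
  assumes d: "DIM('a::euclidean_space) \<ge> 2" and L: "L > 0"
  shows "\<exists>K\<ge>0. \<forall>\<mu>::'a measure. frostman \<mu> s C L \<longrightarrow> (\<forall>\<rho>>0. \<forall>\<omega> \<omega>'. norm (\<omega>' - \<omega>) \<le> \<rho> \<longrightarrow>
    ennreal \<bar>mollified_density \<mu> L \<rho> \<omega>' - mollified_density \<mu> L \<rho> \<omega>\<bar> \<le> ennreal K * oscillation_majorant \<mu> \<rho> \<omega>)"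
proof -
  let ?W = "radial_cos L (DIM('a) - 1) 0"
  have d1: "1 \<le> DIM('a) - 1" using d by linarith
  obtain K where K: "K \<ge> 0" "\<And>\<tau> h. \<bar>?W (\<tau> + h) - ?W \<tau>\<bar> \<le> K * (\<bar>h\<bar> * (1 + h\<^sup>2)) / (1 + \<tau>\<^sup>2)"
    using radial_cos_increment[OF d1 L] by blast
  have "ennreal \<bar>mollified_density \<mu> L \<rho> \<omega>' - mollified_density \<mu> L \<rho> \<omega>\<bar> \<le> ennreal (3 * K) * oscillation_majorant \<mu> \<rho> \<omega>"
    if fr: "frostman \<mu> s C L" and \<rho>: "\<rho> > 0" and near: "norm (\<omega>' - \<omega>) \<le> \<rho>" for \<mu> :: "'a measure" and \<rho> \<omega> \<omega>'
  proof -
    interpret frostman \<mu> s C L by fact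
    let ?f = "\<lambda>\<omega> \<xi>. power_spectrum \<mu> \<xi> * gauss \<rho> \<xi> * ?W (\<xi> \<bullet> \<omega>)"
    have i: "integrable lborel (?f \<omega>)" for \<omega> by (rule mollified_density_integrable[OF d \<rho>])
    have "\<bar>?f \<omega>' \<xi> - ?f \<omega> \<xi>\<bar> \<le> 3 * K * (power_spectrum \<mu> \<xi> * (\<rho> * norm \<xi>) * gauss (\<rho> / 4) \<xi> / (1 + (\<xi> \<bullet> \<omega>)\<^sup>2))" for \<xi>
    proof -
      define h where "h = \<xi> \<bullet> (\<omega>' - \<omega>)"
      define u where "u = \<rho> * norm \<xi>"
      have u: "u \<ge> 0" using \<rho> by (simp add: u_def)
      have "\<bar>h\<bar> \<le> norm \<xi> * norm (\<omega>' - \<omega>)" unfolding h_def by (rule Cauchy_Schwarz_ineq2)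
      also have "\<dots> \<le> norm \<xi> * \<rho>" using near by (intro mult_left_mono) auto
      finally have hu: "\<bar>h\<bar> \<le> u" by (simp add: u_def mult.commute)
      then have hu2: "h\<^sup>2 \<le> u\<^sup>2" using u by (simp add: abs_le_square_iff[symmetric])
      have "\<bar>?W (\<xi> \<bullet> \<omega>') - ?W (\<xi> \<bullet> \<omega>)\<bar> \<le> K * (\<bar>h\<bar> * (1 + h\<^sup>2)) / (1 + (\<xi> \<bullet> \<omega>)\<^sup>2)"
        using K(2)[of "\<xi> \<bullet> \<omega>" h] by (simp add: h_def inner_diff_right)
      also have "\<dots> \<le> K * (u * (1 + u\<^sup>2)) / (1 + (\<xi> \<bullet> \<omega>)\<^sup>2)"
        using hu hu2 u K(1) by (intro divide_right_mono mult_left_mono mult_mono) (auto simp: add_nonneg_nonneg)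
      finally have W: "\<bar>?W (\<xi> \<bullet> \<omega>') - ?W (\<xi> \<bullet> \<omega>)\<bar> \<le> K * (u * (1 + u\<^sup>2)) / (1 + (\<xi> \<bullet> \<omega>)\<^sup>2)" .
      have "\<bar>?f \<omega>' \<xi> - ?f \<omega> \<xi>\<bar> = power_spectrum \<mu> \<xi> * gauss \<rho> \<xi> * \<bar>?W (\<xi> \<bullet> \<omega>') - ?W (\<xi> \<bullet> \<omega>)\<bar>"
        unfolding right_diff_distrib[symmetric] by (simp add: abs_mult power_spectrum_nonneg gauss_nonneg)
      also have "\<dots> \<le> power_spectrum \<mu> \<xi> * gauss \<rho> \<xi> * (K * (u * (1 + u\<^sup>2)) / (1 + (\<xi> \<bullet> \<omega>)\<^sup>2))"
        using W by (intro mult_left_mono mult_nonneg_nonneg power_spectrum_nonneg gauss_nonneg)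
      also have "\<dots> = K * power_spectrum \<mu> \<xi> * u / (1 + (\<xi> \<bullet> \<omega>)\<^sup>2) * (gauss \<rho> \<xi> * (1 + u\<^sup>2))"
        by (simp add: mult_ac)
      also have "\<dots> \<le> K * power_spectrum \<mu> \<xi> * u / (1 + (\<xi> \<bullet> \<omega>)\<^sup>2) * (3 * gauss (\<rho> / 4) \<xi>)"
        unfolding u_def using gauss_absorbs_square K(1) u[unfolded u_def]
        by (intro mult_left_mono divide_nonneg_nonneg mult_nonneg_nonneg power_spectrum_nonneg) (use \<rho> in \<open>auto simp: add_nonneg_nonneg\<close>)
      finally show ?thesis by (simp add: u_def mult_ac)
    qed
    from ennreal_integral_le_majorant[OF Bochner_Integration.integrable_diff[OF i i] this _ fr]
    have "ennreal \<bar>(\<integral>\<xi>. ?f \<omega>' \<xi> - ?f \<omega> \<xi> \<partial>lborel) / (2 * pi) ^ DIM('a)\<bar> \<le> ennreal (3 * K) * oscillation_majorant \<mu> \<rho> \<omega>"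
      using K(1) by simp
    then show ?thesis
      unfolding mollified_density_def diff_divide_distrib[symmetric] Bochner_Integration.integral_diff[OF i i] .
  qed
  then show ?thesis using K(1) by (intro exI[of _ "3 * K"]) auto
qed

lemma mollified_density_dyadic_increment:
  assumes d: "DIM('a::euclidean_space) \<ge> 2" and L: "L > 0"
  shows "\<exists>K\<ge>0. \<forall>\<mu>::'a measure. frostman \<mu> s C L \<longrightarrow> (\<forall>\<rho>>0. \<forall>\<omega>.
    ennreal \<bar>mollified_density \<mu> L (\<rho> / 2) \<omega> - mollified_density \<mu> L \<rho> \<omega>\<bar> \<le> ennreal K * oscillation_majorant \<mu> \<rho> \<omega>)"
proof -
  let ?W = "radial_cos L (DIM('a) - 1) 0"
  have d1: "1 \<le> DIM('a) - 1" using d by linarith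
  obtain K where K: "K \<ge> 0" "\<And>\<theta> \<tau>. \<bar>radial_cos L (DIM('a) - 1) \<theta> \<tau>\<bar> \<le> K / (1 + \<tau>\<^sup>2)"
    using radial_cos_decay[OF d1 L] by blast
  have "ennreal \<bar>mollified_density \<mu> L (\<rho> / 2) \<omega> - mollified_density \<mu> L \<rho> \<omega>\<bar> \<le> ennreal K * oscillation_majorant \<mu> \<rho> \<omega>"
    if fr: "frostman \<mu> s C L" and \<rho>: "\<rho> > 0" for \<mu> :: "'a measure" and \<rho> \<omega>
  proof -
    interpret frostman \<mu> s C L by fact
    let ?f = "\<lambda>\<rho> \<xi>. power_spectrum \<mu> \<xi> * gauss \<rho> \<xi> * ?W (\<xi> \<bullet> \<omega>)"
    have i: "integrable lborel (?f \<rho>)" if "\<rho> > 0" for \<rho> by (rule mollified_density_integrable[OF d that])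
    have i1: "integrable lborel (?f (\<rho> / 2))" and i2: "integrable lborel (?f \<rho>)" using i[of "\<rho> / 2"] i[of \<rho>] \<rho> by auto
    have "\<bar>?f (\<rho> / 2) \<xi> - ?f \<rho> \<xi>\<bar> \<le> K * (power_spectrum \<mu> \<xi> * (\<rho> * norm \<xi>) * gauss (\<rho> / 4) \<xi> / (1 + (\<xi> \<bullet> \<omega>)\<^sup>2))" for \<xi>
    proof -
      have "?f (\<rho> / 2) \<xi> - ?f \<rho> \<xi> = power_spectrum \<mu> \<xi> * ((gauss (\<rho> / 2) \<xi> - gauss \<rho> \<xi>) * ?W (\<xi> \<bullet> \<omega>))"
        by (simp add: algebra_simps)
      then have "\<bar>?f (\<rho> / 2) \<xi> - ?f \<rho> \<xi>\<bar> = power_spectrum \<mu> \<xi> * (\<bar>gauss (\<rho> / 2) \<xi> - gauss \<rho> \<xi>\<bar> * \<bar>?W (\<xi> \<bullet> \<omega>)\<bar>)"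
        by (simp add: abs_mult power_spectrum_nonneg)
      also have "\<dots> \<le> power_spectrum \<mu> \<xi> * ((\<rho> * norm \<xi> * gauss (\<rho> / 4) \<xi>) * (K / (1 + (\<xi> \<bullet> \<omega>)\<^sup>2)))"
        using K \<rho> by (intro mult_left_mono mult_mono gauss_dyadic_increment power_spectrum_nonneg)
          (auto simp: gauss_nonneg)
      finally show ?thesis by (simp add: mult_ac)
    qed
    from ennreal_integral_le_majorant[OF Bochner_Integration.integrable_diff[OF i1 i2] this K(1) fr]
    show ?thesis
      unfolding mollified_density_def diff_divide_distrib[symmetric] Bochner_Integration.integral_diff[OF i1 i2] .
  qed
  then show ?thesis using K(1) by blast
qed

text \<open>
  The normal density with standard deviation \<open>\<rho>\<close> in each coordinate.
\<close>

definition heat_kernel :: "real \<Rightarrow> 'a::euclidean_space \<Rightarrow> real" where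
  "heat_kernel \<rho> x = gauss (1 / \<rho>) x / (sqrt (2 * pi) * \<rho>) ^ DIM('a)"

lemma heat_kernel_measurable [measurable]: "heat_kernel \<rho> \<in> borel_measurable borel"
  unfolding heat_kernel_def by measurable

lemma heat_kernel_nonneg: "\<rho> > 0 \<Longrightarrow> 0 \<le> heat_kernel \<rho> x"
  by (simp add: heat_kernel_def gauss_nonneg)

lemma integral_heat_kernel_1:
  "integrable lborel (heat_kernel 1 :: 'a::euclidean_space \<Rightarrow> real)"
  "(\<integral>u. heat_kernel 1 (u::'a) \<partial>lborel) = 1"
proof -
  have "(\<integral>u. gauss 1 (u::'a) \<partial>lborel) = sqrt (2 * pi) ^ DIM('a)"
    using fourier_gauss[of 1 "0::'a"] by (simp add: gauss_def)
  then show "(\<integral>u. heat_kernel 1 (u::'a) \<partial>lborel) = 1"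
    by (simp add: heat_kernel_def)
  show "integrable lborel (heat_kernel 1 :: 'a \<Rightarrow> real)"
    unfolding heat_kernel_def using integrable_gauss[of 1, where 'a='a] by simp
qed

lemma radial_cos_lebesgue:
  assumes "L > 0"
  shows "radial_cos L n \<theta> \<tau> =
    (\<integral>r. r ^ n * cutoff L r * cos (r * \<tau> + \<theta>) \<partial>restrict_space lborel {0..2*L})"
proof -
  have "set_integrable lborel {0..2*L} (\<lambda>r. r ^ n * cutoff L r * cos (r * \<tau> + \<theta>))"
    by (intro borel_integrable_atLeastAtMost' continuous_intros)
  from set_borel_integral_eq_integral(2)[OF this] show ?thesis
    unfolding radial_cos_def set_lebesgue_integral_def by (simp add: integral_restrict_space)
qed

lemma cutoff_measurable [measurable]: "cutoff L \<in> borel_measurable borel"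
  by (intro borel_measurable_continuous_onI continuous_on_cutoff)

text \<open>
  Fubini's theorem, once in \<open>r\<close> and once in the pair of points, evaluates the frequency integral as
  a Gaussian centred at \<open>x - y - r\<omega>\<close>.  In this form the density is visibly nonnegative and polar
  coordinates apply.
\<close>

lemma (in frostman) mollified_density_eq:
  assumes d: "DIM('a) \<ge> 2" and \<rho>: "\<rho> > 0"
  shows "mollified_density \<mu> L \<rho> \<omega> = (\<integral>r. r ^ (DIM('a) - 1) * cutoff L r *
    (\<integral>p. heat_kernel \<rho> (fst p - snd p - r *\<^sub>R \<omega>) \<partial>(\<mu> \<Otimes>\<^sub>M \<mu>)) \<partial>restrict_space lborel {0..2*L})"
proof -
  interpret P: prob_space "\<mu> \<Otimes>\<^sub>M \<mu>" by (rule prob_space_pair)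
  let ?n = "DIM('a) - 1" and ?R = "restrict_space lborel {0..2*L}"
  let ?w = "\<lambda>r. r ^ ?n * cutoff L r"
  interpret R: finite_measure ?R
    using L_pos by (intro finite_measureI) (simp add: emeasure_restrict_space space_restrict_space)
  have [measurable]: "(\<lambda>r. r) \<in> borel_measurable ?R"
    by (rule measurable_restrict_space1) simp
  define B where "B = (2 * L) ^ ?n"
  have w: "\<bar>?w r * a\<bar> \<le> B * c" if "\<bar>a\<bar> \<le> c" "r \<in> {0..2*L}" for r a c
  proof -
    have "0 \<le> r" "r \<le> 2 * L" using that(2) by auto
    then have "r ^ ?n \<le> B" "0 \<le> r ^ ?n"
      unfolding B_def by (rule power_mono[rotated], simp)
    then have "\<bar>?w r\<bar> \<le> B * 1"
      unfolding abs_mult using cutoff_bounds[of L r]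
      by (intro mult_mono) (simp_all only: abs_of_nonneg abs_ge_zero)
    then show ?thesis
      unfolding abs_mult[of "?w r" a] using that by (intro mult_mono) auto
  qed
  \<comment> \<open>The indicator bounds the integrand for all real \<open>r\<close>, not only on the domain of integration.\<close>
  have "mollified_density \<mu> L \<rho> \<omega> * (2 * pi) ^ DIM('a) =
     (\<integral>\<xi>. (\<integral>r. indicator {0..2*L} r * (?w r * (gauss \<rho> \<xi> * (power_spectrum \<mu> \<xi> * cos (r * (\<xi> \<bullet> \<omega>))))) \<partial>?R) \<partial>lborel)"
  proof -
    have "power_spectrum \<mu> \<xi> * gauss \<rho> \<xi> * radial_cos L ?n 0 (\<xi> \<bullet> \<omega>) =
       (\<integral>r. indicator {0..2*L} r * (?w r * (gauss \<rho> \<xi> * (power_spectrum \<mu> \<xi> * cos (r * (\<xi> \<bullet> \<omega>))))) \<partial>?R)" for \<xi>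
    proof -
      have "power_spectrum \<mu> \<xi> * gauss \<rho> \<xi> * radial_cos L ?n 0 (\<xi> \<bullet> \<omega>) =
        (\<integral>r. power_spectrum \<mu> \<xi> * gauss \<rho> \<xi> * (?w r * cos (r * (\<xi> \<bullet> \<omega>))) \<partial>?R)"
        unfolding radial_cos_lebesgue[OF L_pos] by simp
      also have "\<dots> = (\<integral>r. indicator {0..2*L} r * (?w r * (gauss \<rho> \<xi> * (power_spectrum \<mu> \<xi> * cos (r * (\<xi> \<bullet> \<omega>))))) \<partial>?R)"
        by (rule Bochner_Integration.integral_cong) (auto simp: space_restrict_space mult_ac)
      finally show ?thesis .
    qed
    then show ?thesis by (simp add: mollified_density_def)
  qed
  also have "\<dots> = (\<integral>r. (\<integral>\<xi>. indicator {0..2*L} r * (?w r * (gauss \<rho> \<xi> * (power_spectrum \<mu> \<xi> * cos (r * (\<xi> \<bullet> \<omega>))))) \<partial>lborel) \<partial>?R)"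
  proof (rule Fubini_integral_dominated[OF sigma_finite_lborel R.finite_measure_axioms _ integrable_mult_right[OF integrable_gauss[OF \<rho>], of B]])
    fix \<xi> :: 'a and r :: real
    have "\<bar>gauss \<rho> \<xi> * (power_spectrum \<mu> \<xi> * cos (r * (\<xi> \<bullet> \<omega>)))\<bar> \<le> gauss \<rho> \<xi>"
      by (auto simp: abs_mult gauss_nonneg power_spectrum_nonneg power_spectrum_le_1 intro!: mult_left_le mult_le_one)
    from w[OF this] show "\<bar>indicator {0..2*L} r * (?w r * (gauss \<rho> \<xi> * (power_spectrum \<mu> \<xi> * cos (r * (\<xi> \<bullet> \<omega>)))))\<bar> \<le> B * gauss \<rho> \<xi>"
      using L_pos by (auto simp: indicator_def B_def gauss_nonneg)
  qed measurable
  also have "\<dots> = (\<integral>r. ?w r * ((2 * pi) ^ DIM('a) * (\<integral>p. heat_kernel \<rho> (fst p - snd p - r *\<^sub>R \<omega>) \<partial>(\<mu> \<Otimes>\<^sub>M \<mu>))) \<partial>?R)"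
  proof (rule Bochner_Integration.integral_cong[OF refl])
    fix r assume "r \<in> space ?R"
    then have r: "r \<in> {0..2*L}" by (simp add: space_restrict_space)
    have "(\<integral>\<xi>. gauss \<rho> \<xi> * (power_spectrum \<mu> \<xi> * cos (r * (\<xi> \<bullet> \<omega>))) \<partial>lborel) =
      (\<integral>\<xi>. (\<integral>p. gauss \<rho> \<xi> * cos (\<xi> \<bullet> (fst p - snd p - r *\<^sub>R \<omega>)) \<partial>(\<mu> \<Otimes>\<^sub>M \<mu>)) \<partial>lborel)"
      unfolding power_spectrum_phase by (simp add: inner_diff_right)
    also have "\<dots> = (\<integral>p. (\<integral>\<xi>. gauss \<rho> \<xi> * cos (\<xi> \<bullet> (fst p - snd p - r *\<^sub>R \<omega>)) \<partial>lborel) \<partial>(\<mu> \<Otimes>\<^sub>M \<mu>))"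
      by (rule Fubini_integral_dominated[OF sigma_finite_lborel P.finite_measure_axioms _ integrable_gauss[OF \<rho>]])
        (auto simp: abs_mult gauss_nonneg mult_left_le)
    also have "\<dots> = (\<integral>p. (2 * pi) ^ DIM('a) * heat_kernel \<rho> (fst p - snd p - r *\<^sub>R \<omega>) \<partial>(\<mu> \<Otimes>\<^sub>M \<mu>))"
    proof (rule Bochner_Integration.integral_cong[OF refl])
      fix p :: "'a \<times> 'a"
      have "(sqrt (2 * pi) / \<rho>) ^ DIM('a) = (2 * pi) ^ DIM('a) / (sqrt (2 * pi) * \<rho>) ^ DIM('a)"
      proof -
        define q where "q = sqrt (2 * pi)"
        have q: "q > 0" "2 * pi = q * q" by (simp_all add: q_def)
        have "q / \<rho> = (q * q) / (q * \<rho>)" using q(1) by simp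
        then have "q / \<rho> = (2 * pi) / (q * \<rho>)" by (simp only: q(2))
        then have "(q / \<rho>) ^ DIM('a) = ((2 * pi) / (q * \<rho>)) ^ DIM('a)" by simp
        then show ?thesis unfolding q_def by (simp only: power_divide)
      qed
      then show "(\<integral>\<xi>. gauss \<rho> \<xi> * cos (\<xi> \<bullet> (fst p - snd p - r *\<^sub>R \<omega>)) \<partial>lborel) =
        (2 * pi) ^ DIM('a) * heat_kernel \<rho> (fst p - snd p - r *\<^sub>R \<omega>)"
        unfolding fourier_gauss[OF \<rho>] heat_kernel_def by simp
    qed
    finally show "(\<integral>\<xi>. indicator {0..2*L} r * (?w r * (gauss \<rho> \<xi> * (power_spectrum \<mu> \<xi> * cos (r * (\<xi> \<bullet> \<omega>))))) \<partial>lborel)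
      = ?w r * ((2 * pi) ^ DIM('a) * (\<integral>p. heat_kernel \<rho> (fst p - snd p - r *\<^sub>R \<omega>) \<partial>(\<mu> \<Otimes>\<^sub>M \<mu>)))"
      using r by simp
  qed
  also have "\<dots> = (\<integral>r. (2 * pi) ^ DIM('a) * (?w r * (\<integral>p. heat_kernel \<rho> (fst p - snd p - r *\<^sub>R \<omega>) \<partial>(\<mu> \<Otimes>\<^sub>M \<mu>))) \<partial>?R)"
    by (simp add: mult_ac)
  finally show ?thesis by simp
qed

section \<open>Weak convergence of the mollified densities\<close>

lemma heat_kernel_le:
  fixes x :: "'a::euclidean_space"
  assumes "\<rho> > 0"
  shows "heat_kernel \<rho> x \<le> 1 / (sqrt (2 * pi) * \<rho>) ^ DIM('a)"
  unfolding heat_kernel_def using assms gauss_le_1[of "1 / \<rho>" x] by (intro divide_right_mono) auto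

lemma (in frostman) mollified_density_nn_integral:
  assumes d: "DIM('a) \<ge> 2" and \<rho>: "\<rho> > 0"
  shows "0 \<le> mollified_density \<mu> L \<rho> \<omega>" (is ?nonneg)
    and "ennreal (mollified_density \<mu> L \<rho> \<omega>) =
      (\<integral>\<^sup>+p. (\<integral>\<^sup>+r. indicator {0..2*L} r * ennreal (r ^ (DIM('a) - 1) * cutoff L r *
         heat_kernel \<rho> (fst p - snd p - r *\<^sub>R \<omega>)) \<partial>lborel) \<partial>(\<mu> \<Otimes>\<^sub>M \<mu>))" (is ?eq)
proof -
  interpret P: prob_space "\<mu> \<Otimes>\<^sub>M \<mu>" by (rule prob_space_pair)
  let ?n = "DIM('a) - 1" and ?R = "restrict_space lborel {0..2*L}"
  let ?w = "\<lambda>r. r ^ ?n * cutoff L r"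
  let ?h = "\<lambda>r p. heat_kernel \<rho> (fst p - snd p - r *\<^sub>R \<omega>)"
  interpret R: finite_measure ?R
    using L_pos by (intro finite_measureI) (simp add: emeasure_restrict_space space_restrict_space)
  have [measurable]: "(\<lambda>r. r) \<in> borel_measurable ?R"
    by (rule measurable_restrict_space1) simp
  define H where "H = 1 / (sqrt (2 * pi) * \<rho>) ^ DIM('a)"
  have H: "?h r p \<le> H" "0 \<le> ?h r p" for r p
    unfolding H_def using heat_kernel_le[OF \<rho>] heat_kernel_nonneg[OF \<rho>] by auto
  have ih: "integrable (\<mu> \<Otimes>\<^sub>M \<mu>) (?h r)" for r
    using H by (intro P.integrable_const_bound[of _ H]) auto
  have ih0: "0 \<le> (\<integral>p. ?h r p \<partial>(\<mu> \<Otimes>\<^sub>M \<mu>))" for r using H by simp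
  have ihH: "(\<integral>p. ?h r p \<partial>(\<mu> \<Otimes>\<^sub>M \<mu>)) \<le> H" for r
    using integral_mono[OF ih[of r] P.integrable_const[of H]] H P.prob_space by simp
  have w0: "0 \<le> ?w r" if "r \<in> space ?R" for r
    using that cutoff_bounds[of L r] by (simp add: space_restrict_space)
  have wB: "?w r \<le> (2 * L) ^ ?n" if "r \<in> space ?R" for r
  proof -
    have r: "0 \<le> r" "r \<le> 2 * L" using that by (auto simp: space_restrict_space)
    have "?w r \<le> (2 * L) ^ ?n * 1"
      using r cutoff_bounds[of L r] by (intro mult_mono power_mono) auto
    then show ?thesis by simp
  qed
  have int: "integrable ?R (\<lambda>r. ?w r * (\<integral>p. ?h r p \<partial>(\<mu> \<Otimes>\<^sub>M \<mu>)))"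
  proof (rule R.integrable_const_bound[of _ "(2 * L) ^ ?n * H"])
    show "AE r in ?R. norm (?w r * (\<integral>p. ?h r p \<partial>(\<mu> \<Otimes>\<^sub>M \<mu>))) \<le> (2 * L) ^ ?n * H"
    proof (rule AE_I2)
      fix r assume r: "r \<in> space ?R"
      have "?w r * (\<integral>p. ?h r p \<partial>(\<mu> \<Otimes>\<^sub>M \<mu>)) \<le> (2 * L) ^ ?n * H"
        using w0[OF r] wB[OF r] ih0[of r] ihH[of r] L_pos by (intro mult_mono) auto
      then show "norm (?w r * (\<integral>p. ?h r p \<partial>(\<mu> \<Otimes>\<^sub>M \<mu>))) \<le> (2 * L) ^ ?n * H"
        using w0[OF r] ih0[of r] by (simp only: real_norm_def abs_of_nonneg mult_nonneg_nonneg)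
    qed
  qed measurable
  have m: "mollified_density \<mu> L \<rho> \<omega> = (\<integral>r. ?w r * (\<integral>p. ?h r p \<partial>(\<mu> \<Otimes>\<^sub>M \<mu>)) \<partial>?R)"
    by (rule mollified_density_eq[OF d \<rho>])
  show ?nonneg
    unfolding m using w0 ih0 by (intro Bochner_Integration.integral_nonneg) (auto intro: mult_nonneg_nonneg)
  have "ennreal (mollified_density \<mu> L \<rho> \<omega>) = (\<integral>\<^sup>+r. ennreal (?w r * (\<integral>p. ?h r p \<partial>(\<mu> \<Otimes>\<^sub>M \<mu>))) \<partial>?R)"
    unfolding m using w0 ih0 by (intro nn_integral_eq_integral[symmetric] int AE_I2) (auto intro: mult_nonneg_nonneg)
  also have "\<dots> = (\<integral>\<^sup>+r. (\<integral>\<^sup>+p. ennreal (?w r * ?h r p) \<partial>(\<mu> \<Otimes>\<^sub>M \<mu>)) \<partial>?R)"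
  proof (rule nn_integral_cong)
    fix r assume r: "r \<in> space ?R"
    have "ennreal (?w r * (\<integral>p. ?h r p \<partial>(\<mu> \<Otimes>\<^sub>M \<mu>))) = ennreal (?w r) * (\<integral>\<^sup>+p. ennreal (?h r p) \<partial>(\<mu> \<Otimes>\<^sub>M \<mu>))"
      using w0[OF r] H by (subst nn_integral_eq_integral[OF ih]) (auto simp: ennreal_mult' ih0)
    also have "\<dots> = (\<integral>\<^sup>+p. ennreal (?w r) * ennreal (?h r p) \<partial>(\<mu> \<Otimes>\<^sub>M \<mu>))"
      by (rule nn_integral_cmult[symmetric]) measurable
    also have "\<dots> = (\<integral>\<^sup>+p. ennreal (?w r * ?h r p) \<partial>(\<mu> \<Otimes>\<^sub>M \<mu>))"
      using w0[OF r] H by (simp add: ennreal_mult')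
    finally show "ennreal (?w r * (\<integral>p. ?h r p \<partial>(\<mu> \<Otimes>\<^sub>M \<mu>))) = (\<integral>\<^sup>+p. ennreal (?w r * ?h r p) \<partial>(\<mu> \<Otimes>\<^sub>M \<mu>))" .
  qed
  also have "\<dots> = (\<integral>\<^sup>+r. (\<integral>\<^sup>+p. indicator {0..2*L} r * ennreal (?w r * ?h r p) \<partial>(\<mu> \<Otimes>\<^sub>M \<mu>)) \<partial>lborel)"
    by (subst nn_integral_restrict_space) (auto intro!: nn_integral_cong simp: nn_integral_cmult[symmetric] indicator_def)
  also have "\<dots> = (\<integral>\<^sup>+p. (\<integral>\<^sup>+r. indicator {0..2*L} r * ennreal (?w r * ?h r p) \<partial>lborel) \<partial>(\<mu> \<Otimes>\<^sub>M \<mu>))"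
  proof -
    interpret RP: pair_sigma_finite "lborel :: real measure" "\<mu> \<Otimes>\<^sub>M \<mu>" ..
    show ?thesis by (rule RP.Fubini'[symmetric]) measurable
  qed
  finally show ?eq .
qed

lemma (in frostman) mollified_density_measurable [measurable]:
  "mollified_density \<mu> L \<rho> \<in> borel_measurable borel"
  unfolding mollified_density_def by measurable

text \<open>
  Polar coordinates with \<open>x = r\<omega>\<close> absorb the weight \<open>r\<^sup>d\<^sup>-\<^sup>1\<close>.
\<close>

lemma (in frostman) nn_integral_test_mollified_density:
  fixes \<phi> :: "'a \<Rightarrow> real"
  assumes d: "DIM('a) \<ge> 2" and \<rho>: "\<rho> > 0" and \<phi> [measurable]: "\<phi> \<in> borel_measurable borel" and \<phi>0: "\<And>x. 0 \<le> \<phi> x"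
  shows "(\<integral>\<^sup>+\<omega>. ennreal (\<phi> \<omega>) * ennreal (mollified_density \<mu> L \<rho> \<omega>) \<partial>sphere_measure) =
    (\<integral>\<^sup>+p. (\<integral>\<^sup>+x. ennreal (\<phi> (x /\<^sub>R norm x) * cutoff L (norm x) * heat_kernel \<rho> (fst p - snd p - x)) \<partial>lborel) \<partial>(\<mu> \<Otimes>\<^sub>M \<mu>))"
proof -
  interpret P: prob_space "\<mu> \<Otimes>\<^sub>M \<mu>" by (rule prob_space_pair)
  interpret S: finite_measure "sphere_measure :: 'a measure" by (rule finite_measure_sphere_measure)
  interpret PS: pair_sigma_finite "\<mu> \<Otimes>\<^sub>M \<mu>" "sphere_measure :: 'a measure" ..
  let ?n = "DIM('a) - 1"
  let ?F = "\<lambda>p x. ennreal (\<phi> (x /\<^sub>R norm x) * cutoff L (norm x) * heat_kernel \<rho> (fst p - snd p - x))"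
  have "(\<integral>\<^sup>+\<omega>. ennreal (\<phi> \<omega>) * ennreal (mollified_density \<mu> L \<rho> \<omega>) \<partial>sphere_measure) =
    (\<integral>\<^sup>+\<omega>. (\<integral>\<^sup>+p. ennreal (\<phi> \<omega>) * (\<integral>\<^sup>+r. indicator {0..2*L} r * ennreal (r ^ ?n * cutoff L r *
         heat_kernel \<rho> (fst p - snd p - r *\<^sub>R \<omega>)) \<partial>lborel) \<partial>(\<mu> \<Otimes>\<^sub>M \<mu>)) \<partial>sphere_measure)"
    unfolding mollified_density_nn_integral(2)[OF d \<rho>]
    by (intro nn_integral_cong nn_integral_cmult[symmetric]) measurable
  also have "\<dots> = (\<integral>\<^sup>+p. (\<integral>\<^sup>+\<omega>. ennreal (\<phi> \<omega>) * (\<integral>\<^sup>+r. indicator {0..2*L} r * ennreal (r ^ ?n * cutoff L r *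
         heat_kernel \<rho> (fst p - snd p - r *\<^sub>R \<omega>)) \<partial>lborel) \<partial>sphere_measure) \<partial>(\<mu> \<Otimes>\<^sub>M \<mu>))"
    by (rule PS.Fubini', rule borel_measurable_pair_sphere_measure) measurable
  also have "\<dots> = (\<integral>\<^sup>+p. (\<integral>\<^sup>+x. ?F p x \<partial>lborel) \<partial>(\<mu> \<Otimes>\<^sub>M \<mu>))"
  proof (rule nn_integral_cong)
    fix p :: "'a \<times> 'a"
    have [measurable]: "?F p \<in> borel_measurable borel" by measurable
    have "(\<integral>\<^sup>+\<omega>. ennreal (\<phi> \<omega>) * (\<integral>\<^sup>+r. indicator {0..2*L} r * ennreal (r ^ ?n * cutoff L r *
         heat_kernel \<rho> (fst p - snd p - r *\<^sub>R \<omega>)) \<partial>lborel) \<partial>sphere_measure) =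
       (\<integral>\<^sup>+\<omega>. (\<integral>\<^sup>+r. indicator {0<..} r * ennreal (r ^ ?n) * ?F p (r *\<^sub>R \<omega>) \<partial>lborel) \<partial>sphere_measure)"
    proof (rule nn_integral_cong)
      fix \<omega> :: 'a assume "\<omega> \<in> space sphere_measure"
      then have \<omega>: "norm \<omega> = 1" by (simp add: space_sphere_measure)
      have "ennreal (\<phi> \<omega>) * (\<integral>\<^sup>+r. indicator {0..2*L} r * ennreal (r ^ ?n * cutoff L r *
         heat_kernel \<rho> (fst p - snd p - r *\<^sub>R \<omega>)) \<partial>lborel) =
        (\<integral>\<^sup>+r. ennreal (\<phi> \<omega>) * (indicator {0..2*L} r * ennreal (r ^ ?n * cutoff L r *
         heat_kernel \<rho> (fst p - snd p - r *\<^sub>R \<omega>))) \<partial>lborel)"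
        by (rule nn_integral_cmult[symmetric]) measurable
      also have "\<dots> = (\<integral>\<^sup>+r. indicator {0<..} r * ennreal (r ^ ?n) * ?F p (r *\<^sub>R \<omega>) \<partial>lborel)"
      proof (rule nn_integral_cong)
        fix r :: real
        consider "r < 0" | "r = 0" | "0 < r" "r \<le> 2 * L" | "2 * L < r" "0 < r" using L_pos by linarith
        then show "ennreal (\<phi> \<omega>) * (indicator {0..2*L} r * ennreal (r ^ ?n * cutoff L r *
           heat_kernel \<rho> (fst p - snd p - r *\<^sub>R \<omega>))) = indicator {0<..} r * ennreal (r ^ ?n) * ?F p (r *\<^sub>R \<omega>)"
        proof cases
          case 2
          have "?n > 0" using d by linarith
          then show ?thesis using 2 by (simp add: zero_power)
        next
          case 3
          have "ennreal (\<phi> \<omega>) * ennreal (r ^ ?n * cutoff L r * heat_kernel \<rho> (fst p - snd p - r *\<^sub>R \<omega>)) =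
              ennreal (\<phi> \<omega> * (r ^ ?n * cutoff L r * heat_kernel \<rho> (fst p - snd p - r *\<^sub>R \<omega>)))"
            using \<phi>0 by (simp add: ennreal_mult')
          also have "\<dots> = ennreal (r ^ ?n) * ennreal (\<phi> \<omega> * cutoff L r * heat_kernel \<rho> (fst p - snd p - r *\<^sub>R \<omega>))"
            using 3 by (simp add: ennreal_mult'[symmetric] mult_ac del: One_nat_def)
          finally show ?thesis using 3 \<omega> by (simp add: indicator_def)
        next
          case 4
          then show ?thesis using L_pos \<omega> by (simp add: indicator_def cutoff_eq_0)
        qed (simp add: indicator_def)
      qed
      finally show "ennreal (\<phi> \<omega>) * (\<integral>\<^sup>+r. indicator {0..2*L} r * ennreal (r ^ ?n * cutoff L r *
         heat_kernel \<rho> (fst p - snd p - r *\<^sub>R \<omega>)) \<partial>lborel) =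
        (\<integral>\<^sup>+r. indicator {0<..} r * ennreal (r ^ ?n) * ?F p (r *\<^sub>R \<omega>) \<partial>lborel)" .
    qed
    also have "\<dots> = (\<integral>\<^sup>+x. ?F p x \<partial>lborel)"
      by (rule nn_integral_polar) measurable
    finally show "(\<integral>\<^sup>+\<omega>. ennreal (\<phi> \<omega>) * (\<integral>\<^sup>+r. indicator {0..2*L} r * ennreal (r ^ ?n * cutoff L r *
         heat_kernel \<rho> (fst p - snd p - r *\<^sub>R \<omega>)) \<partial>lborel) \<partial>sphere_measure) = (\<integral>\<^sup>+x. ?F p x \<partial>lborel)" .
  qed
  finally show ?thesis .
qed

lemma nn_integral_heat_kernel_convolution:
  fixes f :: "'a::euclidean_space \<Rightarrow> real"
  assumes [measurable]: "f \<in> borel_measurable borel" and f: "\<And>x. 0 \<le> f x" "\<And>x. f x \<le> 1" and \<rho>: "\<rho> > 0"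
  shows "(\<integral>\<^sup>+x. ennreal (f x * heat_kernel \<rho> (z - x)) \<partial>lborel) =
    ennreal (\<integral>u. f (z - \<rho> *\<^sub>R u) * heat_kernel 1 u \<partial>lborel)"
proof -
  have "(\<integral>\<^sup>+x. ennreal (f x * heat_kernel \<rho> (z - x)) \<partial>lborel) = (\<integral>\<^sup>+x. ennreal (f (z - x) * heat_kernel \<rho> x) \<partial>lborel)"
    by (subst nn_integral_lborel_reflect[of _ z, symmetric]) simp_all
  also have "\<dots> = ennreal (\<rho> ^ DIM('a)) * (\<integral>\<^sup>+u. ennreal (f (z - \<rho> *\<^sub>R u) * heat_kernel \<rho> (\<rho> *\<^sub>R u)) \<partial>lborel)"
    using \<rho> by (subst nn_integral_lborel_scale[of _ \<rho>]) (simp_all add: ennreal_power)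
  also have "\<dots> = (\<integral>\<^sup>+u. ennreal (\<rho> ^ DIM('a)) * ennreal (f (z - \<rho> *\<^sub>R u) * heat_kernel \<rho> (\<rho> *\<^sub>R u)) \<partial>lborel)"
    by (rule nn_integral_cmult[symmetric]) measurable
  also have "\<dots> = (\<integral>\<^sup>+u. ennreal (f (z - \<rho> *\<^sub>R u) * heat_kernel 1 u) \<partial>lborel)"
  proof (rule nn_integral_cong)
    fix u :: 'a
    have "\<rho> ^ DIM('a) * heat_kernel \<rho> (\<rho> *\<^sub>R u) = heat_kernel 1 u"
      using \<rho> by (simp add: heat_kernel_def gauss_def power_mult_distrib)
    then have "\<rho> ^ DIM('a) * (f (z - \<rho> *\<^sub>R u) * heat_kernel \<rho> (\<rho> *\<^sub>R u)) = f (z - \<rho> *\<^sub>R u) * heat_kernel 1 u"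
      by (metis mult.left_commute)
    then show "ennreal (\<rho> ^ DIM('a)) * ennreal (f (z - \<rho> *\<^sub>R u) * heat_kernel \<rho> (\<rho> *\<^sub>R u)) = ennreal (f (z - \<rho> *\<^sub>R u) * heat_kernel 1 u)"
      using \<rho> by (simp only: ennreal_mult'[symmetric] zero_le_power less_imp_le)
  qed
  also have "\<dots> = ennreal (\<integral>u. f (z - \<rho> *\<^sub>R u) * heat_kernel 1 u \<partial>lborel)"
  proof (rule nn_integral_eq_integral)
    show "integrable lborel (\<lambda>u. f (z - \<rho> *\<^sub>R u) * heat_kernel 1 u)"
      by (rule Bochner_Integration.integrable_bound[OF integral_heat_kernel_1(1)])
        (auto simp: abs_mult f heat_kernel_nonneg intro!: mult_left_le_one_le)
  qed (auto simp: f heat_kernel_nonneg)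
  finally show ?thesis .
qed

lemma heat_kernel_convolution_tendsto:
  fixes f :: "'a::euclidean_space \<Rightarrow> real"
  assumes [measurable]: "f \<in> borel_measurable borel" and f: "\<And>x. 0 \<le> f x" "\<And>x. f x \<le> 1" and cont: "isCont f z"
  shows "(\<lambda>n. \<integral>u. f (z - (1 / 2 ^ n) *\<^sub>R u) * heat_kernel 1 u \<partial>lborel) \<longlonglongrightarrow> f z"
proof -
  have "(\<lambda>n. \<integral>u. f (z - (1 / 2 ^ n) *\<^sub>R u) * heat_kernel 1 u \<partial>lborel) \<longlonglongrightarrow> (\<integral>u. f z * heat_kernel 1 (u :: 'a) \<partial>lborel)"
  proof (rule integral_dominated_convergence[where w="heat_kernel 1"])
    show "AE u in lborel. (\<lambda>n. f (z - (1 / 2 ^ n) *\<^sub>R u) * heat_kernel 1 u) \<longlonglongrightarrow> f z * heat_kernel 1 u"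
    proof (rule AE_I2, rule tendsto_mult[OF _ tendsto_const])
      fix u :: 'a
      have "(\<lambda>n. (1/2::real) ^ n) \<longlonglongrightarrow> 0" by (rule LIMSEQ_realpow_zero) auto
      then have "(\<lambda>n. z - ((1/2::real) ^ n) *\<^sub>R u) \<longlonglongrightarrow> z - 0 *\<^sub>R u"
        by (rule tendsto_diff[OF tendsto_const tendsto_scaleR[OF _ tendsto_const]])
      then have "(\<lambda>n. z - (1 / 2 ^ n) *\<^sub>R u) \<longlonglongrightarrow> z" by (simp add: power_divide)
      then show "(\<lambda>n. f (z - (1 / 2 ^ n) *\<^sub>R u)) \<longlonglongrightarrow> f z"
        by (rule isCont_tendsto_compose[OF cont])
    qed
  qed (auto simp: abs_mult f heat_kernel_nonneg integral_heat_kernel_1 intro!: mult_left_le_one_le)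
  then show ?thesis by (simp add: integral_heat_kernel_1)
qed

text \<open>
  This makes the diagonal, on which the direction is undefined, a null set of pairs.
\<close>

lemma (in frostman) null_singleton:
  assumes "s > 0"
  shows "emeasure \<mu> {x} = 0"
proof -
  have "measure \<mu> {x} \<le> C * (1 / real (Suc n)) powr s" for n
  proof -
    have "measure \<mu> {x} \<le> measure \<mu> (ball x (1 / real (Suc n)))"
      by (intro finite_measure_mono) (auto simp: sets_\<mu>)
    also have "\<dots> \<le> C * (1 / real (Suc n)) powr s" by (intro growth) simp
    finally show ?thesis .
  qed
  moreover have "(\<lambda>n. C * (1 / real (Suc n)) powr s) \<longlonglongrightarrow> C * 0 powr s"
    using assms LIMSEQ_inverse_real_of_nat
    by (intro tendsto_intros tendsto_powr2) (auto simp: inverse_eq_divide)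
  ultimately have "measure \<mu> {x} \<le> C * 0 powr s"
    by (intro LIMSEQ_le_const) auto
  then have "measure \<mu> {x} = 0" by (simp add: measure_le_0_iff)
  then show ?thesis by (simp add: emeasure_eq_measure)
qed

lemma (in frostman) AE_pair_distinct_close:
  assumes "s > 0"
  shows "AE p in \<mu> \<Otimes>\<^sub>M \<mu>. fst p \<noteq> snd p \<and> norm (fst p - snd p) < L"
proof -
  have B: "AE x in \<mu>. x \<in> ball 0 (L / 2)"
    by (rule AE_prob_1[OF concentrated])
  interpret pair_prob_space \<mu> \<mu> ..
  have N: "AE y in \<mu>. y \<noteq> x" for x
    using null_singleton[OF assms, of x] by (intro AE_I[of _ _ "{x}"]) (auto simp: sets_\<mu>)
  have "AE x in \<mu>. AE y in \<mu>. x \<noteq> y \<and> norm (x - y) < L"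
    using B
  proof eventually_elim
    case (elim x)
    show ?case using B N[of x]
    proof eventually_elim
      case (elim y)
      have "norm (x - y) \<le> norm x + norm y" by (rule norm_triangle_ineq4)
      also have "\<dots> < L" using elim \<open>x \<in> ball 0 (L / 2)\<close> by simp
      finally show ?case using elim by auto
    qed
  qed
  then show ?thesis
    by (intro AE_pair_measure) (simp_all add: split_beta)
qed

lemma direction_measure_eq:
  "direction_measure \<mu> = distr (\<mu> \<Otimes>\<^sub>M \<mu>) borel (\<lambda>p. (fst p - snd p) /\<^sub>R norm (fst p - snd p))"
  by (simp add: direction_measure_def split_beta')

text \<open>
  Tested against \<open>\<phi>\<close>, the mollified density is the average over pairs of the convolution of
  \<open>x \<mapsto> \<phi>(x/|x|) cutoff(|x|)\<close> with a Gaussian, evaluated at \<open>x - y\<close>.  That function is continuous away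
  from the origin, and for almost every pair the cutoff equals \<open>1\<close> at \<open>x - y\<close>.
\<close>

lemma (in frostman) mollified_density_weak_limit:
  fixes \<phi> :: "'a \<Rightarrow> real"
  assumes d: "DIM('a) \<ge> 2" and s: "s > 0" and \<phi>: "continuous_on UNIV \<phi>" "\<And>x. 0 \<le> \<phi> x" "\<And>x. \<phi> x \<le> 1"
  shows "(\<lambda>n. \<integral>\<^sup>+\<omega>. ennreal (\<phi> \<omega>) * ennreal (mollified_density \<mu> L (1 / 2 ^ n) \<omega>) \<partial>sphere_measure)
    \<longlonglongrightarrow> ennreal (\<integral>\<omega>. \<phi> \<omega> \<partial>direction_measure \<mu>)"
proof -
  interpret P: prob_space "\<mu> \<Otimes>\<^sub>M \<mu>" by (rule prob_space_pair)
  have [measurable]: "\<phi> \<in> borel_measurable borel" by (rule borel_measurable_continuous_onI[OF \<phi>(1)])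
  define f where "f x = \<phi> (x /\<^sub>R norm x) * cutoff L (norm x)" for x
  have [measurable]: "f \<in> borel_measurable borel" unfolding f_def by measurable
  have f01: "0 \<le> f x" "f x \<le> 1" for x
    using \<phi> cutoff_bounds[of L "norm x"] by (auto simp: f_def mult_le_one)
  have f_cont: "isCont f z" if "z \<noteq> 0" for z
  proof -
    have "isCont \<phi> y" for y using \<phi>(1) by (simp add: continuous_on_eq_continuous_at)
    moreover have "isCont (\<lambda>x. x /\<^sub>R norm x) z" using that by (intro continuous_intros) auto
    ultimately have "isCont (\<lambda>x. \<phi> (x /\<^sub>R norm x)) z" by (rule isCont_o2[where g=\<phi>, rotated])
    moreover have "isCont (cutoff L) y" for y
      using continuous_on_cutoff[of UNIV L] by (simp add: continuous_on_eq_continuous_at)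
    then have "isCont (\<lambda>x. cutoff L (norm x)) z" by (rule isCont_o2[where f=norm and g="cutoff L", OF isCont_norm[OF continuous_ident]])
    ultimately show ?thesis unfolding f_def by (rule isCont_mult)
  qed
  define I where "I n p = (\<integral>u. f (fst p - snd p - (1 / 2 ^ n) *\<^sub>R u) * heat_kernel 1 u \<partial>lborel)" for n :: nat and p
  have [measurable]: "I n \<in> borel_measurable (\<mu> \<Otimes>\<^sub>M \<mu>)" for n unfolding I_def by measurable
  have I01: "0 \<le> I n p" "I n p \<le> 1" for n p
  proof -
    have int: "integrable lborel (\<lambda>u. f (fst p - snd p - (1 / 2 ^ n) *\<^sub>R u) * heat_kernel 1 u)"
      by (rule Bochner_Integration.integrable_bound[OF integral_heat_kernel_1(1)])
        (auto simp: abs_mult f01 heat_kernel_nonneg intro!: mult_left_le_one_le)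
    show "0 \<le> I n p" unfolding I_def
      by (intro Bochner_Integration.integral_nonneg mult_nonneg_nonneg f01 heat_kernel_nonneg) simp
    have "I n p \<le> (\<integral>u. heat_kernel 1 (u :: 'a) \<partial>lborel)"
      unfolding I_def
      by (rule integral_mono[OF int integral_heat_kernel_1(1)]) (simp add: mult_left_le_one_le f01 heat_kernel_nonneg)
    then show "I n p \<le> 1" by (simp add: integral_heat_kernel_1)
  qed
  have "(\<lambda>n. \<integral>p. I n p \<partial>(\<mu> \<Otimes>\<^sub>M \<mu>)) \<longlonglongrightarrow> (\<integral>p. \<phi> ((fst p - snd p) /\<^sub>R norm (fst p - snd p)) \<partial>(\<mu> \<Otimes>\<^sub>M \<mu>))"
  proof (rule integral_dominated_convergence[where w="\<lambda>_. 1"])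
    show "AE p in \<mu> \<Otimes>\<^sub>M \<mu>. (\<lambda>n. I n p) \<longlonglongrightarrow> \<phi> ((fst p - snd p) /\<^sub>R norm (fst p - snd p))"
      using AE_pair_distinct_close[OF s]
    proof eventually_elim
      case (elim p)
      then have "f (fst p - snd p) = \<phi> ((fst p - snd p) /\<^sub>R norm (fst p - snd p))"
        by (simp add: f_def cutoff_eq_1[OF L_pos])
      then show ?case
        using heat_kernel_convolution_tendsto[OF _ f01 f_cont, of "fst p - snd p"] elim by (simp add: I_def)
    qed
    show "(\<lambda>p. \<phi> ((fst p - snd p) /\<^sub>R norm (fst p - snd p))) \<in> borel_measurable (\<mu> \<Otimes>\<^sub>M \<mu>)"
      by measurable
    show "AE p in \<mu> \<Otimes>\<^sub>M \<mu>. norm (I n p) \<le> 1" for n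
      by (simp add: I01)
  qed simp_all
  moreover have "(\<integral>\<^sup>+\<omega>. ennreal (\<phi> \<omega>) * ennreal (mollified_density \<mu> L (1 / 2 ^ n) \<omega>) \<partial>sphere_measure) =
      ennreal (\<integral>p. I n p \<partial>(\<mu> \<Otimes>\<^sub>M \<mu>))" for n
  proof -
    have "(\<integral>\<^sup>+\<omega>. ennreal (\<phi> \<omega>) * ennreal (mollified_density \<mu> L (1 / 2 ^ n) \<omega>) \<partial>sphere_measure) =
       (\<integral>\<^sup>+p. (\<integral>\<^sup>+x. ennreal (f x * heat_kernel (1 / 2 ^ n) (fst p - snd p - x)) \<partial>lborel) \<partial>(\<mu> \<Otimes>\<^sub>M \<mu>))"
      unfolding f_def by (rule nn_integral_test_mollified_density[OF d]) (auto simp: \<phi>)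
    also have "\<dots> = (\<integral>\<^sup>+p. ennreal (I n p) \<partial>(\<mu> \<Otimes>\<^sub>M \<mu>))"
      unfolding I_def by (intro nn_integral_cong nn_integral_heat_kernel_convolution) (auto simp: f01)
    also have "\<dots> = ennreal (\<integral>p. I n p \<partial>(\<mu> \<Otimes>\<^sub>M \<mu>))"
      by (intro nn_integral_eq_integral P.integrable_const_bound[of _ 1]) (auto simp: I01)
    finally show ?thesis .
  qed
  moreover have "(\<integral>\<omega>. \<phi> \<omega> \<partial>direction_measure \<mu>) = (\<integral>p. \<phi> ((fst p - snd p) /\<^sub>R norm (fst p - snd p)) \<partial>(\<mu> \<Otimes>\<^sub>M \<mu>))"
    unfolding direction_measure_eq by (rule integral_distr) measurable
  ultimately show ?thesis by (simp add: tendsto_ennrealI)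
qed

section \<open>The limit density\<close>

text \<open>
  Where the limit does not exist, the value is irrelevant: \<open>mollification_tail\<close> is infinite there, so
  the bounds in terms of it hold at every point.
\<close>

definition direction_density :: "'a::euclidean_space measure \<Rightarrow> real \<Rightarrow> 'a \<Rightarrow> real" where
  "direction_density \<mu> L \<omega> = lim (\<lambda>n. mollified_density \<mu> L (1 / 2 ^ n) \<omega>)"

text \<open>
  The total variation of the sequence of mollified densities from scale \<open>1/2\<^sup>n\<close> downwards.
\<close>

definition mollification_tail :: "'a::euclidean_space measure \<Rightarrow> real \<Rightarrow> nat \<Rightarrow> 'a \<Rightarrow> ennreal" where
  "mollification_tail \<mu> L n \<omega> = (\<Sum>i. ennreal
     \<bar>mollified_density \<mu> L (1 / 2 ^ Suc (i + n)) \<omega> - mollified_density \<mu> L (1 / 2 ^ (i + n)) \<omega>\<bar>)"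

lemma lim_diff_le_suminf:
  fixes x :: "nat \<Rightarrow> real"
  shows "ennreal \<bar>lim x - x n\<bar> \<le> (\<Sum>i. ennreal \<bar>x (Suc (i + n)) - x (i + n)\<bar>)"
proof (cases "(\<Sum>i. ennreal \<bar>x (Suc (i + n)) - x (i + n)\<bar>) = \<infinity>")
  case False
  let ?d = "\<lambda>i. x (Suc (i + n)) - x (i + n)"
  have sum_abs: "summable (\<lambda>i. \<bar>?d i\<bar>)"
    using False by (intro summable_suminf_not_top) auto
  then have sum: "summable ?d" by (rule summable_rabs_cancel)
  have tel: "(\<Sum>i<k. ?d i) = x (k + n) - x n" for k
    by (induction k) auto
  have "(\<lambda>k. x (k + n) - x n) \<longlonglongrightarrow> (\<Sum>i. ?d i)"
    using summable_LIMSEQ[OF sum] by (simp only: tel)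
  from tendsto_add[OF this tendsto_const[of "x n"]]
  have "(\<lambda>k. x (k + n)) \<longlonglongrightarrow> (\<Sum>i. ?d i) + x n" by simp
  then have "x \<longlonglongrightarrow> (\<Sum>i. ?d i) + x n" by (rule LIMSEQ_offset)
  then have "lim x - x n = (\<Sum>i. ?d i)" by (simp add: limI)
  then have "\<bar>lim x - x n\<bar> \<le> (\<Sum>i. \<bar>?d i\<bar>)" using summable_rabs[OF sum_abs] by simp
  then have "ennreal \<bar>lim x - x n\<bar> \<le> ennreal (\<Sum>i. \<bar>?d i\<bar>)" by (rule ennreal_leI)
  also have "\<dots> = (\<Sum>i. ennreal \<bar>?d i\<bar>)" by (rule suminf_ennreal2[symmetric]) (auto intro: sum_abs)
  finally show ?thesis .
qed simp

lemma mollification_tail_bound: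
  "ennreal \<bar>direction_density \<mu> L \<omega> - mollified_density \<mu> L (1 / 2 ^ n) \<omega>\<bar> \<le> mollification_tail \<mu> L n \<omega>"
  unfolding direction_density_def mollification_tail_def
  using lim_diff_le_suminf[of "\<lambda>n. mollified_density \<mu> L (1 / 2 ^ n) \<omega>" n] by simp

lemma (in frostman) direction_density_measurable [measurable]: "direction_density \<mu> L \<in> borel_measurable borel"
  unfolding direction_density_def by measurable

lemma (in frostman) mollification_tail_measurable [measurable]: "mollification_tail \<mu> L n \<in> borel_measurable borel"
  unfolding mollification_tail_def by measurable

lemma suminf_dyadic_powr:
  assumes "a > 0" "K \<ge> 0"
  shows "(\<Sum>i. ennreal (K * (1 / 2 ^ (i + n)) powr a)) = ennreal (K / (1 - (1 / 2) powr a) * (1 / 2 ^ n) powr a)"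
proof -
  let ?q = "(1 / 2 :: real) powr a"
  have "?q < 1 powr a" using assms by (intro powr_less_mono2) auto
  then have q: "0 \<le> ?q" "?q < 1" by auto
  have eq: "K * (1 / 2 ^ (i + n)) powr a = (K * (1 / 2 ^ n) powr a) * ?q ^ i" for i
  proof -
    have "(1 / 2 ^ (i + n) :: real) = (1 / 2 ^ n) * (1 / 2) ^ i"
      by (simp add: power_add power_divide)
    then have "(1 / 2 ^ (i + n) :: real) powr a = (1 / 2 ^ n) powr a * ((1 / 2) ^ i) powr a"
      by (simp only: powr_mult zero_le_power zero_le_divide_1_iff zero_le_numeral)
    also have "((1 / 2 :: real) ^ i) powr a = ?q ^ i"
    proof -
      have "((1 / 2 :: real) ^ i) powr a = ((1 / 2) powr real i) powr a" by (simp add: powr_realpow)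
      also have "\<dots> = ?q powr real i" by (simp only: powr_powr mult.commute)
      also have "\<dots> = ?q ^ i" by (rule powr_realpow) simp
      finally show ?thesis .
    qed
    finally show ?thesis by simp
  qed
  have "(\<Sum>i. ennreal (K * (1 / 2 ^ (i + n)) powr a)) = ennreal (\<Sum>i. (K * (1 / 2 ^ n) powr a) * ?q ^ i)"
    unfolding eq using assms q by (intro suminf_ennreal2 summable_mult summable_geometric) auto
  also have "(\<Sum>i. (K * (1 / 2 ^ n) powr a) * ?q ^ i) = (K * (1 / 2 ^ n) powr a) * (1 / (1 - ?q))"
    using q by (subst suminf_mult) (auto intro: summable_geometric simp: suminf_geometric)
  finally show ?thesis by simp
qed

lemma mollification_tail_integral:
  fixes s :: real
  assumes d: "DIM('a::euclidean_space) \<ge> 2" and L: "L > 0" and s: "s > DIM('a) - 1"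
  shows "\<exists>K\<ge>0. \<forall>\<mu>::'a measure. frostman \<mu> s C L \<longrightarrow> (\<forall>n.
    (\<integral>\<^sup>+\<omega>. mollification_tail \<mu> L n \<omega> \<partial>sphere_measure) \<le> ennreal (K * (1 / 2 ^ n) powr (s - (DIM('a) - 1))))"
proof -
  let ?a = "s - (DIM('a) - 1)"
  obtain K2 where K2: "K2 \<ge> 0" "\<And>\<mu>::'a measure. \<And>\<rho> \<omega>. frostman \<mu> s C L \<Longrightarrow> \<rho> > 0 \<Longrightarrow>
    ennreal \<bar>mollified_density \<mu> L (\<rho> / 2) \<omega> - mollified_density \<mu> L \<rho> \<omega>\<bar> \<le> ennreal K2 * oscillation_majorant \<mu> \<rho> \<omega>"
    using mollified_density_dyadic_increment[OF d L, of s C] by blast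
  obtain K3 where K3: "K3 \<ge> 0" "\<And>\<mu>::'a measure. \<And>\<rho>. frostman \<mu> s C L \<Longrightarrow> \<rho> > 0 \<Longrightarrow>
    (\<integral>\<^sup>+\<omega>. oscillation_majorant \<mu> \<rho> \<omega> \<partial>sphere_measure) \<le> ennreal (K3 * \<rho> powr ?a)"
    using oscillation_majorant_integral[where 'a='a, of s C L] by blast
  have "(\<integral>\<^sup>+\<omega>. mollification_tail \<mu> L n \<omega> \<partial>sphere_measure) \<le> ennreal (K2 * K3 / (1 - (1 / 2) powr ?a) * (1 / 2 ^ n) powr ?a)"
    if fr: "frostman \<mu> s C L" for \<mu> :: "'a measure" and n
  proof -
    interpret frostman \<mu> s C L by fact
    note [measurable] = oscillation_majorant_measurable[OF fr]
    have "(\<integral>\<^sup>+\<omega>. mollification_tail \<mu> L n \<omega> \<partial>sphere_measure) =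
      (\<Sum>i. \<integral>\<^sup>+\<omega>. ennreal \<bar>mollified_density \<mu> L (1 / 2 ^ Suc (i + n)) \<omega> - mollified_density \<mu> L (1 / 2 ^ (i + n)) \<omega>\<bar> \<partial>sphere_measure)"
      unfolding mollification_tail_def by (rule nn_integral_suminf) measurable
    also have "\<dots> \<le> (\<Sum>i. ennreal (K2 * K3 * (1 / 2 ^ (i + n)) powr ?a))"
    proof (rule suminf_le)
      fix i
      let ?\<rho> = "1 / 2 ^ (i + n) :: real"
      have \<rho>: "?\<rho> > 0" by simp
      have half: "1 / 2 ^ Suc (i + n) = ?\<rho> / 2" by simp
      have "(\<integral>\<^sup>+\<omega>. ennreal \<bar>mollified_density \<mu> L (1 / 2 ^ Suc (i + n)) \<omega> - mollified_density \<mu> L ?\<rho> \<omega>\<bar> \<partial>sphere_measure)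
        \<le> (\<integral>\<^sup>+\<omega>. ennreal K2 * oscillation_majorant \<mu> ?\<rho> \<omega> \<partial>sphere_measure)"
        unfolding half by (rule nn_integral_mono) (rule K2(2)[OF fr \<rho>])
      also have "\<dots> = ennreal K2 * (\<integral>\<^sup>+\<omega>. oscillation_majorant \<mu> ?\<rho> \<omega> \<partial>sphere_measure)"
        by (rule nn_integral_cmult) measurable
      also have "\<dots> \<le> ennreal K2 * ennreal (K3 * ?\<rho> powr ?a)"
        by (rule mult_left_mono[OF K3(2)[OF fr \<rho>]]) simp
      also have "\<dots> = ennreal (K2 * K3 * ?\<rho> powr ?a)"
        using K2(1) by (simp only: ennreal_mult'[symmetric] mult.assoc)
      finally show "(\<integral>\<^sup>+\<omega>. ennreal \<bar>mollified_density \<mu> L (1 / 2 ^ Suc (i + n)) \<omega> - mollified_density \<mu> L ?\<rho> \<omega>\<bar> \<partial>sphere_measure)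
        \<le> ennreal (K2 * K3 * ?\<rho> powr ?a)" .
    qed auto
    also have "\<dots> = ennreal (K2 * K3 / (1 - (1 / 2) powr ?a) * (1 / 2 ^ n) powr ?a)"
      using s K2(1) K3(1) by (intro suminf_dyadic_powr) auto
    finally show ?thesis .
  qed
  moreover have "0 \<le> K2 * K3 / (1 - (1 / 2) powr ?a)"
  proof -
    have "(1 / 2 :: real) powr ?a \<le> 1 powr ?a" using s by (intro powr_mono2) auto
    then show ?thesis using K2(1) K3(1) by simp
  qed
  ultimately show ?thesis by blast
qed

lemma (in frostman) mollification_tail_tendsto_0:
  assumes d: "DIM('a) \<ge> 2" and s: "s > DIM('a) - 1"
  shows "(\<lambda>n. \<integral>\<^sup>+\<omega>. mollification_tail \<mu> L n \<omega> \<partial>sphere_measure) \<longlonglongrightarrow> 0"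
    and "(\<integral>\<^sup>+\<omega>. mollification_tail \<mu> L n \<omega> \<partial>sphere_measure) < \<infinity>"
proof -
  let ?a = "s - (DIM('a) - 1)"
  obtain K where K: "\<And>n. (\<integral>\<^sup>+\<omega>. mollification_tail \<mu> L n \<omega> \<partial>sphere_measure) \<le> ennreal (K * (1 / 2 ^ n) powr ?a)"
    using mollification_tail_integral[OF d L_pos s, of C] frostman_axioms by blast
  have "(\<lambda>n. (1/2::real) ^ n) \<longlonglongrightarrow> 0" by (rule LIMSEQ_realpow_zero) auto
  then have "(\<lambda>n. (1 / 2 ^ n :: real) powr ?a) \<longlonglongrightarrow> 0 powr ?a"
    using s by (intro tendsto_powr2) (auto simp: power_divide)
  then have "(\<lambda>n. K * (1 / 2 ^ n :: real) powr ?a) \<longlonglongrightarrow> K * 0" by (intro tendsto_mult tendsto_const) simp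
  then have "(\<lambda>n. ennreal (K * (1 / 2 ^ n :: real) powr ?a)) \<longlonglongrightarrow> 0"
    using tendsto_ennrealI[of _ "K * 0"] by simp
  from tendsto_sandwich[OF _ _ tendsto_const this]
  show "(\<lambda>n. \<integral>\<^sup>+\<omega>. mollification_tail \<mu> L n \<omega> \<partial>sphere_measure) \<longlonglongrightarrow> 0"
    using K by (simp add: always_eventually)
  show "(\<integral>\<^sup>+\<omega>. mollification_tail \<mu> L n \<omega> \<partial>sphere_measure) < \<infinity>"
    using K[of n] by (rule le_less_trans) simp
qed

lemma prob_space_direction_measure:
  assumes "frostman \<mu> s C L"
  shows "prob_space (direction_measure \<mu>)"
proof -
  interpret frostman \<mu> s C L by fact
  interpret P: prob_space "\<mu> \<Otimes>\<^sub>M \<mu>" by (rule prob_space_pair)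
  show ?thesis unfolding direction_measure_eq by (rule P.prob_space_distr) measurable
qed

lemma sets_direction_measure [simp, measurable_cong]: "sets (direction_measure \<mu>) = sets borel"
  by (simp add: direction_measure_def)

lemma space_direction_measure [simp]: "space (direction_measure \<mu>) = UNIV"
  by (simp add: direction_measure_def)

text \<open>
  The total masses of the mollified densities converge to \<open>1\<close>, so one of them is integrable; all
  the others, and the limit, differ from it by integrable tails.
\<close>

lemma (in frostman) direction_density_integrable:
  assumes d: "DIM('a) \<ge> 2" and s: "s > DIM('a) - 1"
  shows "integrable sphere_measure (direction_density \<mu> L)"
    and "integrable sphere_measure (mollified_density \<mu> L (1 / 2 ^ n))"
proof -
  have s0: "s > 0" using s d by linarith
  let ?m = "\<lambda>n. mollified_density \<mu> L (1 / 2 ^ n)" and ?f = "direction_density \<mu> L" and ?D = "mollification_tail \<mu> L"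
  interpret N: prob_space "direction_measure \<mu>" by (rule prob_space_direction_measure[OF frostman_axioms])
  have "(\<lambda>n. \<integral>\<^sup>+\<omega>. ennreal 1 * ennreal (?m n \<omega>) \<partial>sphere_measure) \<longlonglongrightarrow> ennreal (\<integral>\<omega>. 1 \<partial>direction_measure \<mu>)"
    by (rule mollified_density_weak_limit[OF d s0]) auto
  then have lim1: "(\<lambda>n. \<integral>\<^sup>+\<omega>. ennreal (?m n \<omega>) \<partial>sphere_measure) \<longlonglongrightarrow> 1"
    using N.prob_space by simp
  have "eventually (\<lambda>n. (\<integral>\<^sup>+\<omega>. ennreal (?m n \<omega>) \<partial>sphere_measure) < top) sequentially"
    by (rule order_tendstoD(2)[OF lim1]) simp
  then obtain k where k: "(\<integral>\<^sup>+\<omega>. ennreal (?m k \<omega>) \<partial>sphere_measure) < top"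
    by (auto simp: eventually_sequentially)
  have abs_m: "\<bar>?m n \<omega>\<bar> = ?m n \<omega>" for n \<omega>
    using mollified_density_nn_integral(1)[OF d, of "1 / 2 ^ n" \<omega>] by simp
  have m0: "0 \<le> ?m n \<omega>" for n \<omega> by (rule mollified_density_nn_integral(1)[OF d]) simp
  have f_le: "ennreal \<bar>?f \<omega>\<bar> \<le> ennreal (?m k \<omega>) + ?D k \<omega>" for \<omega>
  proof -
    have "ennreal \<bar>?f \<omega>\<bar> \<le> ennreal (\<bar>?m k \<omega>\<bar> + \<bar>?f \<omega> - ?m k \<omega>\<bar>)" by (rule ennreal_leI) linarith
    also have "\<dots> = ennreal (?m k \<omega>) + ennreal \<bar>?f \<omega> - ?m k \<omega>\<bar>" by (simp add: m0 ennreal_plus)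
    also have "\<dots> \<le> ennreal (?m k \<omega>) + ?D k \<omega>" by (rule add_left_mono[OF mollification_tail_bound])
    finally show ?thesis .
  qed
  have "(\<integral>\<^sup>+\<omega>. ennreal \<bar>?f \<omega>\<bar> \<partial>sphere_measure) \<le> (\<integral>\<^sup>+\<omega>. ennreal (?m k \<omega>) + ?D k \<omega> \<partial>sphere_measure)"
    by (rule nn_integral_mono) (rule f_le)
  also have "\<dots> = (\<integral>\<^sup>+\<omega>. ennreal (?m k \<omega>) \<partial>sphere_measure) + (\<integral>\<^sup>+\<omega>. ?D k \<omega> \<partial>sphere_measure)"
    by (rule nn_integral_add) measurable
  also have "\<dots> < \<infinity>"
    using k mollification_tail_tendsto_0(2)[OF d s, of k] by simp
  finally have f_fin: "(\<integral>\<^sup>+\<omega>. ennreal \<bar>?f \<omega>\<bar> \<partial>sphere_measure) < \<infinity>" .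
  show "integrable sphere_measure ?f"
    unfolding integrable_iff_bounded using f_fin by simp
  have m_le: "ennreal \<bar>?m n \<omega>\<bar> \<le> ennreal \<bar>?f \<omega>\<bar> + ?D n \<omega>" for \<omega>
  proof -
    have "ennreal \<bar>?m n \<omega>\<bar> \<le> ennreal (\<bar>?f \<omega>\<bar> + \<bar>?f \<omega> - ?m n \<omega>\<bar>)" by (rule ennreal_leI) linarith
    also have "\<dots> = ennreal \<bar>?f \<omega>\<bar> + ennreal \<bar>?f \<omega> - ?m n \<omega>\<bar>" by simp
    also have "\<dots> \<le> ennreal \<bar>?f \<omega>\<bar> + ?D n \<omega>" by (rule add_left_mono[OF mollification_tail_bound])
    finally show ?thesis .
  qed
  have "(\<integral>\<^sup>+\<omega>. ennreal \<bar>?m n \<omega>\<bar> \<partial>sphere_measure) \<le> (\<integral>\<^sup>+\<omega>. ennreal \<bar>?f \<omega>\<bar> + ?D n \<omega> \<partial>sphere_measure)"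
    by (rule nn_integral_mono) (rule m_le)
  also have "\<dots> = (\<integral>\<^sup>+\<omega>. ennreal \<bar>?f \<omega>\<bar> \<partial>sphere_measure) + (\<integral>\<^sup>+\<omega>. ?D n \<omega> \<partial>sphere_measure)"
    by (rule nn_integral_add) measurable
  also have "\<dots> < \<infinity>"
    using f_fin mollification_tail_tendsto_0(2)[OF d s, of n] by simp
  finally show "integrable sphere_measure (?m n)"
    unfolding integrable_iff_bounded by simp
qed

text \<open>
  Convergence in \<open>L\<^sup>1\<close> identifies the weak limit.
\<close>

lemma (in frostman) integral_test_direction_density:
  fixes \<phi> :: "'a \<Rightarrow> real"
  assumes d: "DIM('a) \<ge> 2" and s: "s > DIM('a) - 1"
    and \<phi>: "continuous_on UNIV \<phi>" "\<And>x. 0 \<le> \<phi> x" "\<And>x. \<phi> x \<le> 1"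
  shows "(\<integral>\<omega>. \<phi> \<omega> * direction_density \<mu> L \<omega> \<partial>sphere_measure) = (\<integral>\<omega>. \<phi> \<omega> \<partial>direction_measure \<mu>)"
proof -
  have s0: "s > 0" using s d by linarith
  let ?m = "\<lambda>n. mollified_density \<mu> L (1 / 2 ^ n)" and ?f = "direction_density \<mu> L" and ?D = "mollification_tail \<mu> L"
  have [measurable]: "\<phi> \<in> borel_measurable borel" by (rule borel_measurable_continuous_onI[OF \<phi>(1)])
  note int = direction_density_integrable[OF d s]
  have i: "integrable sphere_measure (\<lambda>\<omega>. \<phi> \<omega> * g \<omega>)" if "integrable sphere_measure g" for g
    using that \<phi> by (intro Bochner_Integration.integrable_bound[OF that])
      (auto simp: abs_mult mult_left_le_one_le dest: borel_measurable_integrable)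
  have m0: "0 \<le> ?m n \<omega>" for n \<omega> by (rule mollified_density_nn_integral(1)[OF d]) simp
  have A: "ennreal (\<integral>\<omega>. \<phi> \<omega> * ?m n \<omega> \<partial>sphere_measure) = (\<integral>\<^sup>+\<omega>. ennreal (\<phi> \<omega>) * ennreal (?m n \<omega>) \<partial>sphere_measure)" for n
    using \<phi>(2) m0 by (subst nn_integral_eq_integral[OF i[OF int(2)], symmetric]) (auto simp: ennreal_mult')
  have "(\<lambda>n. ennreal (\<integral>\<omega>. \<phi> \<omega> * ?m n \<omega> \<partial>sphere_measure)) \<longlonglongrightarrow> ennreal (\<integral>\<omega>. \<phi> \<omega> \<partial>direction_measure \<mu>)"
    unfolding A by (rule mollified_density_weak_limit[OF d s0 \<phi>])
  then have L1: "(\<lambda>n. \<integral>\<omega>. \<phi> \<omega> * ?m n \<omega> \<partial>sphere_measure) \<longlonglongrightarrow> (\<integral>\<omega>. \<phi> \<omega> \<partial>direction_measure \<mu>)"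
    using \<phi>(2) m0 by (subst (asm) tendsto_ennreal_iff) auto
  have B: "ennreal \<bar>(\<integral>\<omega>. \<phi> \<omega> * ?m n \<omega> \<partial>sphere_measure) - (\<integral>\<omega>. \<phi> \<omega> * ?f \<omega> \<partial>sphere_measure)\<bar>
      \<le> (\<integral>\<^sup>+\<omega>. ?D n \<omega> \<partial>sphere_measure)" for n
  proof -
    have "ennreal (norm ((\<integral>\<omega>. \<phi> \<omega> * ?m n \<omega> - \<phi> \<omega> * ?f \<omega> \<partial>sphere_measure)))
      \<le> (\<integral>\<^sup>+\<omega>. ennreal (norm (\<phi> \<omega> * ?m n \<omega> - \<phi> \<omega> * ?f \<omega>)) \<partial>sphere_measure)"
      by (rule integral_norm_bound_ennreal[OF Bochner_Integration.integrable_diff[OF i[OF int(2)] i[OF int(1)]]])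
    also have "\<dots> \<le> (\<integral>\<^sup>+\<omega>. ?D n \<omega> \<partial>sphere_measure)"
    proof (rule nn_integral_mono)
      fix \<omega>
      have "norm (\<phi> \<omega> * ?m n \<omega> - \<phi> \<omega> * ?f \<omega>) \<le> \<bar>?f \<omega> - ?m n \<omega>\<bar>"
        using \<phi>(2,3)[of \<omega>] unfolding right_diff_distrib[symmetric]
        by (simp add: abs_mult mult_left_le_one_le abs_minus_commute)
      then have "ennreal (norm (\<phi> \<omega> * ?m n \<omega> - \<phi> \<omega> * ?f \<omega>)) \<le> ennreal \<bar>?f \<omega> - ?m n \<omega>\<bar>" by (rule ennreal_leI)
      also have "\<dots> \<le> ?D n \<omega>" by (rule mollification_tail_bound)
      finally show "ennreal (norm (\<phi> \<omega> * ?m n \<omega> - \<phi> \<omega> * ?f \<omega>)) \<le> ?D n \<omega>" .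
    qed
    finally show ?thesis
      using Bochner_Integration.integral_diff[OF i[OF int(2)] i[OF int(1)], of n] by simp
  qed
  have "(\<lambda>n. ennreal \<bar>(\<integral>\<omega>. \<phi> \<omega> * ?m n \<omega> \<partial>sphere_measure) - (\<integral>\<omega>. \<phi> \<omega> * ?f \<omega> \<partial>sphere_measure)\<bar>) \<longlonglongrightarrow> ennreal 0"
    by (rule tendsto_sandwich[OF _ _ tendsto_const, where h="\<lambda>n. \<integral>\<^sup>+\<omega>. ?D n \<omega> \<partial>sphere_measure"])
      (simp_all add: always_eventually B mollification_tail_tendsto_0(1)[OF d s])
  then have "(\<lambda>n. \<bar>(\<integral>\<omega>. \<phi> \<omega> * ?m n \<omega> \<partial>sphere_measure) - (\<integral>\<omega>. \<phi> \<omega> * ?f \<omega> \<partial>sphere_measure)\<bar>) \<longlonglongrightarrow> 0"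
    by (subst (asm) tendsto_ennreal_iff) auto
  then have "(\<lambda>n. (\<integral>\<omega>. \<phi> \<omega> * ?m n \<omega> \<partial>sphere_measure) - (\<integral>\<omega>. \<phi> \<omega> * ?f \<omega> \<partial>sphere_measure)) \<longlonglongrightarrow> 0"
    by (rule tendsto_rabs_zero_cancel)
  then have "(\<lambda>n. \<integral>\<omega>. \<phi> \<omega> * ?m n \<omega> \<partial>sphere_measure) \<longlonglongrightarrow> (\<integral>\<omega>. \<phi> \<omega> * ?f \<omega> \<partial>sphere_measure)"
    by (rule LIM_zero_cancel)
  from LIMSEQ_unique[OF this L1] show ?thesis .
qed

lemma (in frostman) direction_density_AE_nonneg:
  assumes d: "DIM('a) \<ge> 2" and s: "s > DIM('a) - 1"
  shows "AE \<omega> in sphere_measure. 0 \<le> direction_density \<mu> L \<omega>"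
proof -
  let ?m = "\<lambda>n. mollified_density \<mu> L (1 / 2 ^ n)" and ?f = "direction_density \<mu> L" and ?D = "mollification_tail \<mu> L"
  have "AE \<omega> in sphere_measure. ?D 0 \<omega> \<noteq> \<infinity>"
    using mollification_tail_tendsto_0(2)[OF d s, of 0]
    by (intro nn_integral_PInf_AE) (auto intro: borel_measurable_sphere_measure)
  then show ?thesis
  proof eventually_elim
    case (elim \<omega>)
    let ?x = "\<lambda>n. ?m n \<omega>"
    have "summable (\<lambda>i. \<bar>?x (Suc i) - ?x i\<bar>)"
      using elim unfolding mollification_tail_def by (intro summable_suminf_not_top) auto
    then have "summable (\<lambda>i. ?x (Suc i) - ?x i)" by (rule summable_rabs_cancel)
    then have "convergent (\<lambda>n. \<Sum>i<n. ?x (Suc i) - ?x i)" by (simp add: summable_iff_convergent)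
    then have "convergent (\<lambda>n. ?x n - ?x 0)" by (simp only: sum_lessThan_telescope[of ?x])
    then have "convergent ?x" using convergent_diff_const_right_iff by blast
    then have "?x \<longlonglongrightarrow> ?f \<omega>" by (simp add: direction_density_def convergent_LIMSEQ_iff)
    then show ?case
      by (rule LIMSEQ_le_const) (auto intro!: mollified_density_nn_integral(1)[OF d])
  qed
qed

section \<open>The remainder at a single scale\<close>

lemma truncated_infdist_tendsto_indicator:
  fixes U :: "'a::metric_space set"
  assumes "open U" "U \<noteq> UNIV"
  shows "(\<lambda>k. min 1 (real k * infdist x (- U))) \<longlonglongrightarrow> indicator U x"
proof (cases "x \<in> U")
  case True
  have "infdist x (- U) \<noteq> 0"
    using assms True in_closed_iff_infdist_zero[of "- U" x] by auto
  then have pos: "infdist x (- U) > 0" using infdist_nonneg[of x "- U"] by linarith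
  obtain n where n: "1 / infdist x (- U) < real n" using reals_Archimedean2 by blast
  have "min 1 (real k * infdist x (- U)) = 1" if "k \<ge> n" for k
  proof -
    have "1 / infdist x (- U) \<le> real k" using n that by linarith
    then show ?thesis using pos by (simp add: pos_divide_le_eq min_def)
  qed
  then have "eventually (\<lambda>k. min 1 (real k * infdist x (- U)) = 1) sequentially"
    unfolding eventually_sequentially by blast
  then show ?thesis using True by (simp add: tendsto_eventually)
qed (simp add: infdist_zero)

text \<open>
  Indicators of open sets are increasing limits of continuous functions, and the open sets generate
  the Borel sets and are closed under intersection.
\<close>

lemma (in frostman) direction_measure_density:
  assumes d: "DIM('a) \<ge> 2" and s: "s > DIM('a) - 1" and A: "A \<in> sets borel"
  shows "measure (direction_measure \<mu>) A = (\<integral>\<omega>. indicator A \<omega> * direction_density \<mu> L \<omega> \<partial>sphere_measure)"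
proof -
  let ?f = "direction_density \<mu> L" and ?\<nu> = "direction_measure \<mu>"
  interpret N: prob_space ?\<nu> by (rule prob_space_direction_measure[OF frostman_axioms])
  note f_int = direction_density_integrable(1)[OF d s]
  note f_nn = direction_density_AE_nonneg[OF d s]
  define N' where "N' = distr (density sphere_measure (\<lambda>\<omega>. ennreal (?f \<omega>))) borel (\<lambda>x. x)"
  have id: "(\<lambda>x. x) \<in> (sphere_measure :: 'a measure) \<rightarrow>\<^sub>M borel"
    by (rule borel_measurable_sphere_measure) simp
  have ind_int: "integrable sphere_measure (\<lambda>\<omega>. indicator B \<omega> * ?f \<omega>)" if [measurable]: "B \<in> sets borel" for B
    by (rule Bochner_Integration.integrable_bound[OF f_int]) (auto simp: indicator_def)
  have N': "emeasure N' B = ennreal (\<integral>\<omega>. indicator B \<omega> * ?f \<omega> \<partial>sphere_measure)"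
    if B [measurable]: "B \<in> sets borel" for B
  proof -
    have "(\<lambda>x. x) -` B \<inter> space (sphere_measure :: 'a measure) \<in> sets sphere_measure"
      by (rule measurable_sets[OF id B])
    then have "emeasure N' B = (\<integral>\<^sup>+\<omega>. ennreal (?f \<omega>) * indicator (B \<inter> space sphere_measure) \<omega> \<partial>sphere_measure)"
      unfolding N'_def by (subst emeasure_distr) (simp_all add: emeasure_density id)
    also have "\<dots> = (\<integral>\<^sup>+\<omega>. ennreal (indicator B \<omega> * ?f \<omega>) \<partial>sphere_measure)"
      by (rule nn_integral_cong) (simp add: indicator_def)
    also have "\<dots> = ennreal (\<integral>\<omega>. indicator B \<omega> * ?f \<omega> \<partial>sphere_measure)"
    proof (rule nn_integral_eq_integral[OF ind_int[OF B]])
      show "AE \<omega> in sphere_measure. 0 \<le> indicator B \<omega> * ?f \<omega>"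
        using f_nn by eventually_elim simp
    qed
    finally show ?thesis .
  qed
  have open_eq: "measure ?\<nu> U = (\<integral>\<omega>. indicator U \<omega> * ?f \<omega> \<partial>sphere_measure)" if U: "open U" for U
  proof (cases "U = UNIV")
    case True
    then show ?thesis using integral_test_direction_density[OF d s, of "\<lambda>_. 1"] N.prob_space by simp
  next
    case False
    define \<phi> where "\<phi> k x = min 1 (real k * infdist x (- U))" for k and x :: 'a
    have \<phi>_cont: "continuous_on UNIV (\<phi> k)" for k
      unfolding \<phi>_def by (intro continuous_intros)
    have \<phi>01: "0 \<le> \<phi> k x" "\<phi> k x \<le> 1" for k x by (simp_all add: \<phi>_def infdist_nonneg)
    have [measurable]: "\<phi> k \<in> borel_measurable borel" for k by (rule borel_measurable_continuous_onI[OF \<phi>_cont])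
    have [measurable]: "U \<in> sets borel" using U by simp
    have lim: "(\<lambda>k. \<phi> k x) \<longlonglongrightarrow> indicator U x" for x
      unfolding \<phi>_def by (rule truncated_infdist_tendsto_indicator[OF U False])
    have "(\<lambda>k. \<integral>\<omega>. \<phi> k \<omega> \<partial>?\<nu>) \<longlonglongrightarrow> (\<integral>\<omega>. indicator U \<omega> \<partial>?\<nu>)"
    proof (rule integral_dominated_convergence[where w="\<lambda>_. 1"])
      show "AE \<omega> in ?\<nu>. (\<lambda>k. \<phi> k \<omega>) \<longlonglongrightarrow> indicator U \<omega>" by (simp add: lim)
      show "AE \<omega> in ?\<nu>. norm (\<phi> k \<omega>) \<le> 1" for k by (simp add: \<phi>01)
      show "integrable ?\<nu> (\<lambda>_. 1 :: real)" by simp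
    qed measurable
    moreover have "(\<lambda>k. \<integral>\<omega>. \<phi> k \<omega> * ?f \<omega> \<partial>sphere_measure) \<longlonglongrightarrow> (\<integral>\<omega>. indicator U \<omega> * ?f \<omega> \<partial>sphere_measure)"
    proof (rule integral_dominated_convergence[where w="\<lambda>\<omega>. \<bar>?f \<omega>\<bar>"])
      show "AE \<omega> in sphere_measure. (\<lambda>k. \<phi> k \<omega> * ?f \<omega>) \<longlonglongrightarrow> indicator U \<omega> * ?f \<omega>"
        by (intro AE_I2 tendsto_mult lim tendsto_const)
      show "AE \<omega> in sphere_measure. norm (\<phi> k \<omega> * ?f \<omega>) \<le> \<bar>?f \<omega>\<bar>" for k
        by (simp add: abs_mult mult_left_le_one_le \<phi>01)
      show "integrable sphere_measure (\<lambda>\<omega>. \<bar>?f \<omega>\<bar>)" using f_int by simp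
    qed measurable
    moreover have "(\<integral>\<omega>. \<phi> k \<omega> * ?f \<omega> \<partial>sphere_measure) = (\<integral>\<omega>. \<phi> k \<omega> \<partial>?\<nu>)" for k
      by (rule integral_test_direction_density[OF d s \<phi>_cont \<phi>01])
    ultimately have "(\<integral>\<omega>. indicator U \<omega> * ?f \<omega> \<partial>sphere_measure) = (\<integral>\<omega>. indicator U \<omega> \<partial>?\<nu>)"
      by (auto intro: LIMSEQ_unique)
    then show ?thesis by simp
  qed
  have "?\<nu> = N'"
  proof (rule measure_eqI_generator_eq[where E="{S. open S}" and \<Omega>=UNIV and A="\<lambda>_. UNIV"])
    show "Int_stable {S :: 'a set. open S}" by (auto simp: Int_stable_def)
    show "sets ?\<nu> = sigma_sets UNIV {S. open S}" by (simp add: borel_def)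
    show "sets N' = sigma_sets UNIV {S. open S}" by (simp add: N'_def borel_def)
    show "emeasure ?\<nu> X = emeasure N' X" if "X \<in> {S. open S}" for X
      using that open_eq[of X] N'[of X] by (simp add: N.emeasure_eq_measure)
  qed (auto simp: N.emeasure_eq_measure)
  then have "ennreal (measure ?\<nu> A) = ennreal (\<integral>\<omega>. indicator A \<omega> * ?f \<omega> \<partial>sphere_measure)"
    using N'[OF A] N.emeasure_eq_measure[of A] by simp
  moreover have "0 \<le> (\<integral>\<omega>. indicator A \<omega> * ?f \<omega> \<partial>sphere_measure)"
    using f_nn by (intro integral_nonneg_AE) (auto elim!: eventually_mono)
  ultimately show ?thesis by simp
qed

lemma (in frostman) direction_density_integral:
  assumes d: "DIM('a) \<ge> 2" and s: "s > DIM('a) - 1"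
  shows "(\<integral>\<omega>. direction_density \<mu> L \<omega> \<partial>sphere_measure) = 1"
    and "(\<integral>\<^sup>+\<omega>. ennreal \<bar>direction_density \<mu> L \<omega>\<bar> \<partial>sphere_measure) = 1"
proof -
  interpret N: prob_space "direction_measure \<mu>" by (rule prob_space_direction_measure[OF frostman_axioms])
  show 1: "(\<integral>\<omega>. direction_density \<mu> L \<omega> \<partial>sphere_measure) = 1"
    using direction_measure_density[OF d s, of UNIV] N.prob_space by simp
  have "(\<integral>\<^sup>+\<omega>. ennreal \<bar>direction_density \<mu> L \<omega>\<bar> \<partial>sphere_measure) = (\<integral>\<^sup>+\<omega>. ennreal (direction_density \<mu> L \<omega>) \<partial>sphere_measure)"
    by (rule nn_integral_cong_AE, use direction_density_AE_nonneg[OF d s] in eventually_elim) simp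
  also have "\<dots> = 1"
    by (subst nn_integral_eq_integral[OF direction_density_integrable(1)[OF d s] direction_density_AE_nonneg[OF d s]]) (simp add: 1)
  finally show "(\<integral>\<^sup>+\<omega>. ennreal \<bar>direction_density \<mu> L \<omega>\<bar> \<partial>sphere_measure) = 1" .
qed

text \<open>
  Write \<open>f\<close> for the density and \<open>m\<close> for its mollification at scale \<open>1/2\<^sup>k\<close>.  The average of \<open>f\<close> over
  the cap minus \<open>f(\<omega>)\<close> splits into \<open>f - m\<close> averaged over the cap, \<open>m - m(\<omega>)\<close> averaged over the cap, and
  \<open>m(\<omega>) - f(\<omega>)\<close>; what remains is the deviation of the normalised cap area from its limit \<open>v\<close>.  Once
  \<open>A\<close> and \<open>B\<close> are chosen uniformly, the right-hand side depends on \<open>\<epsilon>\<close> only through \<open>k\<close>, so the supremum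
  over a dyadic block costs nothing.
\<close>

lemma (in frostman) direction_average_remainder_bound:
  fixes v K1 A :: real
  assumes d: "DIM('a) \<ge> 2" and s: "s > DIM('a) - 1" and \<omega>: "norm \<omega> = 1"
    and \<epsilon>: "1 / 2 ^ Suc k \<le> \<epsilon>" "\<epsilon> \<le> 1 / 2 ^ k"
    and K1: "K1 \<ge> 0" "\<And>\<omega>'. norm (\<omega>' - \<omega>) \<le> 1 / 2 ^ k \<Longrightarrow>
      ennreal \<bar>mollified_density \<mu> L (1 / 2 ^ k) \<omega>' - mollified_density \<mu> L (1 / 2 ^ k) \<omega>\<bar>
        \<le> ennreal K1 * oscillation_majorant \<mu> (1 / 2 ^ k) \<omega>"
    and A: "cap_area \<epsilon> \<omega> / \<epsilon> ^ (DIM('a) - 1) \<le> A"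
    and B: "\<bar>cap_area \<epsilon> \<omega> / \<epsilon> ^ (DIM('a) - 1) - v\<bar> \<le> B"
  shows "ennreal \<bar>direction_average (direction_measure \<mu>) \<epsilon> \<omega> - v * direction_density \<mu> L \<omega>\<bar> \<le>
    ennreal ((2 * 2 ^ k) ^ (DIM('a) - 1)) *
      (\<integral>\<^sup>+\<omega>'. indicator (ball \<omega> (1 / 2 ^ k)) \<omega>' * mollification_tail \<mu> L k \<omega>' \<partial>sphere_measure)
    + ennreal A * (ennreal K1 * oscillation_majorant \<mu> (1 / 2 ^ k) \<omega> + mollification_tail \<mu> L k \<omega>)
    + ennreal B * ennreal \<bar>direction_density \<mu> L \<omega>\<bar>"
proof -
  interpret S: finite_measure "sphere_measure :: 'a measure" by (rule finite_measure_sphere_measure)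
  let ?n = "DIM('a) - 1"
  let ?f = "direction_density \<mu> L" and ?m = "mollified_density \<mu> L (1 / 2 ^ k)"
    and ?D = "mollification_tail \<mu> L k" and ?N = "oscillation_majorant \<mu> (1 / 2 ^ k)"
  let ?q = "cap_area \<epsilon> \<omega>" and ?B = "ball \<omega> \<epsilon>" and ?\<nu>B = "measure (direction_measure \<mu>) (ball \<omega> \<epsilon>)"
  define E where "E = ennreal K1 * ?N \<omega> + ?D \<omega>"
  note f_int = direction_density_integrable(1)[OF d s]
  have "0 < (1 / 2 ^ Suc k :: real)" by simp
  with \<epsilon>(1) have \<epsilon>0: "\<epsilon> > 0" by linarith
  have q0: "0 \<le> ?q" by (simp add: cap_area_def)
  have q_int: "(\<integral>\<omega>'. indicator ?B \<omega>' \<partial>sphere_measure) = ?q"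
  proof -
    have "ennreal (\<integral>\<omega>'. indicator ?B \<omega>' \<partial>sphere_measure) = (\<integral>\<^sup>+\<omega>'. ennreal (indicator ?B \<omega>') \<partial>sphere_measure)"
      by (rule nn_integral_eq_integral[symmetric]) (auto intro!: S.integrable_const_bound[of _ 1])
    also have "\<dots> = ennreal ?q" unfolding nn_integral_cap[symmetric] by (simp add: ennreal_indicator)
    finally show ?thesis using q0 by (subst (asm) ennreal_inj) auto
  qed
  have i1: "integrable sphere_measure (\<lambda>\<omega>'. indicator ?B \<omega>' * ?f \<omega>')"
    by (rule Bochner_Integration.integrable_bound[OF f_int]) (auto simp: indicator_def)
  have i2: "integrable sphere_measure (\<lambda>\<omega>'. indicator ?B \<omega>' * ?f \<omega>)"
    by (intro integrable_mult_left S.integrable_const_bound[of _ 1]) auto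
  have "?\<nu>B - ?q * ?f \<omega> = (\<integral>\<omega>'. indicator ?B \<omega>' * ?f \<omega>' - indicator ?B \<omega>' * ?f \<omega> \<partial>sphere_measure)"
    unfolding Bochner_Integration.integral_diff[OF i1 i2]
    using direction_measure_density[OF d s, of ?B] q_int by simp
  then have "ennreal \<bar>?\<nu>B - ?q * ?f \<omega>\<bar> = ennreal (norm (\<integral>\<omega>'. indicator ?B \<omega>' * ?f \<omega>' - indicator ?B \<omega>' * ?f \<omega> \<partial>sphere_measure))"
    by simp
  also have "\<dots> \<le> (\<integral>\<^sup>+\<omega>'. ennreal (norm (indicator ?B \<omega>' * ?f \<omega>' - indicator ?B \<omega>' * ?f \<omega>)) \<partial>sphere_measure)"
    by (rule integral_norm_bound_ennreal[OF Bochner_Integration.integrable_diff[OF i1 i2]])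
  also have "\<dots> \<le> (\<integral>\<^sup>+\<omega>'. indicator ?B \<omega>' * ?D \<omega>' + indicator ?B \<omega>' * E \<partial>sphere_measure)"
  proof (rule nn_integral_mono)
    fix \<omega>'
    show "ennreal (norm (indicator ?B \<omega>' * ?f \<omega>' - indicator ?B \<omega>' * ?f \<omega>)) \<le> indicator ?B \<omega>' * ?D \<omega>' + indicator ?B \<omega>' * E"
    proof (cases "\<omega>' \<in> ?B")
      case True
      then have "norm (\<omega>' - \<omega>) \<le> 1 / 2 ^ k" using \<epsilon>(2) by (simp add: dist_norm norm_minus_commute)
      from K1(2)[OF this] have mm: "ennreal \<bar>?m \<omega>' - ?m \<omega>\<bar> \<le> ennreal K1 * ?N \<omega>" .
      have "ennreal \<bar>?f \<omega>' - ?f \<omega>\<bar> \<le> ennreal (\<bar>?f \<omega>' - ?m \<omega>'\<bar> + (\<bar>?m \<omega>' - ?m \<omega>\<bar> + \<bar>?f \<omega> - ?m \<omega>\<bar>))"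
        by (rule ennreal_leI) linarith
      also have "\<dots> = ennreal \<bar>?f \<omega>' - ?m \<omega>'\<bar> + (ennreal \<bar>?m \<omega>' - ?m \<omega>\<bar> + ennreal \<bar>?f \<omega> - ?m \<omega>\<bar>)"
        by (simp add: ennreal_plus del: ennreal_plus[symmetric])
      also have "\<dots> \<le> ?D \<omega>' + E"
        unfolding E_def by (intro add_mono mm mollification_tail_bound)
      finally show ?thesis using True by simp
    qed simp
  qed
  also have "\<dots> = (\<integral>\<^sup>+\<omega>'. indicator ?B \<omega>' * ?D \<omega>' \<partial>sphere_measure) + (\<integral>\<^sup>+\<omega>'. indicator ?B \<omega>' * E \<partial>sphere_measure)"
    by (rule nn_integral_add) measurable
  also have "(\<integral>\<^sup>+\<omega>'. indicator ?B \<omega>' * E \<partial>sphere_measure) = ennreal ?q * E"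
    unfolding nn_integral_cap[symmetric] by (rule nn_integral_multc) measurable
  also have "(\<integral>\<^sup>+\<omega>'. indicator ?B \<omega>' * ?D \<omega>' \<partial>sphere_measure) \<le>
      (\<integral>\<^sup>+\<omega>'. indicator (ball \<omega> (1 / 2 ^ k)) \<omega>' * ?D \<omega>' \<partial>sphere_measure)"
    using \<epsilon>(2) by (intro nn_integral_mono mult_right_mono) (auto simp: indicator_def)
  finally have main: "ennreal \<bar>?\<nu>B - ?q * ?f \<omega>\<bar> \<le>
      (\<integral>\<^sup>+\<omega>'. indicator (ball \<omega> (1 / 2 ^ k)) \<omega>' * ?D \<omega>' \<partial>sphere_measure) + ennreal ?q * E"
    by (simp add: add_right_mono)
  have p: "0 < \<epsilon> ^ ?n" using \<epsilon>0 by simp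
  have "1 / \<epsilon> \<le> 2 * 2 ^ k"
    using \<epsilon>(1) \<epsilon>0 by (simp add: field_simps)
  then have "(1 / \<epsilon>) ^ ?n \<le> (2 * 2 ^ k) ^ ?n" using \<epsilon>0 by (intro power_mono) auto
  then have inv: "1 / \<epsilon> ^ ?n \<le> (2 * 2 ^ k) ^ ?n" by (simp only: power_one_over)
  have dec: "direction_average (direction_measure \<mu>) \<epsilon> \<omega> - v * ?f \<omega> =
      1 / \<epsilon> ^ ?n * (?\<nu>B - ?q * ?f \<omega>) + (?q / \<epsilon> ^ ?n - v) * ?f \<omega>"
    by (simp add: direction_average_def algebra_simps diff_divide_distrib)
  have "\<bar>direction_average (direction_measure \<mu>) \<epsilon> \<omega> - v * ?f \<omega>\<bar> \<le>
      1 / \<epsilon> ^ ?n * \<bar>?\<nu>B - ?q * ?f \<omega>\<bar> + B * \<bar>?f \<omega>\<bar>"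
  proof -
    have "\<bar>(?q / \<epsilon> ^ ?n - v) * ?f \<omega>\<bar> \<le> B * \<bar>?f \<omega>\<bar>"
      unfolding abs_mult using B by (intro mult_right_mono) auto
    moreover have "\<bar>1 / \<epsilon> ^ ?n * (?\<nu>B - ?q * ?f \<omega>)\<bar> = 1 / \<epsilon> ^ ?n * \<bar>?\<nu>B - ?q * ?f \<omega>\<bar>"
      using p by (simp add: abs_mult)
    ultimately show ?thesis unfolding dec using abs_triangle_ineq by (smt (verit))
  qed
  then have "ennreal \<bar>direction_average (direction_measure \<mu>) \<epsilon> \<omega> - v * ?f \<omega>\<bar> \<le>
      ennreal (1 / \<epsilon> ^ ?n * \<bar>?\<nu>B - ?q * ?f \<omega>\<bar> + B * \<bar>?f \<omega>\<bar>)" by (rule ennreal_leI)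
  also have "\<dots> = ennreal (1 / \<epsilon> ^ ?n) * ennreal \<bar>?\<nu>B - ?q * ?f \<omega>\<bar> + ennreal B * ennreal \<bar>?f \<omega>\<bar>"
  proof -
    have "0 \<le> B" using B by linarith
    then have "ennreal (1 / \<epsilon> ^ ?n * \<bar>?\<nu>B - ?q * ?f \<omega>\<bar> + B * \<bar>?f \<omega>\<bar>) =
        ennreal (1 / \<epsilon> ^ ?n * \<bar>?\<nu>B - ?q * ?f \<omega>\<bar>) + ennreal (B * \<bar>?f \<omega>\<bar>)"
      using p by (intro ennreal_plus) auto
    then show ?thesis using p \<open>0 \<le> B\<close> by (simp only: ennreal_mult' abs_ge_zero zero_le_divide_1_iff less_imp_le)
  qed
  also have "ennreal (1 / \<epsilon> ^ ?n) * ennreal \<bar>?\<nu>B - ?q * ?f \<omega>\<bar> \<le> ennreal (1 / \<epsilon> ^ ?n) *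
      ((\<integral>\<^sup>+\<omega>'. indicator (ball \<omega> (1 / 2 ^ k)) \<omega>' * ?D \<omega>' \<partial>sphere_measure) + ennreal ?q * E)"
    by (rule mult_left_mono[OF main]) simp
  also have "\<dots> = ennreal (1 / \<epsilon> ^ ?n) * (\<integral>\<^sup>+\<omega>'. indicator (ball \<omega> (1 / 2 ^ k)) \<omega>' * ?D \<omega>' \<partial>sphere_measure)
      + ennreal (?q / \<epsilon> ^ ?n) * E"
  proof -
    have "ennreal (1 / \<epsilon> ^ ?n) * ennreal ?q = ennreal (?q / \<epsilon> ^ ?n)"
      using p by (subst ennreal_mult'[symmetric]) auto
    then show ?thesis by (simp only: distrib_left mult.assoc[symmetric])
  qed
  also have "\<dots> \<le> ennreal ((2 * 2 ^ k) ^ ?n) * (\<integral>\<^sup>+\<omega>'. indicator (ball \<omega> (1 / 2 ^ k)) \<omega>' * ?D \<omega>' \<partial>sphere_measure)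
      + ennreal A * E"
    by (intro add_mono mult_right_mono ennreal_leI inv A) auto
  finally show ?thesis unfolding E_def by (simp add: add_right_mono)
qed

section \<open>The maximal estimate\<close>

text \<open>
  The part of the bound in \<open>direction_average_remainder_bound\<close> that decays with the scale.
\<close>

definition dyadic_remainder_bound :: "'a::euclidean_space measure \<Rightarrow> real \<Rightarrow> real \<Rightarrow> real \<Rightarrow> nat \<Rightarrow> 'a \<Rightarrow> ennreal" where
  "dyadic_remainder_bound \<mu> L K A k \<omega> =
     ennreal ((2 * 2 ^ k) ^ (DIM('a) - 1)) *
       (\<integral>\<^sup>+\<omega>'. indicator (ball \<omega> (1 / 2 ^ k)) \<omega>' * mollification_tail \<mu> L k \<omega>' \<partial>sphere_measure)
     + ennreal A * (ennreal K * oscillation_majorant \<mu> (1 / 2 ^ k) \<omega> + mollification_tail \<mu> L k \<omega>)"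

text \<open>
  Averaging over caps does not increase the \<open>L\<^sup>1\<close> norm, up to the area of the caps.
\<close>

lemma nn_integral_ball_average:
  fixes g :: "'a::euclidean_space \<Rightarrow> ennreal"
  assumes [measurable]: "g \<in> borel_measurable borel"
    and cap: "\<And>\<omega>::'a. norm \<omega> = 1 \<Longrightarrow> cap_area \<rho> \<omega> \<le> A"
  shows "(\<integral>\<^sup>+\<omega>. (\<integral>\<^sup>+\<omega>'. indicator (ball \<omega> \<rho>) \<omega>' * g \<omega>' \<partial>sphere_measure) \<partial>sphere_measure) \<le>
    ennreal A * (\<integral>\<^sup>+\<omega>. g \<omega> \<partial>sphere_measure)"
proof -
  interpret S: finite_measure "sphere_measure :: 'a measure" by (rule finite_measure_sphere_measure)
  interpret SS: pair_sigma_finite "sphere_measure :: 'a measure" "sphere_measure :: 'a measure" ..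
  have id: "(\<lambda>x. x) \<in> (sphere_measure :: 'a measure) \<rightarrow>\<^sub>M borel"
    by (rule borel_measurable_sphere_measure) simp
  have "(\<lambda>p. (fst p, snd p)) \<in> (sphere_measure :: 'a measure) \<Otimes>\<^sub>M (sphere_measure :: 'a measure) \<rightarrow>\<^sub>M borel \<Otimes>\<^sub>M borel"
    by (intro measurable_Pair measurable_compose[OF measurable_fst id] measurable_compose[OF measurable_snd id])
  moreover have "(\<lambda>(\<omega>, \<omega>'). indicator (ball \<omega>' \<rho>) \<omega> * g \<omega>) \<in> borel_measurable (borel \<Otimes>\<^sub>M borel)"
    by measurable
  ultimately have meas: "(\<lambda>(\<omega>, \<omega>'). indicator (ball \<omega>' \<rho>) \<omega> * g \<omega>) \<in> borel_measurable (sphere_measure \<Otimes>\<^sub>M sphere_measure)"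
    by (auto dest: measurable_compose simp: split_beta)
  have "(\<integral>\<^sup>+\<omega>. (\<integral>\<^sup>+\<omega>'. indicator (ball \<omega> \<rho>) \<omega>' * g \<omega>' \<partial>sphere_measure) \<partial>sphere_measure) =
      (\<integral>\<^sup>+\<omega>'. (\<integral>\<^sup>+\<omega>. indicator (ball \<omega> \<rho>) \<omega>' * g \<omega>' \<partial>sphere_measure) \<partial>sphere_measure)"
    by (rule SS.Fubini'[OF meas])
  also have "\<dots> \<le> (\<integral>\<^sup>+\<omega>'. ennreal A * g \<omega>' \<partial>sphere_measure)"
  proof (rule nn_integral_mono)
    fix \<omega>' :: 'a assume "\<omega>' \<in> space sphere_measure"
    then have \<omega>': "norm \<omega>' = 1" by (simp add: space_sphere_measure)
    have "(\<integral>\<^sup>+\<omega>. indicator (ball \<omega> \<rho>) \<omega>' * g \<omega>' \<partial>sphere_measure) = (\<integral>\<^sup>+\<omega>. indicator (ball \<omega>' \<rho>) \<omega> * g \<omega>' \<partial>sphere_measure)"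
      by (rule nn_integral_cong) (simp add: indicator_def dist_commute)
    also have "\<dots> = (\<integral>\<^sup>+\<omega>. indicator (ball \<omega>' \<rho>) \<omega> \<partial>sphere_measure) * g \<omega>'"
      by (rule nn_integral_multc) measurable
    also have "\<dots> \<le> ennreal A * g \<omega>'"
      unfolding nn_integral_cap by (intro mult_right_mono ennreal_leI cap[OF \<omega>']) simp
    finally show "(\<integral>\<^sup>+\<omega>. indicator (ball \<omega> \<rho>) \<omega>' * g \<omega>' \<partial>sphere_measure) \<le> ennreal A * g \<omega>'" .
  qed
  also have "\<dots> = ennreal A * (\<integral>\<^sup>+\<omega>. g \<omega> \<partial>sphere_measure)"
    by (rule nn_integral_cmult) measurable
  finally show ?thesis .
qed

lemma (in frostman) ball_average_measurable:
  "(\<lambda>\<omega>. \<integral>\<^sup>+\<omega>'. indicator (ball \<omega> \<rho>) \<omega>' * mollification_tail \<mu> L k \<omega>' \<partial>sphere_measure) \<in> borel_measurable borel"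
proof -
  interpret S: finite_measure "sphere_measure :: 'a measure" by (rule finite_measure_sphere_measure)
  show ?thesis
    by (rule S.borel_measurable_nn_integral, rule borel_measurable_pair_sphere_measure) measurable
qed

lemma (in frostman) dyadic_remainder_bound_measurable:
  "dyadic_remainder_bound \<mu> L K A k \<in> borel_measurable borel"
proof -
  note [measurable] = ball_average_measurable oscillation_majorant_measurable[OF frostman_axioms]
  show ?thesis unfolding dyadic_remainder_bound_def by measurable
qed

lemma dyadic_remainder_bound_integral:
  fixes s :: real
  assumes d: "DIM('a::euclidean_space) \<ge> 2" and L: "L > 0" and s: "s > DIM('a) - 1" and "K1 \<ge> 0" "A \<ge> 0"
    and cap: "\<And>\<epsilon>. \<And>\<omega>::'a. \<epsilon> > 0 \<Longrightarrow> norm \<omega> = 1 \<Longrightarrow> cap_area \<epsilon> \<omega> / \<epsilon> ^ (DIM('a) - 1) \<le> A"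
  shows "\<exists>K\<ge>0. \<forall>\<mu>::'a measure. frostman \<mu> s C L \<longrightarrow> (\<forall>k.
    (\<integral>\<^sup>+\<omega>. dyadic_remainder_bound \<mu> L K1 A k \<omega> \<partial>sphere_measure) \<le> ennreal (K * (1 / 2 ^ k) powr (s - (DIM('a) - 1))))"
proof -
  let ?a = "s - (DIM('a) - 1)" and ?n = "DIM('a) - 1"
  obtain K2 where K2: "K2 \<ge> 0" "\<And>\<mu>::'a measure. \<And>n. frostman \<mu> s C L \<Longrightarrow>
    (\<integral>\<^sup>+\<omega>. mollification_tail \<mu> L n \<omega> \<partial>sphere_measure) \<le> ennreal (K2 * (1 / 2 ^ n) powr ?a)"
    using mollification_tail_integral[OF d L s, of C] by blast
  obtain K3 where K3: "K3 \<ge> 0" "\<And>\<mu>::'a measure. \<And>\<rho>. frostman \<mu> s C L \<Longrightarrow> \<rho> > 0 \<Longrightarrow>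
    (\<integral>\<^sup>+\<omega>. oscillation_majorant \<mu> \<rho> \<omega> \<partial>sphere_measure) \<le> ennreal (K3 * \<rho> powr ?a)"
    using oscillation_majorant_integral[where 'a='a, of s C L] by blast
  let ?K = "2 ^ ?n * A * K2 + A * (K1 * K3 + K2)"
  have "(\<integral>\<^sup>+\<omega>. dyadic_remainder_bound \<mu> L K1 A k \<omega> \<partial>sphere_measure) \<le> ennreal (?K * (1 / 2 ^ k) powr ?a)"
    if fr: "frostman \<mu> s C L" for \<mu> :: "'a measure" and k
  proof -
    interpret frostman \<mu> s C L by fact
    note [measurable] = ball_average_measurable oscillation_majorant_measurable[OF fr]
    let ?\<rho> = "1 / 2 ^ k :: real"
    let ?p = "?\<rho> powr ?a"
    let ?D = "mollification_tail \<mu> L k" and ?N = "oscillation_majorant \<mu> ?\<rho>"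
    have ID: "(\<integral>\<^sup>+\<omega>. ?D \<omega> \<partial>sphere_measure) \<le> ennreal (K2 * ?p)" by (rule K2(2)[OF fr])
    have IN: "(\<integral>\<^sup>+\<omega>. ?N \<omega> \<partial>sphere_measure) \<le> ennreal (K3 * ?p)" by (rule K3(2)[OF fr]) simp
    have "cap_area ?\<rho> \<omega> \<le> A * ?\<rho> ^ ?n" if "norm \<omega> = 1" for \<omega> :: 'a
      using cap[of ?\<rho> \<omega>] that by (simp add: pos_divide_le_eq del: power_one_over)
    from nn_integral_ball_average[OF _ this, of ?D]
    have avg: "(\<integral>\<^sup>+\<omega>. (\<integral>\<^sup>+\<omega>'. indicator (ball \<omega> ?\<rho>) \<omega>' * ?D \<omega>' \<partial>sphere_measure) \<partial>sphere_measure)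
        \<le> ennreal (A * ?\<rho> ^ ?n) * (\<integral>\<^sup>+\<omega>. ?D \<omega> \<partial>sphere_measure)"
      by simp
    have "(\<integral>\<^sup>+\<omega>. dyadic_remainder_bound \<mu> L K1 A k \<omega> \<partial>sphere_measure) =
      ennreal ((2 * 2 ^ k) ^ ?n) * (\<integral>\<^sup>+\<omega>. (\<integral>\<^sup>+\<omega>'. indicator (ball \<omega> ?\<rho>) \<omega>' * ?D \<omega>' \<partial>sphere_measure) \<partial>sphere_measure)
      + ennreal A * (ennreal K1 * (\<integral>\<^sup>+\<omega>. ?N \<omega> \<partial>sphere_measure) + (\<integral>\<^sup>+\<omega>. ?D \<omega> \<partial>sphere_measure))"
      unfolding dyadic_remainder_bound_def
      by (simp add: nn_integral_add nn_integral_cmult borel_measurable_sphere_measure)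
    also have "\<dots> \<le> ennreal ((2 * 2 ^ k) ^ ?n) * (ennreal (A * ?\<rho> ^ ?n) * ennreal (K2 * ?p))
      + ennreal A * (ennreal K1 * ennreal (K3 * ?p) + ennreal (K2 * ?p))"
    proof (intro add_mono mult_left_mono)
      show "(\<integral>\<^sup>+\<omega>. (\<integral>\<^sup>+\<omega>'. indicator (ball \<omega> ?\<rho>) \<omega>' * ?D \<omega>' \<partial>sphere_measure) \<partial>sphere_measure)
        \<le> ennreal (A * ?\<rho> ^ ?n) * ennreal (K2 * ?p)"
        by (rule order_trans[OF avg]) (rule mult_left_mono[OF ID], simp)
    qed (use ID IN in simp_all)
    also have "\<dots> = ennreal ((2 * 2 ^ k) ^ ?n * ((A * ?\<rho> ^ ?n) * (K2 * ?p)) + A * (K1 * (K3 * ?p) + K2 * ?p))"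
      using \<open>K1 \<ge> 0\<close> \<open>A \<ge> 0\<close> K2(1) K3(1) by (simp add: ennreal_mult ennreal_plus)
    also have "(2 * 2 ^ k) ^ ?n * ((A * ?\<rho> ^ ?n) * (K2 * ?p)) + A * (K1 * (K3 * ?p) + K2 * ?p) = ?K * ?p"
    proof -
      have "(2 * 2 ^ k) ^ ?n * ?\<rho> ^ ?n = (2 * 2 ^ k * ?\<rho>) ^ ?n" by (rule power_mult_distrib[symmetric])
      also have "\<dots> = 2 ^ ?n" by simp
      finally have "((2 * 2 ^ k) ^ ?n * ?\<rho> ^ ?n) * (A * K2 * ?p) = 2 ^ ?n * (A * K2 * ?p)"
        by (rule arg_cong[where f="\<lambda>x. x * (A * K2 * ?p)"])
      then have "(2 * 2 ^ k) ^ ?n * ((A * ?\<rho> ^ ?n) * (K2 * ?p)) = 2 ^ ?n * A * K2 * ?p"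
        by (simp only: mult_ac)
      then show ?thesis by (simp add: algebra_simps)
    qed
    finally show ?thesis .
  qed
  moreover have "?K \<ge> 0" using \<open>K1 \<ge> 0\<close> \<open>A \<ge> 0\<close> K2(1) K3(1) by simp
  ultimately show ?thesis by blast
qed

lemma dyadic_scale_exists:
  fixes \<epsilon> :: real
  assumes "0 < \<epsilon>" "\<epsilon> \<le> 1"
  shows "\<exists>k. 1 / 2 ^ Suc k < \<epsilon> \<and> \<epsilon> \<le> 1 / 2 ^ k"
proof -
  have "\<exists>n. (1 / 2) ^ n < \<epsilon>" using assms by (intro real_arch_pow_inv) auto
  then have ex: "\<exists>n. 1 / 2 ^ n < \<epsilon>" by (simp add: power_one_over)
  define n where "n = (LEAST n. 1 / 2 ^ n < \<epsilon>)"
  have n: "1 / 2 ^ n < \<epsilon>" unfolding n_def using ex by (rule LeastI_ex)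
  then have "n \<noteq> 0" using assms by (cases n) auto
  then obtain k where k: "n = Suc k" using not0_implies_Suc by blast
  then have "\<not> 1 / 2 ^ k < \<epsilon>" unfolding n_def using not_less_Least[of k "\<lambda>n. 1 / 2 ^ n < \<epsilon>"] by simp
  with n k show ?thesis by auto
qed

text \<open>
  Every \<open>\<epsilon> < c\<close> with \<open>\<epsilon> \<le> 1\<close> lies in some dyadic block below \<open>2c\<close>, so the supremum is bounded by the
  sum of the dyadic bounds, a geometric series of ratio \<open>2\<^sup>-\<^sup>a\<close> with \<open>a = s - (d - 1) > 0\<close>.  The error in
  the cap area is at most a multiple of \<open>min 1 c \<le> c\<^sup>a\<close>; here \<open>a \<le> 1\<close>, that is, \<open>s \<le> d\<close>, is
  used.  For \<open>c > 1\<close> the radii beyond \<open>1\<close> contribute a constant, which is at most a multiple of \<open>c\<^sup>a\<close>.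
\<close>

lemma maximal_remainder_estimate:
  fixes s C L :: real
  assumes d: "DIM('a::euclidean_space) \<ge> 2" and L: "L > 0" and s: "s > DIM('a) - 1"
  shows "\<exists>K>0. \<forall>\<mu>::'a measure. frostman \<mu> s C L \<longrightarrow> (\<forall>c>0.
    (\<integral>\<^sup>+\<omega>. (SUP \<epsilon>\<in>{0<..<c}. ennreal \<bar>direction_average (direction_measure \<mu>) \<epsilon> \<omega> -
        sphere_cap_constant TYPE('a) * direction_density \<mu> L \<omega>\<bar>) \<partial>sphere_measure)
      \<le> ennreal (K * c powr (s - (DIM('a) - 1))))"
proof -
  let ?a = "s - (DIM('a) - 1)" and ?n = "DIM('a) - 1" and ?v = "sphere_cap_constant TYPE('a)"
  have a: "?a > 0" using s by simp
  have v: "?v > 0" by (rule sphere_cap_constant_pos)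
  interpret S: finite_measure "sphere_measure :: 'a measure" by (rule finite_measure_sphere_measure)
  define S where "S = measure sphere_measure (space (sphere_measure :: 'a measure))"
  have S: "S \<ge> 0" "emeasure sphere_measure (space (sphere_measure :: 'a measure)) = ennreal S"
    by (simp_all add: S_def S.emeasure_eq_measure)
  obtain B where B: "B \<ge> 0" "\<And>\<epsilon>. \<And>\<omega>::'a. \<epsilon> > 0 \<Longrightarrow> norm \<omega> = 1 \<Longrightarrow> \<bar>cap_area \<epsilon> \<omega> / \<epsilon> ^ ?n - ?v\<bar> \<le> B * min 1 \<epsilon>"
    using cap_area_asymptotics[where 'a='a] by blast
  define A where "A = ?v + B"
  have A0: "A \<ge> 0" using v B(1) by (simp add: A_def)
  have A: "cap_area \<epsilon> \<omega> / \<epsilon> ^ ?n \<le> A" if "\<epsilon> > 0" "norm \<omega> = 1" for \<epsilon> and \<omega> :: 'a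
  proof -
    have "B * min 1 \<epsilon> \<le> B * 1" using B(1) by (intro mult_left_mono) auto
    then show ?thesis using B(2)[OF that] unfolding A_def by linarith
  qed
  obtain K1 where K1: "K1 \<ge> 0" "\<And>\<mu>::'a measure. \<And>\<rho> \<omega> \<omega>'. frostman \<mu> s C L \<Longrightarrow> \<rho> > 0 \<Longrightarrow> norm (\<omega>' - \<omega>) \<le> \<rho> \<Longrightarrow>
    ennreal \<bar>mollified_density \<mu> L \<rho> \<omega>' - mollified_density \<mu> L \<rho> \<omega>\<bar> \<le> ennreal K1 * oscillation_majorant \<mu> \<rho> \<omega>"
    using mollified_density_oscillation[OF d L, of s C] by blast
  obtain K2 where K2: "K2 \<ge> 0" "\<And>\<mu>::'a measure. \<And>k. frostman \<mu> s C L \<Longrightarrow>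
    (\<integral>\<^sup>+\<omega>. dyadic_remainder_bound \<mu> L K1 A k \<omega> \<partial>sphere_measure) \<le> ennreal (K2 * (1 / 2 ^ k) powr ?a)"
    using dyadic_remainder_bound_integral[OF d L s K1(1) A0 A, of C] by blast
  define K4 where "K4 = K2 / (1 - (1 / 2) powr ?a)"
  have "(1 / 2 :: real) powr ?a \<le> 1 powr ?a" using a by (intro powr_mono2) auto
  then have K4: "K4 \<ge> 0" using K2(1) by (simp add: K4_def)
  define K where "K = K4 * 2 powr ?a + B + S + ?v"
  have K: "K > 0" using K4 B(1) S(1) v by (simp add: K_def add_nonneg_pos)
  have "(\<integral>\<^sup>+\<omega>. (SUP \<epsilon>\<in>{0<..<c}. ennreal \<bar>direction_average (direction_measure \<mu>) \<epsilon> \<omega> -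
        ?v * direction_density \<mu> L \<omega>\<bar>) \<partial>sphere_measure) \<le> ennreal (K * c powr ?a)"
    if fr: "frostman \<mu> s C L" and c: "c > 0" for \<mu> :: "'a measure" and c
  proof -
    interpret frostman \<mu> s C L by fact
    interpret N: prob_space "direction_measure \<mu>" by (rule prob_space_direction_measure[OF fr])
    note [measurable] = dyadic_remainder_bound_measurable
    let ?f = "direction_density \<mu> L" and ?G = "dyadic_remainder_bound \<mu> L K1 A"
    let ?R = "\<lambda>\<epsilon> \<omega>. ennreal \<bar>direction_average (direction_measure \<mu>) \<epsilon> \<omega> - ?v * ?f \<omega>\<bar>"
    have a1: "?a \<le> 1" using exponent_le_DIM d by (simp add: of_nat_diff)
    have min_le: "min 1 c \<le> c powr ?a"
    proof (cases "c \<le> 1")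
      case True
      then have "c powr 1 \<le> c powr ?a" using c a1 by (intro powr_mono') auto
      then show ?thesis using True c by simp
    next
      case False
      then have "1 powr ?a \<le> c powr ?a" using a by (intro powr_mono2) auto
      then show ?thesis using False by simp
    qed
    \<comment> \<open>The first dyadic scale that meets the radii below \<open>c\<close>; for \<open>c > 1\<close> the sum starts at scale \<open>1\<close>.\<close>
    obtain j where j: "(1 / 2 ^ j) \<le> 2 * c" "\<And>k \<epsilon>. 0 < \<epsilon> \<Longrightarrow> \<epsilon> < c \<Longrightarrow> 1 / 2 ^ Suc k < \<epsilon> \<Longrightarrow> j \<le> k"
    proof (cases "c \<le> 1")
      case True
      obtain j where "1 / 2 ^ Suc j < c" "c \<le> 1 / 2 ^ j" using dyadic_scale_exists[OF c True] by blast
      moreover have "j \<le> k" if "\<epsilon> < c" "1 / 2 ^ Suc k < \<epsilon>" for k \<epsilon>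
      proof (rule ccontr)
        assume "\<not> j \<le> k"
        then have "(1 / 2 ^ j :: real) \<le> 1 / 2 ^ Suc k" by (intro divide_left_mono power_increasing) auto
        then show False using that \<open>c \<le> 1 / 2 ^ j\<close> by linarith
      qed
      ultimately show ?thesis by (intro that[of j]) auto
    next
      case False
      then show ?thesis by (intro that[of 0]) auto
    qed
    \<comment> \<open>\<open>H\<close> switches on the contribution of the radii beyond \<open>1\<close>.\<close>
    define H where "H = (if c \<le> 1 then 0 else 1 :: real)"
    have H: "0 \<le> H" "H \<le> c powr ?a"
      using min_le by (auto simp: H_def min_def split: if_splits)
    have bound: "?R \<epsilon> \<omega> \<le> (\<Sum>i. ?G (i + j) \<omega>) + ennreal (B * c powr ?a) * ennreal \<bar>?f \<omega>\<bar> +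
        ennreal H * (1 + ennreal ?v * ennreal \<bar>?f \<omega>\<bar>)"
      if \<omega>: "norm \<omega> = 1" and \<epsilon>: "0 < \<epsilon>" "\<epsilon> < c" for \<epsilon> \<omega>
    proof (cases "\<epsilon> \<le> 1")
      case True
      obtain k where k: "1 / 2 ^ Suc k < \<epsilon>" "\<epsilon> \<le> 1 / 2 ^ k" using dyadic_scale_exists[OF \<epsilon>(1) True] by blast
      have jk: "j \<le> k" using j(2)[OF \<epsilon> k(1)] .
      have "B * min 1 \<epsilon> \<le> B * c powr ?a"
        using min_le \<epsilon> by (intro mult_left_mono B(1)) auto
      with B(2)[OF \<epsilon>(1) \<omega>] have B': "\<bar>cap_area \<epsilon> \<omega> / \<epsilon> ^ ?n - ?v\<bar> \<le> B * c powr ?a" by linarith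
      have "?R \<epsilon> \<omega> \<le> ?G k \<omega> + ennreal (B * c powr ?a) * ennreal \<bar>?f \<omega>\<bar>"
        unfolding dyadic_remainder_bound_def
        by (rule direction_average_remainder_bound[OF d s \<omega> less_imp_le[OF k(1)] k(2) K1(1) K1(2)[OF fr] A[OF \<epsilon>(1) \<omega>] B']) simp_all
      also have "?G k \<omega> \<le> (\<Sum>i. ?G (i + j) \<omega>)"
      proof -
        have "?G k \<omega> = (\<Sum>i\<in>{k - j}. ?G (i + j) \<omega>)" using jk by simp
        also have "\<dots> \<le> (\<Sum>i. ?G (i + j) \<omega>)" by (rule sum_le_suminf) auto
        finally show ?thesis .
      qed
      finally have "?R \<epsilon> \<omega> \<le> (\<Sum>i. ?G (i + j) \<omega>) + ennreal (B * c powr ?a) * ennreal \<bar>?f \<omega>\<bar>"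
        by (simp add: add_right_mono)
      then show ?thesis by (rule order_trans) simp
    next
      case False
      have "0 \<le> direction_average (direction_measure \<mu>) \<epsilon> \<omega>" "direction_average (direction_measure \<mu>) \<epsilon> \<omega> \<le> 1"
      proof -
        have "1 \<le> \<epsilon> ^ ?n" using False by (intro one_le_power) auto
        then have "measure (direction_measure \<mu>) (ball \<omega> \<epsilon>) / \<epsilon> ^ ?n \<le> 1 / 1"
          by (intro frac_le) auto
        then show "direction_average (direction_measure \<mu>) \<epsilon> \<omega> \<le> 1" by (simp add: direction_average_def)
        show "0 \<le> direction_average (direction_measure \<mu>) \<epsilon> \<omega>" using \<epsilon> by (simp add: direction_average_def)
      qed
      moreover have "\<bar>?v * ?f \<omega>\<bar> = ?v * \<bar>?f \<omega>\<bar>" using v by (simp add: abs_mult)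
      ultimately have "\<bar>direction_average (direction_measure \<mu>) \<epsilon> \<omega> - ?v * ?f \<omega>\<bar> \<le> 1 + ?v * \<bar>?f \<omega>\<bar>" by linarith
      then have "?R \<epsilon> \<omega> \<le> ennreal (1 + ?v * \<bar>?f \<omega>\<bar>)" by (rule ennreal_leI)
      also have "\<dots> = ennreal H * (1 + ennreal ?v * ennreal \<bar>?f \<omega>\<bar>)"
        using False \<epsilon> v by (simp add: H_def ennreal_plus ennreal_mult')
      finally show ?thesis by (rule order_trans) simp
    qed
    have "(\<integral>\<^sup>+\<omega>. (SUP \<epsilon>\<in>{0<..<c}. ?R \<epsilon> \<omega>) \<partial>sphere_measure) \<le>
      (\<integral>\<^sup>+\<omega>. (\<Sum>i. ?G (i + j) \<omega>) + ennreal (B * c powr ?a) * ennreal \<bar>?f \<omega>\<bar> +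
        ennreal H * (1 + ennreal ?v * ennreal \<bar>?f \<omega>\<bar>) \<partial>sphere_measure)"
      by (intro nn_integral_mono SUP_least bound) (auto simp: space_sphere_measure)
    also have "\<dots> = (\<integral>\<^sup>+\<omega>. (\<Sum>i. ?G (i + j) \<omega>) \<partial>sphere_measure) +
        ennreal (B * c powr ?a) * (\<integral>\<^sup>+\<omega>. ennreal \<bar>?f \<omega>\<bar> \<partial>sphere_measure) +
        ennreal H * (ennreal S + ennreal ?v * (\<integral>\<^sup>+\<omega>. ennreal \<bar>?f \<omega>\<bar> \<partial>sphere_measure))"
      by (simp add: nn_integral_add nn_integral_cmult borel_measurable_sphere_measure S(2))
    also have "\<dots> = (\<Sum>i. \<integral>\<^sup>+\<omega>. ?G (i + j) \<omega> \<partial>sphere_measure) + ennreal (B * c powr ?a) + ennreal H * (ennreal S + ennreal ?v)"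
      unfolding direction_density_integral(2)[OF d s]
      by (subst nn_integral_suminf) (simp_all add: borel_measurable_sphere_measure)
    also have "\<dots> \<le> ennreal (K4 * (2 powr ?a * c powr ?a)) + ennreal (B * c powr ?a) + ennreal (c powr ?a * (S + ?v))"
    proof (intro add_mono order_refl)
      have "(\<Sum>i. \<integral>\<^sup>+\<omega>. ?G (i + j) \<omega> \<partial>sphere_measure) \<le> (\<Sum>i. ennreal (K2 * (1 / 2 ^ (i + j)) powr ?a))"
        by (intro suminf_le K2(2)[OF fr]) auto
      also have "\<dots> = ennreal (K4 * (1 / 2 ^ j) powr ?a)"
        unfolding K4_def by (rule suminf_dyadic_powr[OF a K2(1)])
      also have "\<dots> \<le> ennreal (K4 * (2 * c) powr ?a)"
        using j(1) a by (intro ennreal_leI mult_left_mono powr_mono2 K4) auto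
      also have "(2 * c) powr ?a = 2 powr ?a * c powr ?a" using c by (simp add: powr_mult)
      finally show "(\<Sum>i. \<integral>\<^sup>+\<omega>. ?G (i + j) \<omega> \<partial>sphere_measure) \<le> ennreal (K4 * (2 powr ?a * c powr ?a))" .
      have "ennreal H * (ennreal S + ennreal ?v) = ennreal (H * (S + ?v))"
        using H(1) S(1) v by (simp add: ennreal_mult ennreal_plus)
      also have "\<dots> \<le> ennreal (c powr ?a * (S + ?v))"
        using H(2) S(1) v by (intro ennreal_leI mult_right_mono) auto
      finally show "ennreal H * (ennreal S + ennreal ?v) \<le> ennreal (c powr ?a * (S + ?v))" .
    qed
    also have "\<dots> = ennreal (K4 * (2 powr ?a * c powr ?a) + B * c powr ?a + c powr ?a * (S + ?v))"
      using K4 B(1) S(1) v by (simp add: ennreal_plus)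
    also have "K4 * (2 powr ?a * c powr ?a) + B * c powr ?a + c powr ?a * (S + ?v) = K * c powr ?a"
      by (simp add: K_def algebra_simps)
    finally show ?thesis .
  qed
  with K show ?thesis by blast
qed

section \<open>Rotations and the set of directions\<close>

text \<open>
  Directions do not depend on whether \<open>N\<close> is regarded as a measure on a subset or on the whole
  space.
\<close>

lemma direction_measure_distr_id:
  fixes N :: "'a::euclidean_space measure"
  assumes "prob_space N" and id: "(\<lambda>x. x) \<in> N \<rightarrow>\<^sub>M borel"
  shows "direction_measure (distr N borel (\<lambda>x. x)) = direction_measure N"
proof -
  interpret N: prob_space N by fact
  interpret D: prob_space "distr N borel (\<lambda>x. x)" by (rule N.prob_space_distr[OF id])
  have pair: "distr N borel (\<lambda>x. x) \<Otimes>\<^sub>M distr N borel (\<lambda>x. x) = distr (N \<Otimes>\<^sub>M N) (borel \<Otimes>\<^sub>M borel) (\<lambda>(x, y). (x, y))"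
    by (rule pair_measure_distr[OF id id D.sigma_finite_measure_axioms])
  have m: "(\<lambda>(x, y). (x, y)) \<in> N \<Otimes>\<^sub>M N \<rightarrow>\<^sub>M borel \<Otimes>\<^sub>M borel"
    unfolding split_beta
    by (intro measurable_Pair measurable_compose[OF measurable_fst id] measurable_compose[OF measurable_snd id])
  have dir: "(\<lambda>(x, y). (x - y) /\<^sub>R norm (x - y)) \<in> borel_measurable (borel \<Otimes>\<^sub>M (borel :: 'a measure))"
    unfolding split_beta by measurable
  show ?thesis
    unfolding direction_measure_def pair distr_distr[OF dir m]
    by (simp add: comp_def split_beta')
qed

text \<open>
  The supremum ranges over uncountably many radii, but open balls make the mass left-continuous in
  the radius, so rational radii suffice.
\<close>

lemma average_remainder_sup_measurable:
  fixes \<nu> :: "'a::euclidean_space measure" and g :: "'a \<Rightarrow> real"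
  assumes "finite_measure \<nu>" and sets_\<nu> [measurable_cong]: "sets \<nu> = sets borel"
    and [measurable]: "g \<in> borel_measurable borel"
  shows "(\<lambda>\<omega>. SUP \<epsilon>\<in>{0<..<c}. ennreal \<bar>direction_average \<nu> \<epsilon> \<omega> - g \<omega>\<bar>) \<in> borel_measurable borel"
proof -
  interpret finite_measure \<nu> by fact
  let ?h = "\<lambda>\<epsilon> \<omega>. ennreal \<bar>direction_average \<nu> \<epsilon> \<omega> - g \<omega>\<bar>"
  have [measurable]: "(\<lambda>\<omega>. measure \<nu> (ball \<omega> \<epsilon>)) \<in> borel_measurable borel" for \<epsilon>
  proof -
    have "(\<lambda>\<omega>. enn2real (\<integral>\<^sup>+x. indicator (ball \<omega> \<epsilon>) x \<partial>\<nu>)) \<in> borel_measurable borel"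
      by measurable
    then show ?thesis by (simp add: measure_def sets_\<nu>)
  qed
  have h_meas: "?h \<epsilon> \<in> borel_measurable borel" for \<epsilon>
    unfolding direction_average_def by measurable
  have left: "?h \<epsilon> \<omega> \<le> (SUP \<delta>\<in>{0<..<c} \<inter> \<rat>. ?h \<delta> \<omega>)" if \<epsilon>: "0 < \<epsilon>" "\<epsilon> < c" for \<epsilon> \<omega>
  proof -
    \<comment> \<open>Rational points chosen between consecutive \<open>l i\<close> increase to \<open>\<epsilon>\<close>.\<close>
    define l where "l i = \<epsilon> - \<epsilon> / real (i + 2)" for i :: nat
    have l_less: "l i < l (Suc i)" for i
      using \<epsilon> by (simp add: l_def frac_less2)
    have "\<forall>i. \<exists>q\<in>\<rat>. l i < q \<and> q < l (Suc i)"
      using Rats_dense_in_real[OF l_less] by blast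
    then obtain q where q: "\<And>i. q i \<in> \<rat>" "\<And>i. l i < q i" "\<And>i. q i < l (Suc i)" by metis
    have l0: "0 < l i" for i
    proof -
      have "\<epsilon> / real (i + 2) < \<epsilon> / 1" using \<epsilon> by (intro divide_strict_left_mono) auto
      then show ?thesis by (simp add: l_def)
    qed
    have l\<epsilon>: "l i < \<epsilon>" for i using \<epsilon> by (simp add: l_def)
    have q_range: "0 < q i" "q i < \<epsilon>" for i
      using q(2,3)[of i] l0[of i] l\<epsilon>[of "Suc i"] by linarith+
    have "incseq q"
      by (rule incseq_SucI) (use q(2,3) less_trans less_imp_le in metis)
    have "(\<lambda>i. \<epsilon> * inverse (real (Suc (Suc i)))) \<longlonglongrightarrow> \<epsilon> * 0"
      using LIMSEQ_Suc[OF LIMSEQ_inverse_real_of_nat] by (rule tendsto_mult[OF tendsto_const])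
    then have "(\<lambda>i. \<epsilon> - \<epsilon> * inverse (real (Suc (Suc i)))) \<longlonglongrightarrow> \<epsilon> - \<epsilon> * 0"
      by (rule tendsto_diff[OF tendsto_const])
    then have l_lim: "l \<longlonglongrightarrow> \<epsilon>" by (simp add: l_def[abs_def] divide_inverse add.commute)
    have q_lim: "q \<longlonglongrightarrow> \<epsilon>"
      by (rule tendsto_sandwich[OF _ _ l_lim tendsto_const])
        (auto intro!: always_eventually less_imp_le q(2) q_range)
    have "incseq (\<lambda>i. ball \<omega> (q i))"
      using \<open>incseq q\<close> by (simp add: incseq_def subset_ball)
    moreover have "(\<Union>i. ball \<omega> (q i)) = ball \<omega> \<epsilon>"
    proof (intro equalityI subsetI)
      fix x assume "x \<in> ball \<omega> \<epsilon>"
      then have "dist \<omega> x < \<epsilon>" by simp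
      from order_tendstoD(1)[OF q_lim this] obtain i where "dist \<omega> x < q i"
        by (auto simp: eventually_sequentially)
      then show "x \<in> (\<Union>i. ball \<omega> (q i))" by auto
    qed (use q_range in \<open>auto intro: less_trans\<close>)
    ultimately have "(\<lambda>i. measure \<nu> (ball \<omega> (q i))) \<longlonglongrightarrow> measure \<nu> (ball \<omega> \<epsilon>)"
      using finite_Lim_measure_incseq[of "\<lambda>i. ball \<omega> (q i)"] by (simp add: sets_\<nu> image_subset_iff)
    then have "(\<lambda>i. direction_average \<nu> (q i) \<omega>) \<longlonglongrightarrow> direction_average \<nu> \<epsilon> \<omega>"
      unfolding direction_average_def using \<epsilon> by (intro tendsto_divide tendsto_power q_lim) auto
    then have "(\<lambda>i. ?h (q i) \<omega>) \<longlonglongrightarrow> ?h \<epsilon> \<omega>"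
      by (intro tendsto_ennrealI tendsto_rabs tendsto_diff tendsto_const)
    then show ?thesis
    proof (rule LIMSEQ_le_const2)
      have "q i \<in> {0<..<c} \<inter> \<rat>" for i
        using q(1)[of i] q_range[of i] \<epsilon> by auto
      then show "\<exists>N. \<forall>i\<ge>N. ?h (q i) \<omega> \<le> (SUP \<delta>\<in>{0<..<c} \<inter> \<rat>. ?h \<delta> \<omega>)"
        by (intro exI[of _ 0] allI impI SUP_upper)
    qed
  qed
  have "(SUP \<epsilon>\<in>{0<..<c}. ?h \<epsilon> \<omega>) = (SUP \<delta>\<in>{0<..<c} \<inter> \<rat>. ?h \<delta> \<omega>)" for \<omega>
    by (intro antisym SUP_least left SUP_subset_mono) auto
  moreover have "(\<lambda>\<omega>. SUP \<delta>\<in>{0<..<c} \<inter> \<rat>. ?h \<delta> \<omega>) \<in> borel_measurable borel"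
    by (intro borel_measurable_SUP h_meas countable_Int2 countable_rat)
  ultimately show ?thesis by simp
qed

lemma measurable_id_frostman_measure:
  assumes "frostman_measure s E \<mu>"
  shows "(\<lambda>x. x) \<in> \<mu> \<rightarrow>\<^sub>M borel" "space \<mu> = E"
proof -
  have sets: "sets \<mu> = sets (restrict_space borel E)" using assms by (simp add: frostman_measure_def)
  have "(\<lambda>x. x) \<in> restrict_space borel E \<rightarrow>\<^sub>M borel"
    by (rule measurable_restrict_space1) simp
  then show "(\<lambda>x. x) \<in> \<mu> \<rightarrow>\<^sub>M borel"
    by (simp only: measurable_cong_sets[OF sets refl])
  show "space \<mu> = E" using sets_eq_imp_space_eq[OF sets] by (simp add: space_restrict_space)
qed

text \<open>
  Rotations preserve balls around the origin and map balls to balls of the same radius, so one pair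
  of constants serves all of them.
\<close>

lemma frostman_measure_rotations:
  fixes \<mu> :: "'a::euclidean_space measure"
  assumes \<mu>: "frostman_measure s E \<mu>"
  obtains C L where "0 < L"
    "\<And>\<Theta> :: 'a \<Rightarrow> 'a. orthogonal_transformation \<Theta> \<Longrightarrow> frostman (distr \<mu> borel \<Theta>) s C L"
proof -
  note id = measurable_id_frostman_measure[OF \<mu>]
  interpret prob_space \<mu> using \<mu> by (simp add: frostman_measure_def)
  obtain \<rho> C where \<rho>: "measure \<mu> (ball 0 \<rho> \<inter> E) = 1" and C: "C > 0"
    and growth: "\<And>x r. r > 0 \<Longrightarrow> measure \<mu> (ball x r \<inter> E) \<le> C * r powr s"
    using \<mu> by (auto simp: frostman_measure_def)
  have "\<rho> > 0"
  proof (rule ccontr)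
    assume "\<not> \<rho> > 0"
    then have "ball (0::'a) \<rho> = {}" by simp
    with \<rho> have "measure \<mu> ({} \<inter> E) = 1" by metis
    then show False by simp
  qed
  have "frostman (distr \<mu> borel \<Theta>) s C (2 * \<rho>)" if \<Theta>: "orthogonal_transformation \<Theta>" for \<Theta> :: "'a \<Rightarrow> 'a"
  proof -
    have meas: "\<Theta> \<in> \<mu> \<rightarrow>\<^sub>M borel"
      using measurable_compose[OF id(1) orthogonal_transformation_borel[OF \<Theta>]] .
    have ball: "measure (distr \<mu> borel \<Theta>) (ball (\<Theta> y) r) = measure \<mu> (ball y r \<inter> E)" for y r
    proof -
      have "\<Theta> -` ball (\<Theta> y) r = ball y r"
        using \<Theta> by (auto simp: orthogonal_transformation_isometry)
      then show ?thesis using meas by (simp add: measure_distr id(2))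
    qed
    have zero: "\<Theta> 0 = 0" using orthogonal_transformation_linear[OF \<Theta>] by (rule linear_0)
    interpret D: prob_space "distr \<mu> borel \<Theta>" by (rule prob_space_distr[OF meas])
    show ?thesis
    proof
      show "measure (distr \<mu> borel \<Theta>) (ball 0 (2 * \<rho> / 2)) = 1"
        using ball[of 0 \<rho>] \<rho> by (simp add: zero)
      show "measure (distr \<mu> borel \<Theta>) (ball x r) \<le> C * r powr s" if "0 < r" for r x
      proof -
        obtain y where "\<Theta> y = x" using orthogonal_transformation_surj[OF \<Theta>] by (metis surjD)
        then show ?thesis using ball[of y r] growth[OF that, of y] by simp
      qed
    qed (use C \<open>\<rho> > 0\<close> in simp_all)
  qed
  then show ?thesis using \<open>\<rho> > 0\<close> by (intro that[of "2 * \<rho>" C]) auto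
qed

lemma rotated_direction_measure_eq:
  fixes \<mu> :: "'a::euclidean_space measure"
  assumes \<mu>: "frostman_measure s E \<mu>" and \<Theta>: "orthogonal_transformation \<Theta>"
  shows "rotated_direction_measure \<Theta> E \<mu> = direction_measure (distr \<mu> borel \<Theta>)"
proof -
  note id = measurable_id_frostman_measure[OF \<mu>]
  interpret prob_space \<mu> using \<mu> by (simp add: frostman_measure_def)
  have meas: "\<Theta> \<in> \<mu> \<rightarrow>\<^sub>M borel"
    using measurable_compose[OF id(1) orthogonal_transformation_borel[OF \<Theta>]] .
  let ?N = "distr \<mu> (restrict_space borel (\<Theta> ` E)) \<Theta>"
  have meas': "\<Theta> \<in> \<mu> \<rightarrow>\<^sub>M restrict_space borel (\<Theta> ` E)"
    by (rule measurable_restrict_space2) (use id(2) meas in auto)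
  have "(\<lambda>x. x) \<in> restrict_space borel (\<Theta> ` E) \<rightarrow>\<^sub>M borel"
    by (rule measurable_restrict_space1) simp
  then have idN: "(\<lambda>x. x) \<in> ?N \<rightarrow>\<^sub>M borel" by simp
  have "distr ?N borel (\<lambda>x. x) = distr \<mu> borel \<Theta>"
    using distr_distr[OF _ meas', of "\<lambda>x. x" borel] idN by (simp add: comp_def)
  then show ?thesis
    unfolding rotated_direction_measure_def
    using direction_measure_distr_id[OF prob_space_distr[OF meas'] idN] by simp
qed

text \<open>
  A null set containing all directions would carry the full mass of the direction measure, which
  has a density with respect to surface measure.
\<close>

lemma outer_measure_directions_pos:
  fixes \<mu> :: "'a::euclidean_space measure"
  assumes \<mu>: "frostman_measure s E \<mu>" and d: "DIM('a) \<ge> 2" and s: "s > DIM('a) - 1"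
  shows "outer_measure_of sphere_measure (directions E) > 0"
proof (rule ccontr)
  assume "\<not> ?thesis"
  then have zero: "outer_measure_of sphere_measure (directions E) = 0"
    by (simp add: zero_less_iff_neq_zero)
  have dir_sphere: "directions E \<subseteq> space (sphere_measure :: 'a measure)"
    by (auto simp: directions_def space_sphere_measure)
  obtain B where B: "B \<in> sets (sphere_measure :: 'a measure)" "directions E \<subseteq> B" "emeasure sphere_measure B = 0"
    using outer_measure_of_attain[OF dir_sphere] zero by auto
  have B_borel [measurable]: "B \<in> sets borel"
    using B(1) by (auto simp: sets_sphere_measure sets_restrict_space_iff)
  note id = measurable_id_frostman_measure[OF \<mu>]
  obtain C L where fr: "\<And>\<Theta> :: 'a \<Rightarrow> 'a. orthogonal_transformation \<Theta> \<Longrightarrow> frostman (distr \<mu> borel \<Theta>) s C L"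
    using frostman_measure_rotations[OF \<mu>] by blast
  interpret \<mu>: prob_space \<mu> using \<mu> by (simp add: frostman_measure_def)
  interpret F: frostman "distr \<mu> borel (\<lambda>x. x)" s C L
    by (rule fr) (simp add: orthogonal_transformation_id)
  interpret pair_prob_space \<mu> \<mu> ..
  have m: "(\<lambda>p. (fst p - snd p) /\<^sub>R norm (fst p - snd p)) \<in> borel_measurable (\<mu> \<Otimes>\<^sub>M \<mu>)"
    using measurable_direction[of \<mu> E] \<mu> by (simp add: frostman_measure_def split_beta')
  have fs [measurable]: "fst \<in> \<mu> \<Otimes>\<^sub>M \<mu> \<rightarrow>\<^sub>M borel" "snd \<in> \<mu> \<Otimes>\<^sub>M \<mu> \<rightarrow>\<^sub>M borel"
    by (rule measurable_compose[OF measurable_fst id(1)], rule measurable_compose[OF measurable_snd id(1)])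
  have dm: "direction_measure (distr \<mu> borel (\<lambda>x. x)) = direction_measure \<mu>"
    by (rule direction_measure_distr_id[OF \<mu>.prob_space_axioms id(1)])
  interpret N: prob_space "direction_measure \<mu>"
    using prob_space_direction_measure[OF F.frostman_axioms] by (simp add: dm)
  have "AE y in \<mu>. y \<noteq> x" for x
  proof -
    have "emeasure (distr \<mu> borel (\<lambda>x. x)) {x} = 0"
      using F.null_singleton s d by (simp add: of_nat_diff)
    then have "AE y in distr \<mu> borel (\<lambda>x. x). y \<noteq> x"
      by (intro AE_I[of _ _ "{x}"]) auto
    then show ?thesis using AE_distrD[OF id(1)] by blast
  qed
  then have "AE y in \<mu>. x \<noteq> y" for x by (simp only: eq_commute[of x])
  then have "AE x in \<mu>. AE y in \<mu>. x \<noteq> y" by simp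
  then have "AE p in \<mu> \<Otimes>\<^sub>M \<mu>. fst p \<noteq> snd p"
    by (intro AE_pair_measure) (simp_all add: split_beta)
  then have "AE p in \<mu> \<Otimes>\<^sub>M \<mu>. (fst p - snd p) /\<^sub>R norm (fst p - snd p) \<in> B"
  proof (rule AE_mp, intro AE_I2 impI)
    fix p assume "p \<in> space (\<mu> \<Otimes>\<^sub>M \<mu>)" "fst p \<noteq> snd p"
    then have "fst p \<in> E" "snd p \<in> E" "fst p \<noteq> snd p"
      using id(2) by (auto simp: space_pair_measure)
    then have "(fst p - snd p) /\<^sub>R norm (fst p - snd p) \<in> directions E"
      unfolding directions_def by blast
    then show "(fst p - snd p) /\<^sub>R norm (fst p - snd p) \<in> B" using B(2) by blast
  qed
  then have "AE \<omega> in direction_measure \<mu>. \<omega> \<in> B"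
    unfolding direction_measure_eq by (subst AE_distr_iff[OF m]) simp_all
  then have "measure (direction_measure \<mu>) B = 1"
    by (subst N.prob_eq_1) simp_all
  moreover have "measure (direction_measure \<mu>) B = 0"
  proof -
    have "AE \<omega> in sphere_measure. \<omega> \<notin> B"
      using B by (intro AE_not_in) (simp add: null_sets_def)
    then have "AE \<omega> in sphere_measure. indicator B \<omega> * direction_density (distr \<mu> borel (\<lambda>x. x)) L \<omega> = 0"
      by eventually_elim simp
    from integral_eq_zero_AE[OF this] show ?thesis
      using F.direction_measure_density[OF d s B_borel] by (simp add: dm)
  qed
  ultimately show False by simp
qed

text \<open>
  The main term is the limit density times the limiting normalised area of caps, so its integral is
  \<open>sphere_cap_constant\<close> for every rotation, and the identity serves as \<open>\<Theta>\<^sub>0\<close>.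
\<close>

theorem theorem1p2:
  fixes E :: "(real ^ 'n) set" and s :: real and \<mu> :: "(real ^ 'n) measure"
  assumes d: "CARD('n) \<ge> 2"
    and dim: "hausdorff_dim E = ereal s"
    and s: "s > real CARD('n) - 1"
    and \<mu>: "frostman_measure s E \<mu>"
  shows
    "(\<exists>(M :: (real ^ 'n \<Rightarrow> real ^ 'n) \<Rightarrow> real ^ 'n \<Rightarrow> real)
        (R :: (real ^ 'n \<Rightarrow> real ^ 'n) \<Rightarrow> real \<Rightarrow> real ^ 'n \<Rightarrow> real).
        (\<forall>\<Theta>. orthogonal_transformation \<Theta> \<longrightarrow>
           (\<forall>\<epsilon>>0. \<forall>\<omega> \<in> sphere 0 1. direction_average (rotated_direction_measure \<Theta> E \<mu>) \<epsilon> \<omega> =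
                M \<Theta> \<omega> + R \<Theta> \<epsilon> \<omega>)) \<and>
        (\<exists>C>0. \<forall>\<Theta>. orthogonal_transformation \<Theta> \<longrightarrow> (\<forall>c>0.
           (\<lambda>\<omega>. SUP \<epsilon> \<in> {0<..<c}. ennreal \<bar>R \<Theta> \<epsilon> \<omega>\<bar>) \<in> borel_measurable sphere_measure \<and>
           (\<integral>\<^sup>+\<omega>. (SUP \<epsilon> \<in> {0<..<c}. ennreal \<bar>R \<Theta> \<epsilon> \<omega>\<bar>) \<partial>sphere_measure)
             \<le> ennreal (C * c powr (s - (real CARD('n) - 1))))) \<and>
        (\<exists>C>0. \<forall>\<Theta>. orthogonal_transformation \<Theta> \<longrightarrow>
           integrable sphere_measure (M \<Theta>) \<and> (\<integral>\<omega>. M \<Theta> \<omega> \<partial>sphere_measure) \<le> C) \<and>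
        (\<exists>\<Theta>\<^sub>0. orthogonal_transformation \<Theta>\<^sub>0 \<and>
           (\<exists>C>0. 1 \<le> C * (\<integral>\<omega>. M \<Theta>\<^sub>0 \<omega> \<partial>sphere_measure)))) \<and>
     outer_measure_of sphere_measure (directions E) > 0"
proof -
  have DIM: "DIM(real ^ 'n) = CARD('n)" by simp
  have d': "DIM(real ^ 'n) \<ge> 2" using d unfolding DIM .
  have exponent: "real (DIM(real ^ 'n) - 1) = real CARD('n) - 1" unfolding DIM using d by (simp add: of_nat_diff)
  have s': "s > real (DIM(real ^ 'n) - 1)" using s unfolding exponent .
  obtain C L where L: "0 < L" and fr: "\<And>\<Theta> :: real ^ 'n \<Rightarrow> real ^ 'n. orthogonal_transformation \<Theta> \<Longrightarrow> frostman (distr \<mu> borel \<Theta>) s C L"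
    using frostman_measure_rotations[OF \<mu>] by blast
  define v where "v = sphere_cap_constant TYPE(real ^ 'n)"
  have v: "v > 0" unfolding v_def by (rule sphere_cap_constant_pos)
  let ?\<mu> = "\<lambda>\<Theta>. distr \<mu> borel \<Theta>"
  define M where "M \<Theta> \<omega> = v * direction_density (?\<mu> \<Theta>) L \<omega>" for \<Theta> :: "real ^ 'n \<Rightarrow> real ^ 'n" and \<omega>
  define R where "R \<Theta> \<epsilon> \<omega> = direction_average (direction_measure (?\<mu> \<Theta>)) \<epsilon> \<omega> - M \<Theta> \<omega>"
    for \<Theta> :: "real ^ 'n \<Rightarrow> real ^ 'n" and \<epsilon> \<omega>
  have "\<exists>K>0. \<forall>\<mu>' :: (real ^ 'n) measure. frostman \<mu>' s C L \<longrightarrow> (\<forall>c>0.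
    (\<integral>\<^sup>+\<omega>. (SUP \<epsilon>\<in>{0<..<c}. ennreal \<bar>direction_average (direction_measure \<mu>') \<epsilon> \<omega> -
        v * direction_density \<mu>' L \<omega>\<bar>) \<partial>sphere_measure) \<le> ennreal (K * c powr (s - (real CARD('n) - 1))))"
    using maximal_remainder_estimate[OF d' L s', of C] unfolding exponent v_def .
  then obtain K where K: "K > 0" "\<forall>\<mu>' :: (real ^ 'n) measure. frostman \<mu>' s C L \<longrightarrow> (\<forall>c>0.
    (\<integral>\<^sup>+\<omega>. (SUP \<epsilon>\<in>{0<..<c}. ennreal \<bar>direction_average (direction_measure \<mu>') \<epsilon> \<omega> -
        v * direction_density \<mu>' L \<omega>\<bar>) \<partial>sphere_measure) \<le> ennreal (K * c powr (s - (real CARD('n) - 1))))"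
    by (elim exE conjE)
  have M_int: "integrable sphere_measure (M \<Theta>)" "(\<integral>\<omega>. M \<Theta> \<omega> \<partial>sphere_measure) = v"
    if "orthogonal_transformation \<Theta>" for \<Theta> :: "real ^ 'n \<Rightarrow> real ^ 'n"
  proof -
    interpret frostman "?\<mu> \<Theta>" s C L by (rule fr[OF that])
    show "integrable sphere_measure (M \<Theta>)"
      unfolding M_def using direction_density_integrable(1)[OF d' s'] by simp
    show "(\<integral>\<omega>. M \<Theta> \<omega> \<partial>sphere_measure) = v"
      unfolding M_def using direction_density_integral(1)[OF d' s'] by simp
  qed
  have R_meas: "(\<lambda>\<omega>. SUP \<epsilon> \<in> {0<..<c}. ennreal \<bar>R \<Theta> \<epsilon> \<omega>\<bar>) \<in> borel_measurable sphere_measure"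
    if "orthogonal_transformation \<Theta>" for \<Theta> :: "real ^ 'n \<Rightarrow> real ^ 'n" and c
  proof -
    interpret frostman "?\<mu> \<Theta>" s C L by (rule fr[OF that])
    interpret N: prob_space "direction_measure (?\<mu> \<Theta>)" by (rule prob_space_direction_measure[OF frostman_axioms])
    show ?thesis
      unfolding R_def M_def
      by (intro borel_measurable_sphere_measure average_remainder_sup_measurable N.finite_measure_axioms) simp_all
  qed
  have id: "orthogonal_transformation (\<lambda>x :: real ^ 'n. x)" by (simp add: orthogonal_transformation_id)
  show ?thesis
  proof (intro conjI exI[of _ M] exI[of _ R] allI impI ballI)
    show "direction_average (rotated_direction_measure \<Theta> E \<mu>) \<epsilon> \<omega> = M \<Theta> \<omega> + R \<Theta> \<epsilon> \<omega>"
      if "orthogonal_transformation \<Theta>" for \<Theta> \<epsilon> \<omega>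
      unfolding rotated_direction_measure_eq[OF \<mu> that] by (simp add: R_def)
    show "\<exists>C>0. \<forall>\<Theta>. orthogonal_transformation \<Theta> \<longrightarrow> (\<forall>c>0.
           (\<lambda>\<omega>. SUP \<epsilon> \<in> {0<..<c}. ennreal \<bar>R \<Theta> \<epsilon> \<omega>\<bar>) \<in> borel_measurable sphere_measure \<and>
           (\<integral>\<^sup>+\<omega>. (SUP \<epsilon> \<in> {0<..<c}. ennreal \<bar>R \<Theta> \<epsilon> \<omega>\<bar>) \<partial>sphere_measure)
             \<le> ennreal (C * c powr (s - (real CARD('n) - 1))))"
      using K(1) R_meas K(2)[rule_format, OF fr] by (intro exI[of _ K]) (simp add: R_def M_def)
    show "\<exists>C>0. \<forall>\<Theta>. orthogonal_transformation \<Theta> \<longrightarrow>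
           integrable sphere_measure (M \<Theta>) \<and> (\<integral>\<omega>. M \<Theta> \<omega> \<partial>sphere_measure) \<le> C"
      using v M_int by (intro exI[of _ v]) auto
    show "\<exists>\<Theta>\<^sub>0. orthogonal_transformation \<Theta>\<^sub>0 \<and> (\<exists>C>0. 1 \<le> C * (\<integral>\<omega>. M \<Theta>\<^sub>0 \<omega> \<partial>sphere_measure))"
      using v M_int(2)[OF id] id by (intro exI[of _ "\<lambda>x. x"] conjI exI[of _ "1 / v"]) auto
    show "outer_measure_of sphere_measure (directions E) > 0"
      by (rule outer_measure_directions_pos[OF \<mu> d' s'])
  qed
qed

end
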